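(* Let $\{(N_k,B_k)\}_{k=1}^m$ be finitely many admissible pairs in $\mathbb{R}$, where $B_k=\{0,1,\dots,b_k-1\}$ with $b_k\in\mathbb{N}_+$ for each $1\le k\le m$, let $\mathbf n=\{n_k\}_{k=1}^\infty$ be a sequence of positive integers, let $\Omega=\{1,\dots,m\}^\infty$, and let $\mathbb{P}$ be a Borel probability measure on $\Omega$. For $\omega=\omega_1\omega_2\cdots\in\Omega$ let $$\mu^{\mathbf n}(\omega)=\delta_{N_{\omega_1}^{-n_1}B_{\omega_1}}*\delta_{N_{\omega_1}^{-n_1}N_{\omega_2}^{-n_2}B_{\omega_2}}*\cdots,\qquad \mu(\omega)=\delta_{N_{\omega_1}^{-1}B_{\omega_1}}*\delta_{N_{\omega_1}^{-1}N_{\omega_2}^{-1}B_{\omega_2}}*\cdots,$$ and let $$\mathcal{E}'_m=\{t\in\mathbb{N}_+:\gcd(t,b_k)=1\text{ for all }1\le k\le m\}.$$ If $\mu(\omega)$ is non-degenerate for $\mathbb{P}$-a.e. $\omega\in\Omega$, then $\mu^{\mathbf n}$ is a spectral random measure $\mathbb{P}$-a.e., and $\mathcal{E}'_m$ is an $\aleph_1$-spectral eigen set of $\mu^{\mathbf n}$ $\mathbb{P}$-a.e.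
   Context: For a nonempty finite $D\subset\mathbb{R}$, $\delta_D=\frac{1}{\#D}\sum_{a\in D}\delta_a$. Infinite convolutions are weak limits of the corresponding finite convolutions; those above exist for every $\omega\in\Omega$, and $(\omega,B)\mapsto\mu^{\mathbf n}(\omega)(B)$ is a random measure, denoted $\mu^{\mathbf n}$ (i.e. measurable in $\omega$ for each Borel $B$ and a measure in $B$ for each $\omega$). $\Omega$ has the metric $d(\alpha,\beta)=2^{-|\alpha\wedge\beta|}$ for $\alpha\neq\beta$, $|\alpha\wedge\beta|$ being the length of the longest common prefix. Admissible pair: an integer $N\ge2$ and a finite $B\subset\mathbb{Z}$ with $\#B\ge2$ form an admissible pair $(N,B)$ if there is $L\subset\mathbb{Z}$ such that the matrix $\left[\frac{1}{\sqrt{\#B}}e^{-2\pi i bl/N}\right]_{b\in B,\,l\in L}$ is unitary. Non-degenerate: for $k\ge1$ put $\nu_{>k}(\omega)=\delta_{N_{\omega_{k+1}}^{-1}B_{\omega_{k+1}}}*\delta_{(N_{\omega_{k+1}}N_{\omega_{k+2}})^{-1}B_{\omega_{k+2}}}*\cdots$. $\mu(\omega)$ is non-degenerate if some subsequence $\{\nu_{>k_j}(\omega)\}_{j=1}^\infty$ converges weakly to a measure singular to Lebesgue measure. A Borel probability measure $\eta$ on $\mathbb{R}$ is a spectral measure if there is a countable $\Lambda\subset\mathbb{R}$ (a spectrum of $\eta$) such that $\{e^{-2\pi i\lambda x}:\lambda\in\Lambda\}$ is an orthonormal basis of $L^2(\eta)$. A random measure $M$ on $\mathbb{R}$ is a spectral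 random measure $\mathbb{P}$-a.e. if $M(\omega)$ is a spectral measure for $\mathbb{P}$-a.e. $\omega$. A set $\mathcal{E}\subset\mathbb{R}$ containing $1$ is an $\aleph_1$-spectral eigen set of $M$ $\mathbb{P}$-a.e. if for $\mathbb{P}$-a.e. $\omega\in\Omega$ there exist uncountably many subsets $\Lambda_\omega\subset\mathbb{R}$ such that $t\Lambda_\omega$ is a spectrum of $M(\omega)$ for all $t\in\mathcal{E}$. *)

theory Defs
  imports "HOL-Probability.Probability"
begin

text \<open>
  Sequences indexed by \<open>1, 2, \<dots>\<close> on paper are functions on \<^typ>\<open>nat\<close> starting at \<open>0\<close>:
  \<open>\<omega> i\<close> is the letter \<open>\<omega>\<^sub>i\<^sub>+\<^sub>1\<close>, and \<open>n i\<close> is the exponent \<open>n\<^sub>i\<^sub>+\<^sub>1\<close>.  The letters themselves are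
  \<open>1, \<dots>, m\<close>.
\<close>

section \<open>The symbolic space\<close>

definition words :: "nat \<Rightarrow> (nat \<Rightarrow> nat) set" where
  "words m = {\<omega>. \<forall>i. \<omega> i \<in> {1..m}}"

text \<open>For \<open>\<alpha> \<noteq> \<beta>\<close> the first index (counted from \<open>0\<close>) where they differ is the length of
  their longest common prefix.\<close>

definition word_dist :: "(nat \<Rightarrow> nat) \<Rightarrow> (nat \<Rightarrow> nat) \<Rightarrow> real" where
  "word_dist \<alpha> \<beta> = (if \<alpha> = \<beta> then 0 else (1 / 2) ^ (LEAST i. \<alpha> i \<noteq> \<beta> i))"

lemma Metric_space_words: "Metric_space (words m) word_dist"
proof
  fix x y z :: "nat \<Rightarrow> nat"
  show "0 \<le> word_dist x y"
    by (simp add: word_dist_def)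
  show "word_dist x y = word_dist y x"
    unfolding word_dist_def by (simp add: eq_commute)
  show "(word_dist x y = 0) = (x = y)"
    by (simp add: word_dist_def)
  show "word_dist x z \<le> word_dist x y + word_dist y z"
  proof (cases "x = y \<or> y = z \<or> x = z")
    case True
    then show ?thesis by (auto simp: word_dist_def)
  next
    case False
    let ?l = "\<lambda>a b. LEAST i. (a::nat \<Rightarrow> nat) i \<noteq> b i"
    define k where "k = ?l x z"
    have "\<exists>i. x i \<noteq> z i"
      using False by (simp add: fun_eq_iff)
    then have k: "x k \<noteq> z k" "k = ?l x z"
      unfolding k_def by (rule LeastI_ex, simp)
    have "?l x y \<le> k \<or> ?l y z \<le> k"
      using k(1) by (cases "x k = y k") (auto intro: Least_le)
    then have "(1/2::real) ^ k \<le> (1/2) ^ ?l x y \<or> (1/2::real) ^ k \<le> (1/2) ^ ?l y z"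
      by (auto intro: power_decreasing)
    moreover have "(0::real) \<le> (1/2) ^ ?l x y" "(0::real) \<le> (1/2) ^ ?l y z"
      by auto
    ultimately have "(1/2::real) ^ k \<le> (1/2) ^ ?l x y + (1/2) ^ ?l y z"
      by linarith
    then show ?thesis
      using False by (simp add: word_dist_def k(2))
  qed
qed

definition borel_words :: "nat \<Rightarrow> (nat \<Rightarrow> nat) measure" where
  "borel_words m =
     sigma (words m) {U. openin (Metric_space.mtopology (words m) word_dist) U}"


section \<open>Infinite convolutions of discrete measures\<close>

text \<open>\<open>\<delta>\<^sub>D\<close>, as a Borel measure.  The set \<open>D\<close> is meant to be finite and nonempty.\<close>

definition unif :: "real set \<Rightarrow> real measure" where
  "unif D = distr (measure_pmf (pmf_of_set D)) borel (\<lambda>x. x)"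

primrec conv_upto :: "(nat \<Rightarrow> real measure) \<Rightarrow> nat \<Rightarrow> real measure" where
  "conv_upto \<nu> 0 = \<nu> 0"
| "conv_upto \<nu> (Suc k) = convolution (conv_upto \<nu> k) (\<nu> (Suc k))"

definition inf_convolution :: "(nat \<Rightarrow> real measure) \<Rightarrow> real measure" where
  "inf_convolution \<nu> = (THE \<eta>. real_distribution \<eta> \<and> weak_conv_m (conv_upto \<nu>) \<eta>)"

lemma real_distribution_unif: "real_distribution (unif D)"
  unfolding unif_def
  by (intro prob_space.real_distribution_distr) (auto simp: measure_pmf.prob_space_axioms)

lemma real_distribution_conv_upto:
  assumes "\<And>j. real_distribution (\<nu> j)"
  shows "real_distribution (conv_upto \<nu> k)"
proof (induction k)
  case 0
  then show ?case using assms by simp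
next
  case (Suc k)
  interpret A: real_distribution "conv_upto \<nu> k" by (rule Suc)
  interpret B: real_distribution "\<nu> (Suc k)" by (rule assms)
  interpret P: pair_prob_space "conv_upto \<nu> k" "\<nu> (Suc k)" ..
  show ?case
    unfolding conv_upto.simps convolution_def
    by (intro prob_space.real_distribution_distr P.prob_space_axioms) simp
qed

text \<open>The weak limit is unique, so the description above picks it out whenever it exists.\<close>

lemma inf_convolution_eqI:
  assumes \<nu>: "\<And>j. real_distribution (\<nu> j)"
    and \<eta>: "real_distribution \<eta>" "weak_conv_m (conv_upto \<nu>) \<eta>"
  shows "inf_convolution \<nu> = \<eta>"
  unfolding inf_convolution_def
proof (rule the_equality)
  show "real_distribution \<eta> \<and> weak_conv_m (conv_upto \<nu>) \<eta>"
    using \<eta> by simp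
next
  fix \<eta>' assume \<eta>': "real_distribution \<eta>' \<and> weak_conv_m (conv_upto \<nu>) \<eta>'"
  have *: "(\<lambda>k. char (conv_upto \<nu> k) t) \<longlonglongrightarrow> char \<eta> t"
    "(\<lambda>k. char (conv_upto \<nu> k) t) \<longlonglongrightarrow> char \<eta>' t" for t
    using levy_continuity1[OF real_distribution_conv_upto[OF \<nu>]] \<eta> \<eta>' by auto
  have "char \<eta>' = char \<eta>"
    using LIMSEQ_unique[OF *(2) *(1)] by (rule ext)
  then show "\<eta>' = \<eta>"
    using Levy_uniqueness \<eta>(1) \<eta>' by blast
qed

text \<open>The convolution of the measures \<open>\<delta>\<^bsub>N\<^sub>\<omega>\<^sub>1\<^bsup>-n\<^sub>1\<^esup>\<cdots>N\<^sub>\<omega>\<^sub>j\<^bsup>-n\<^sub>j\<^esup> B\<^sub>\<omega>\<^sub>j\<^esub>\<close> over \<open>j = 1, 2, \<dots>\<close>.\<close>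

definition mu_exp ::
    "(nat \<Rightarrow> int) \<Rightarrow> (nat \<Rightarrow> int set) \<Rightarrow> (nat \<Rightarrow> nat) \<Rightarrow> (nat \<Rightarrow> nat) \<Rightarrow> real measure" where
  "mu_exp N B n \<omega> = inf_convolution
     (\<lambda>j. unif ((\<lambda>b. inverse (\<Prod>i\<le>j. real_of_int (N (\<omega> i)) ^ n i) * real_of_int b) ` B (\<omega> j)))"

text \<open>\<open>\<nu>\<^sub>>\<^sub>k(\<omega>)\<close>; its leading letter \<open>\<omega>\<^sub>k\<^sub>+\<^sub>1\<close> is \<open>\<omega> k\<close>.\<close>

definition nu_gt ::
    "(nat \<Rightarrow> int) \<Rightarrow> (nat \<Rightarrow> int set) \<Rightarrow> nat \<Rightarrow> (nat \<Rightarrow> nat) \<Rightarrow> real measure" where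
  "nu_gt N B k \<omega> = inf_convolution
     (\<lambda>j. unif ((\<lambda>b. inverse (\<Prod>i\<le>j. real_of_int (N (\<omega> (k + i)))) * real_of_int b) ` B (\<omega> (k + j))))"

definition mutually_singular :: "'a measure \<Rightarrow> 'a measure \<Rightarrow> bool" where
  "mutually_singular M M' \<longleftrightarrow>
     (\<exists>A \<in> sets M \<inter> sets M'. emeasure M A = 0 \<and> emeasure M' (space M' - A) = 0)"

text \<open>Non-degeneracy of \<open>\<mu>(\<omega>)\<close>, the measure with all exponents \<open>1\<close>.  It is a property of
  the word \<open>\<omega>\<close>: it only involves the tails \<open>\<nu>\<^sub>>\<^sub>k(\<omega>)\<close>.\<close>

definition nondegenerate ::
    "(nat \<Rightarrow> int) \<Rightarrow> (nat \<Rightarrow> int set) \<Rightarrow> (nat \<Rightarrow> nat) \<Rightarrow> bool" where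
  "nondegenerate N B \<omega> \<longleftrightarrow>
     (\<exists>r \<rho>. strict_mono r \<and> (\<forall>j. 1 \<le> r j) \<and> real_distribution \<rho> \<and>
        weak_conv_m (\<lambda>j. nu_gt N B (r j) \<omega>) \<rho> \<and> mutually_singular \<rho> lborel)"


section \<open>Admissible pairs\<close>

definition unitary_matrix :: "'a set \<Rightarrow> 'b set \<Rightarrow> ('a \<Rightarrow> 'b \<Rightarrow> complex) \<Rightarrow> bool" where
  "unitary_matrix I J H \<longleftrightarrow> finite I \<and> finite J \<and> card I = card J \<and>
     (\<forall>i\<in>I. \<forall>i'\<in>I. (\<Sum>j\<in>J. H i j * cnj (H i' j)) = (if i = i' then 1 else 0)) \<and>
     (\<forall>j\<in>J. \<forall>j'\<in>J. (\<Sum>i\<in>I. cnj (H i j) * H i j') = (if j = j' then 1 else 0))"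

definition admissible_pair :: "int \<Rightarrow> int set \<Rightarrow> bool" where
  "admissible_pair N B \<longleftrightarrow> N \<ge> 2 \<and> finite B \<and> card B \<ge> 2 \<and>
     (\<exists>L :: int set. unitary_matrix B L
        (\<lambda>b l. complex_of_real (1 / sqrt (real (card B))) *
               exp (- 2 * complex_of_real pi * \<i> * of_int b * of_int l / of_int N)))"


section \<open>Spectral measures\<close>

definition L2_functions :: "'a measure \<Rightarrow> ('a \<Rightarrow> complex) set" where
  "L2_functions M = {f \<in> borel_measurable M. integrable M (\<lambda>x. (cmod (f x))\<^sup>2)}"

definition L2_inner :: "'a measure \<Rightarrow> ('a \<Rightarrow> complex) \<Rightarrow> ('a \<Rightarrow> complex) \<Rightarrow> complex" where
  "L2_inner M f g = (\<integral>x. f x * cnj (g x) \<partial>M)"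

definition L2_norm :: "'a measure \<Rightarrow> ('a \<Rightarrow> complex) \<Rightarrow> real" where
  "L2_norm M f = sqrt (\<integral>x. (cmod (f x))\<^sup>2 \<partial>M)"

text \<open>An orthonormal family whose linear span is dense in \<open>L\<^sup>2(M)\<close>.\<close>

definition L2_orthonormal_basis :: "'a measure \<Rightarrow> 'i set \<Rightarrow> ('i \<Rightarrow> 'a \<Rightarrow> complex) \<Rightarrow> bool" where
  "L2_orthonormal_basis M I e \<longleftrightarrow>
     (\<forall>i\<in>I. e i \<in> L2_functions M) \<and>
     (\<forall>i\<in>I. \<forall>j\<in>I. L2_inner M (e i) (e j) = (if i = j then 1 else 0)) \<and>
     (\<forall>f\<in>L2_functions M. \<forall>\<epsilon>>0. \<exists>F c. finite F \<and> F \<subseteq> I \<and>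
        L2_norm M (\<lambda>x. f x - (\<Sum>i\<in>F. c i * e i x)) < \<epsilon>)"

definition is_spectrum :: "real measure \<Rightarrow> real set \<Rightarrow> bool" where
  "is_spectrum \<eta> \<Lambda> \<longleftrightarrow> countable \<Lambda> \<and>
     L2_orthonormal_basis \<eta> \<Lambda>
       (\<lambda>l x. exp (- 2 * complex_of_real pi * \<i> * complex_of_real l * complex_of_real x))"

definition spectral_measure :: "real measure \<Rightarrow> bool" where
  "spectral_measure \<eta> \<longleftrightarrow> real_distribution \<eta> \<and> (\<exists>\<Lambda>. is_spectrum \<eta> \<Lambda>)"

definition random_measure :: "'w measure \<Rightarrow> ('w \<Rightarrow> real measure) \<Rightarrow> bool" where
  "random_measure P M \<longleftrightarrow> (\<forall>\<omega>\<in>space P. sets (M \<omega>) = sets borel) \<and>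
     (\<forall>A\<in>sets borel. (\<lambda>\<omega>. emeasure (M \<omega>) A) \<in> borel_measurable P)"

definition spectral_random_measure :: "'w measure \<Rightarrow> ('w \<Rightarrow> real measure) \<Rightarrow> bool" where
  "spectral_random_measure P M \<longleftrightarrow> random_measure P M \<and> (AE \<omega> in P. spectral_measure (M \<omega>))"

definition aleph1_spectral_eigen_set ::
    "'w measure \<Rightarrow> ('w \<Rightarrow> real measure) \<Rightarrow> real set \<Rightarrow> bool" where
  "aleph1_spectral_eigen_set P M E \<longleftrightarrow> 1 \<in> E \<and>
     (AE \<omega> in P. uncountable {\<Lambda>. \<forall>t\<in>E. is_spectrum (M \<omega>) ((\<lambda>l. t * l) ` \<Lambda>)})"

definition coprime_multipliers :: "nat \<Rightarrow> (nat \<Rightarrow> nat) \<Rightarrow> real set" where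
  "coprime_multipliers m b = {real t | t :: nat. t > 0 \<and> (\<forall>k\<in>{1..m}. coprime t (b k))}"

end

theory Submission
  imports Defs
begin

text \<open>
  Fix a word \<open>\<omega>\<close> and write \<open>M\<^sub>j = N\<^sub>\<omega>\<^sub>j ^ n\<^sub>j\<close> and \<open>c\<^sub>j = b\<^sub>\<omega>\<^sub>j\<close>.  For consecutive digits admissibility means
  \<open>c\<^sub>j dvd M\<^sub>j\<close>; put \<open>q\<^sub>j = M\<^sub>j div c\<^sub>j\<close>.  The Fourier transform of the measure is an infinite product of
  masks.  A finite set \<open>X\<close> of integers is a spectrum of the \<open>k\<close>-th partial convolution for all admissible
  multipliers \<open>t\<close> at once as soon as it arises by repeatedly adding the digit sets
  \<open>M\<^sub>1 \<cdots> M\<^sub>j\<^sub>-\<^sub>1 q\<^sub>j {0, \<dots>, c\<^sub>j - 1}\<close> and by moving elements by multiples of \<open>M\<^sub>1 \<cdots> M\<^sub>k\<close>.  The union of an increasing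
  sequence of such sets \<open>X\<^sub>i\<close> of level \<open>k\<^sub>i\<close>, scaled by \<open>t\<close>, is a spectrum of the infinite convolution if the
  tail product beyond level \<open>k\<^sub>i\<close> is bounded below on \<open>t X\<^sub>i\<close> for infinitely many \<open>i\<close>.  For a given \<open>t\<close> this
  is achieved by moving the new elements so that \<open>t x / (M\<^sub>1 \<cdots> M\<^sub>k)\<close> is close to an integer that is not a zero
  of the tail product; such an integer of bounded size exists if the product of boundedly many of the
  next quotients \<open>q\<^sub>j\<close> exceeds \<open>t\<close>.  Non-degeneracy provides infinitely many such levels: otherwise the
  limits of the tails would have Lipschitz distribution functions.  Each \<open>t\<close> is served
  infinitely often, and translates of one set give uncountably many.
\<close>

subsection \<open>Admissible pairs with consecutive digits\<close>

text \<open>The obstacle is that the transform of a tail vanishes at many integers. If every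
  quotient is \<open>1\<close>, the measure is Lebesgue measure on the unit interval, all nonzero
  integers are zeros, and for \<open>t > 1\<close> the multiple \<open>t X\<close> of a spectrum
  \<open>X\<close> is too sparse to be one. Quotients whose product exceeds \<open>t\<close>
  guarantee that every residue class modulo \<open>t\<close> contains an integer that is not a zero.
  Different multipliers ask for different translations at the same level, so they cannot all be
  served there. Serving each one infinitely often is enough: at a good level the partial transforms
  have total squared mass \<open>1\<close>, their mass outside a finite set is at most a constant
  times that of the infinite measure, and the latter is small by Bessel's inequality. The constant
  must not depend on the level; it comes from the bounded size of the integer and from radices that
  grow at least like powers of \<open>2\<close>. Coprimality with the digit counts is used twice:
  multiplication by \<open>t\<close> then permutes residues in Parseval's identity, and a product of
  digit counts can be prescribed as a factor of the sought integer without restricting its class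
  modulo \<open>t\<close>.\<close>

lemma cis_2pi_eq_1_iff: "cis (2 * pi * x) = 1 \<longleftrightarrow> x \<in> \<int>"
proof
  assume "cis (2 * pi * x) = 1"
  then have "cos (2 * pi * x) = 1" by (simp add: complex_eq_iff)
  then obtain k :: int where "2 * pi * x = k * 2 * pi"
    by (auto simp: cos_one_2pi_int)
  then have "x = k" by simp
  then show "x \<in> \<int>" by simp
next
  assume "x \<in> \<int>"
  then show "cis (2 * pi * x) = 1" by (auto elim!: Ints_cases)
qed

lemma sum_cis_eq_0_iff:
  assumes "b > 0"
  shows "(\<Sum>d<b. cis (2 * pi * x) ^ d) = 0 \<longleftrightarrow> x \<notin> \<int> \<and> b * x \<in> \<int>"
proof (cases "x \<in> \<int>")
  case True
  then show ?thesis using assms by (simp add: cis_2pi_eq_1_iff[THEN iffD2])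
next
  case False
  have "cis (2 * pi * x) ^ b = cis (2 * pi * (b * x))"
    by (simp add: Complex.DeMoivre algebra_simps)
  then show ?thesis
    using False geometric_sum[of "cis (2 * pi * x)" b]
    by (auto simp: cis_2pi_eq_1_iff)
qed

text \<open>Orthogonality of columns says that for distinct \<open>l\<close>, \<open>l'\<close> in
  \<open>L\<close> the integer \<open>N\<close> divides \<open>b * (l - l')\<close> but not
  \<open>l - l'\<close>. With \<open>g = gcd N b\<close> and \<open>d = N / g\<close>, all of
  \<open>L\<close> lies in one class modulo \<open>d\<close>, and the quotients by \<open>d\<close>
  are distinct modulo \<open>g\<close>. Counting gives \<open>b \<le> g\<close>, hence
  \<open>g = b\<close>.\<close>

lemma admissible_pair_dvd:
  assumes "admissible_pair N {0..int b - 1}"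
  shows "int b dvd N"
proof -
  define h where "h = (\<lambda>x l :: int. complex_of_real (1 / sqrt (real (card {0..int b - 1}))) *
               exp (- 2 * complex_of_real pi * \<i> * of_int x * of_int l / of_int N))"
  obtain L :: "int set" where N: "N \<ge> 2" and b2: "b \<ge> 2"
    and L: "unitary_matrix {0..int b - 1} L h"
    using assms unfolding admissible_pair_def h_def by auto
  have finL: "finite L" and cardL: "card L = b"
    using L by (auto simp: unitary_matrix_def)
  have h_eq: "h x l = complex_of_real (1 / sqrt b) * cis (- (2 * pi * x * l / N))" for x l
    unfolding h_def cis_conv_exp by (simp add: algebra_simps)
  have key: "int b * (l - l') mod N = 0 \<and> (l - l') mod N \<noteq> 0"
    if "l \<in> L" "l' \<in> L" "l \<noteq> l'" for l l'
  proof -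
    have "(\<Sum>x\<in>{0..int b - 1}. cnj (h x l) * h x l') = 0"
      using L that unfolding unitary_matrix_def by auto
    also have "(\<Sum>x\<in>{0..int b - 1}. cnj (h x l) * h x l') = (\<Sum>d<b. cnj (h (int d) l) * h (int d) l')"
      by (rule sum.reindex_bij_witness[of _ int nat]) auto
    also have "\<dots> = (\<Sum>d<b. cis (2 * pi * ((l - l') / N)) ^ d / b)"
    proof (rule sum.cong)
      fix d
      have "complex_of_real (1 / sqrt b) * complex_of_real (1 / sqrt b) = 1 / b"
        by (metis of_real_divide of_real_mult of_real_of_nat_eq of_real_1 real_sqrt_mult_self
            abs_of_nat times_divide_times_eq mult_1)
      moreover have "cis (2 * pi * real_of_int (int d) * l / N) * cis (- (2 * pi * real_of_int (int d) * l' / N))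
          = cis (2 * pi * ((l - l') / N)) ^ d"
        unfolding Complex.DeMoivre cis_mult using N by (intro arg_cong[of _ _ cis]) (simp add: field_simps)
      ultimately show "cnj (h (int d) l) * h (int d) l' = cis (2 * pi * ((l - l') / N)) ^ d / b"
        unfolding h_eq
        by (simp add: cis_cnj mult.assoc mult.left_commute[of "cis _"])
    qed simp
    also have "\<dots> = (\<Sum>d<b. cis (2 * pi * ((l - l') / N)) ^ d) / b"
      by (simp add: sum_divide_distrib)
    finally have "(\<Sum>d<b. cis (2 * pi * ((l - l') / N)) ^ d) = 0"
      using b2 by simp
    moreover have "b > 0" using b2 by simp
    ultimately have *: "(l - l') / N \<notin> \<int>" "b * ((l - l') / N) \<in> \<int>"
      using sum_cis_eq_0_iff[of b "(l - l') / N"] by (simp_all only: conj_commute) metis+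
    have dvd_iff: "N dvd z \<longleftrightarrow> real_of_int z / N \<in> \<int>" for z
      using N by (auto simp: of_int_divide_in_Ints elim!: Ints_cases simp: field_simps)
         (metis dvd_triv_right mult.commute of_int_eq_iff of_int_mult)
    have "\<not> N dvd (l - l')" "N dvd int b * (l - l')"
      using * by (simp_all add: dvd_iff)
    then show ?thesis by presburger
  qed
  define g where "g = gcd N (int b)"
  have g: "g > 0" unfolding g_def using N by simp
  define d where "d = N div g"
  have Nd: "N = g * d" by (simp add: d_def g_def)
  then have d: "d > 0" using N g zero_less_mult_pos by (metis less_le_trans zero_less_numeral)
  have dl: "d dvd l - l'" if "l \<in> L" "l' \<in> L" for l l'
  proof (cases "l = l'")
    case False
    have "g * d dvd int b * (l - l')" using key[OF that False] Nd by auto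
    also have "int b * (l - l') = g * ((int b div g) * (l - l'))"
      by (simp add: g_def mult.assoc[symmetric])
    finally have "d dvd (int b div g) * (l - l')" using g by simp
    moreover have "coprime d (int b div g)"
      unfolding d_def g_def using N by (intro div_gcd_coprime) auto
    ultimately show ?thesis by (simp add: coprime_dvd_mult_right_iff)
  qed simp
  obtain l0 where l0: "l0 \<in> L" using cardL b2 by fastforce
  have "inj_on (\<lambda>l. ((l - l0) div d) mod g) L"
  proof (rule inj_onI, rule ccontr)
    fix l l' assume l: "l \<in> L" "l' \<in> L" "l \<noteq> l'"
      and eq: "((l - l0) div d) mod g = ((l' - l0) div d) mod g"
    then have "g dvd (l - l0) div d - (l' - l0) div d" by (simp add: mod_eq_dvd_iff)
    then have "d * g dvd d * ((l - l0) div d - (l' - l0) div d)" by simp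
    also have "d * ((l - l0) div d - (l' - l0) div d) = l - l'"
      using dl l l0 by (simp add: right_diff_distrib)
    finally show False using key[OF l] Nd by (simp add: mult.commute dvd_eq_mod_eq_0)
  qed
  moreover have "(\<lambda>l. ((l - l0) div d) mod g) ` L \<subseteq> {0..<g}" using g by auto
  ultimately have "b \<le> card {0..<g}" using cardL card_inj_on_le by blast
  then have "int b \<le> g" using g by simp
  moreover have "g dvd int b" by (simp add: g_def)
  ultimately have "g = int b" using b2 zdvd_imp_le by fastforce
  then show ?thesis by (metis g_def gcd_dvd1)
qed

subsection \<open>Masks\<close>

text \<open>Characteristic function at \<open>2 * pi * x\<close> of the uniform distribution on
  \<open>b\<close> consecutive digits, kept as a geometric sum so that its modulus becomes a
  quotient of sines.\<close>

definition mask :: "nat \<Rightarrow> real \<Rightarrow> complex" where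
  "mask b x = (\<Sum>d<b. cis (2 * pi * x) ^ d) / b"

lemma mask_0 [simp]: "b > 0 \<Longrightarrow> mask b 0 = 1"
  by (simp add: mask_def)

lemma cmod_mask_le_1: "cmod (mask b x) \<le> 1"
proof -
  have "cmod (\<Sum>d<b. cis (2 * pi * x) ^ d) \<le> (\<Sum>d<b. 1)"
    by (rule order_trans[OF norm_sum]) (simp add: norm_power)
  then show ?thesis by (cases "b = 0") (simp_all add: mask_def norm_divide)
qed

lemma mask_add_int: "k \<in> \<int> \<Longrightarrow> mask b (x + k) = mask b x"
  by (simp add: mask_def distrib_left cis_mult[symmetric] cis_2pi_eq_1_iff[THEN iffD2])

lemma cmod_1_minus_cis: "cmod (1 - cis (2 * x)) = 2 * \<bar>sin x\<bar>"
proof -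
  have "1 - cis (2 * x) = cis x * (cis (- x) - cis x)"
    by (simp add: right_diff_distrib cis_mult)
  moreover have "cis (- x) - cis x = - (2 * \<i> * sin x)"
    by (simp add: complex_eq_iff)
  ultimately show ?thesis by (simp add: norm_mult)
qed

text \<open>In modulus the geometric sum is the Dirichlet kernel
  \<open>sin (pi * y) / (b * sin (pi * y / b))\<close>. Only the denominator is estimated, by
  \<open>|sin x| \<le> |x|\<close>, so the bound is uniform in \<open>b\<close>.\<close>

lemma cmod_mask_ge_sin:
  assumes "b > 0" "y \<noteq> 0"
  shows "\<bar>sin (pi * y)\<bar> / (pi * \<bar>y\<bar>) \<le> cmod (mask b (y / b))"
proof (cases "y / b \<in> \<int>")
  case True
  then have "mask b (y / b) = 1"
    using mask_add_int[of "y / b" b 0] assms by simp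
  then show ?thesis using abs_sin_x_le_abs_x[of "pi * y"] assms
    by (simp add: abs_mult)
next
  case False
  let ?w = "cis (2 * (pi * (y / b)))"
  have w: "?w \<noteq> 1" using False cis_2pi_eq_1_iff[of "y / b"] by (simp add: mult.assoc)
  have "mask b (y / b) = (1 - ?w ^ b) / (1 - ?w) / b"
    unfolding mask_def using w by (simp add: sum_gp_strict mult.assoc)
  also have "?w ^ b = cis (2 * (pi * y))" using assms by (simp add: Complex.DeMoivre)
  finally have eq: "cmod (mask b (y / b)) = \<bar>sin (pi * y)\<bar> / \<bar>sin (pi * (y / b))\<bar> / b"
    by (simp only: norm_divide cmod_1_minus_cis) simp
  have "sin (pi * (y / b)) \<noteq> 0"
    using w cmod_1_minus_cis[of "pi * (y / b)"] by auto
  moreover have "\<bar>sin (pi * (y / b))\<bar> * b \<le> pi * \<bar>y\<bar>"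
    using abs_sin_x_le_abs_x[of "pi * (y / b)"] assms by (simp add: field_simps abs_mult)
  ultimately show ?thesis unfolding eq using assms
    by (auto intro!: divide_left_mono simp: divide_divide_eq_left)
qed

lemma sin_ge_cubic: "0 \<le> x \<Longrightarrow> x - x ^ 3 / 6 \<le> sin (x::real)"
proof -
  assume x: "0 \<le> x"
  have "\<bar>sin x - (\<Sum>m<3. sin_coeff m * x ^ m)\<bar> \<le> inverse (fact 3) * \<bar>x\<bar> ^ 3"
    by (rule Maclaurin_sin_bound)
  moreover have "(\<Sum>m<3. sin_coeff m * x ^ m) = x"
    by (simp add: eval_nat_numeral sin_coeff_def)
  moreover have "inverse (fact 3) * \<bar>x\<bar> ^ 3 = x ^ 3 / 6"
    using x by (simp add: eval_nat_numeral field_simps)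
  ultimately show ?thesis by (simp only: abs_le_iff) linarith
qed

lemma pi_squared_less: "pi\<^sup>2 < 10"
proof -
  have "pi * pi < 3.15 * 3.15"
    using pi_approx pi_gt_zero by (intro mult_strict_mono) auto
  then show ?thesis by (simp add: power2_eq_square)
qed

text \<open>The cubic Taylor bound for the sine gives \<open>1 - pi^2 * y^2 / 6\<close>, and
  \<open>pi^2 < 10\<close> turns this into the rational constant \<open>5 / 3\<close>. Quadratic
  decay makes infinite products of such factors easy to bound below.\<close>

lemma cmod_mask_ge_quadratic:
  assumes "b > 0"
  shows "1 - 5 / 3 * y\<^sup>2 \<le> cmod (mask b (y / b))"
proof (cases "y = 0")
  case False
  have "pi * \<bar>y\<bar> - (pi * \<bar>y\<bar>) ^ 3 / 6 \<le> \<bar>sin (pi * \<bar>y\<bar>)\<bar>"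
    using sin_ge_cubic[of "pi * \<bar>y\<bar>"] by simp
  then have "(pi * \<bar>y\<bar> - (pi * \<bar>y\<bar>) ^ 3 / 6) / (pi * \<bar>y\<bar>) \<le> \<bar>sin (pi * \<bar>y\<bar>)\<bar> / (pi * \<bar>y\<bar>)"
    by (intro divide_right_mono) auto
  also have "(pi * \<bar>y\<bar> - (pi * \<bar>y\<bar>) ^ 3 / 6) / (pi * \<bar>y\<bar>) = 1 - pi\<^sup>2 * y\<^sup>2 / 6"
    using False by (simp add: field_simps power2_eq_square power3_eq_cube)
  also have "\<bar>sin (pi * \<bar>y\<bar>)\<bar> = \<bar>sin (pi * y)\<bar>" by (cases "y \<ge> 0") auto
  also have "\<bar>sin (pi * y)\<bar> / (pi * \<bar>y\<bar>) \<le> cmod (mask b (y / b))"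
    by (rule cmod_mask_ge_sin[OF assms False])
  finally have "1 - pi\<^sup>2 * y\<^sup>2 / 6 \<le> cmod (mask b (y / b))" .
  moreover have "pi\<^sup>2 * y\<^sup>2 \<le> 10 * y\<^sup>2"
    using pi_squared_less by (intro mult_right_mono) auto
  ultimately show ?thesis by simp
qed (use assms in simp)

text \<open>Subtracting the nearest integer leaves \<open>v\<close> with
  \<open>|v| \<le> 1/2\<close>, where the cubic bound gives
  \<open>sin (pi * |v|) \<ge> (1 - 10/24) * pi * |v| \<ge> |v|\<close>.\<close>

lemma abs_sin_pi_ge:
  fixes y :: real
  assumes "\<And>k::int. \<eta> \<le> \<bar>y - k\<bar>" "\<eta> \<ge> 0"
  shows "\<eta> \<le> \<bar>sin (pi * y)\<bar>"
proof -
  define v :: real where "v = y - of_int (round y)"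
  have v: "\<bar>v\<bar> \<le> 1/2" unfolding v_def using of_int_round_abs_le[of y] by (simp add: abs_minus_commute)
  have "\<eta> \<le> \<bar>v\<bar>" unfolding v_def by (rule assms)
  have "sin (pi * y) = sin (pi * v + pi * round y)" by (simp add: v_def algebra_simps)
  then have "\<bar>sin (pi * y)\<bar> = \<bar>sin (pi * v)\<bar>"
    by (simp add: sin_add abs_mult)
  also have "\<bar>sin (pi * v)\<bar> = \<bar>sin (pi * \<bar>v\<bar>)\<bar>" by (cases "v \<ge> 0") auto
  also have "\<dots> = sin (pi * \<bar>v\<bar>)"
    using v mult_left_le[of "\<bar>v\<bar>" pi] by (intro abs_of_nonneg sin_ge_zero) auto
  finally have "\<bar>sin (pi * y)\<bar> = sin (pi * \<bar>v\<bar>)" .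
  moreover have "pi * \<bar>v\<bar> - (pi * \<bar>v\<bar>) ^ 3 / 6 \<le> sin (pi * \<bar>v\<bar>)" by (rule sin_ge_cubic) simp
  moreover have "(pi * \<bar>v\<bar>) ^ 3 / 6 \<le> (10 / 4) / 6 * (pi * \<bar>v\<bar>)"
  proof -
    have "pi\<^sup>2 * v\<^sup>2 \<le> 10 * (1/2)\<^sup>2"
      using pi_squared_less v power_mono[of "\<bar>v\<bar>" "1/2" 2] by (intro mult_mono) auto
    then have "(pi\<^sup>2 * v\<^sup>2) * (pi * \<bar>v\<bar>) \<le> 10 / 4 * (pi * \<bar>v\<bar>)"
      by (intro mult_right_mono) (auto simp: power2_eq_square)
    moreover have "(pi * \<bar>v\<bar>) ^ 3 = (pi\<^sup>2 * v\<^sup>2) * (pi * \<bar>v\<bar>)"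
      by (cases "v \<ge> 0") (auto simp: power2_eq_square power3_eq_cube)
    ultimately show ?thesis by linarith
  qed
  moreover have "3 * \<bar>v\<bar> \<le> pi * \<bar>v\<bar>" using pi_gt3 by (intro mult_right_mono) auto
  ultimately show ?thesis using \<open>\<eta> \<le> \<bar>v\<bar>\<close> abs_ge_zero[of v] by linarith
qed

text \<open>Parseval's identity on the integers modulo \<open>b\<close>. After expanding the
  squares, an off-diagonal pair of digits contributes a full geometric sum with ratio
  \<open>cis (2 * pi * t * (d - d') / b)\<close>; coprimality keeps this ratio different from
  \<open>1\<close>, so the sum vanishes.\<close>

lemma sum_cmod_mask_sq:
  assumes "b > 0" "coprime t b"
  shows "(\<Sum>a<b. (cmod (mask b (y + real t * real a / b)))\<^sup>2) = 1"
proof -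
  define w where "w = (\<lambda>x. cis (2 * pi * x))"
  have w_add: "w (x + x') = w x * w x'" for x x' by (simp add: w_def distrib_left cis_mult)
  have w_pow: "w x ^ n = w (n * x)" for x n by (simp add: w_def Complex.DeMoivre algebra_simps)
  have w_cnj: "cnj (w x) = w (- x)" for x by (simp add: w_def cis_cnj)
  have orth: "(\<Sum>a<b. w (real a * (real t * (real d - real d') / b))) = (if d = d' then of_nat b else 0)"
    if "d < b" "d' < b" for d d'
  proof (cases "d = d'")
    case False
    have "real t * (real d - real d') / b \<notin> \<int>"
    proof
      assume "real t * (real d - real d') / b \<in> \<int>"
      then obtain k :: int where "real t * (real d - real d') / b = k" by (auto elim: Ints_cases)
      then have "real_of_int (int t * (int d - int d')) = real_of_int (k * int b)"
        using assms(1) by (simp add: field_simps)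
      then have "int b dvd int t * (int d - int d')" by (metis dvd_triv_right of_int_eq_iff)
      then have "int b dvd int d - int d'"
        using assms(2) by (simp add: coprime_dvd_mult_right_iff coprime_commute)
      then show False using that False zdvd_imp_le[of "int b" "int d - int d'"]
          zdvd_imp_le[of "int b" "int d' - int d"] dvd_diff_commute[of "int b"] by fastforce
    qed
    moreover have "b * (real t * (real d - real d') / b) \<in> \<int>" using assms(1) by simp
    ultimately have "(\<Sum>a<b. w (real t * (real d - real d') / b) ^ a) = 0"
      unfolding w_def sum_cis_eq_0_iff[OF assms(1)] by blast
    then show ?thesis using False by (simp only: w_pow if_False)
  qed (simp add: w_def)
  have sq: "complex_of_real ((cmod (mask b x))\<^sup>2) = (\<Sum>d<b. \<Sum>d'<b. w ((real d - real d') * x)) / b\<^sup>2" for x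
  proof -
    have m: "mask b x = (\<Sum>d<b. w (d * x)) / b"
      unfolding mask_def w_pow[symmetric] by (simp add: w_def)
    have "complex_of_real ((cmod (mask b x))\<^sup>2) = mask b x * cnj (mask b x)"
      by (rule complex_norm_square)
    also have "\<dots> = (\<Sum>d<b. w (d * x)) * (\<Sum>d'<b. w (- (d' * x))) / b\<^sup>2"
      unfolding m by (simp add: w_cnj power2_eq_square)
    also have "(\<Sum>d<b. w (d * x)) * (\<Sum>d'<b. w (- (d' * x))) = (\<Sum>d<b. \<Sum>d'<b. w ((real d - real d') * x))"
      by (simp add: sum_product w_add[symmetric] left_diff_distrib)
    finally show ?thesis .
  qed
  have "complex_of_real (\<Sum>a<b. (cmod (mask b (y + real t * real a / b)))\<^sup>2)
      = (\<Sum>a<b. \<Sum>d<b. \<Sum>d'<b. w ((real d - real d') * (y + real t * real a / b))) / b\<^sup>2"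
    by (simp only: of_real_sum sq sum_divide_distrib)
  also have "(\<Sum>a<b. \<Sum>d<b. \<Sum>d'<b. w ((real d - real d') * (y + real t * real a / b)))
      = (\<Sum>d<b. \<Sum>d'<b. \<Sum>a<b. w ((real d - real d') * (y + real t * real a / b)))"
    by (subst sum.swap, rule sum.cong[OF refl], rule sum.swap)
  also have "\<dots> = (\<Sum>d<b. \<Sum>d'<b. w ((real d - real d') * y) *
        (\<Sum>a<b. w (real a * (real t * (real d - real d') / b))))"
    by (simp add: sum_distrib_left w_add[symmetric] algebra_simps)
  also have "\<dots> = (\<Sum>d<b. \<Sum>d'<b. w ((real d - real d') * y) * (if d = d' then of_nat b else 0))"
    by (intro sum.cong refl) (simp only: orth lessThan_iff)
  also have "\<dots> = (\<Sum>d<b. \<Sum>d'<b. if d = d' then of_nat b else 0)"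
    by (intro sum.cong refl) (simp add: w_def)
  also have "\<dots> = of_nat b ^ 2" by (simp add: power2_eq_square)
  finally have "complex_of_real (\<Sum>a<b. (cmod (mask b (y + real t * real a / b)))\<^sup>2) = 1"
    using assms(1) by simp
  then show ?thesis by (metis of_real_eq_1_iff)
qed

text \<open>Characteristic function, at \<open>2 * pi * x\<close>, of the convolution of the first
  \<open>k\<close> factors. \<open>conv_upto\<close> at index \<open>k\<close> already has
  \<open>k + 1\<close> factors, so the two indices differ by one; here \<open>k = 0\<close> is the
  empty product.\<close>

definition mask_prod :: "(nat \<Rightarrow> nat) \<Rightarrow> (nat \<Rightarrow> nat) \<Rightarrow> nat \<Rightarrow> real \<Rightarrow> complex" where
  "mask_prod M c k x = (\<Prod>j<k. mask (c j) (x / real (\<Prod>i<Suc j. M i)))"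

lemma prod_lessThan_add:
  fixes f :: "nat \<Rightarrow> 'a::comm_monoid_mult"
  shows "(\<Prod>i<K + L. f i) = (\<Prod>i<K. f i) * (\<Prod>i<L. f (K + i))"
  by (induction L) (simp_all add: mult.assoc)

text \<open>Weierstrass' product inequality: summable deviations from \<open>1\<close> leave a
  product bounded away from \<open>0\<close>.\<close>

lemma prod_one_minus_ge:
  fixes a :: "nat \<Rightarrow> real"
  assumes "\<And>i. 0 \<le> a i" "\<And>i. a i \<le> 1"
  shows "1 - (\<Sum>i<n. a i) \<le> (\<Prod>i<n. 1 - a i)"
proof (induction n)
  case (Suc n)
  have "0 \<le> (\<Prod>i<n. 1 - a i)" "(\<Prod>i<n. 1 - a i) \<le> 1"
    using assms by (auto intro!: prod_nonneg prod_le_1)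
  then have "(\<Prod>i<n. 1 - a i) * a n \<le> a n" using assms(1) by (simp add: mult_left_le_one_le)
  with Suc show ?case by (simp add: algebra_simps)
qed simp

text \<open>One fixed word with its exponents absorbed into \<open>M\<close>. The parameter
  \<open>q\<close> records that the digit count divides the radix. The value \<open>q j = 1\<close>
  is allowed, so degenerate stretches are covered; only later lemmas ask for large products of
  quotients.\<close>

locale digit_system =
  fixes M c q :: "nat \<Rightarrow> nat"
  assumes M_eq: "M j = c j * q j"
    and c_ge: "c j \<ge> 2"
    and q_pos: "q j > 0"
begin

lemma c_pos: "c j > 0"
  using c_ge[of j] by simp

lemma M_ge: "M j \<ge> 2"
  unfolding M_eq using mult_le_mono[OF c_ge[of j], of 1 "q j"] q_pos[of j] by simp

lemma radix_ge: "2 ^ k \<le> (\<Prod>i<k. M i)"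
proof (induction k)
  case (Suc k)
  then show ?case using mult_le_mono[OF Suc M_ge[of k]] by (simp add: mult.commute)
qed simp

lemma radix_pos: "(\<Prod>i<k. M i) > 0"
  using radix_ge[of k] by (metis less_le_trans zero_less_numeral zero_less_power)

lemma shift: "digit_system (\<lambda>i. M (K + i)) (\<lambda>i. c (K + i)) (\<lambda>i. q (K + i))"
  by unfold_locales (rule M_eq c_ge q_pos)+

lemma mask_prod_add:
  "mask_prod M c (K + L) x = mask_prod M c K x *
     mask_prod (\<lambda>i. M (K + i)) (\<lambda>i. c (K + i)) L (x / real (\<Prod>i<K. M i))"
  unfolding mask_prod_def prod_lessThan_add add_Suc_right[symmetric]
  by (simp only: of_nat_mult divide_divide_eq_left)

lemma cmod_mask_prod_le_1: "cmod (mask_prod M c k x) \<le> 1"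
  unfolding mask_prod_def prod_norm[symmetric]
  by (intro prod_le_1) (simp add: cmod_mask_le_1)

lemma mask_prod_add_radix:
  assumes "int (\<Prod>i<k. M i) dvd z"
  shows "mask_prod M c k (x + of_int z) = mask_prod M c k x"
  unfolding mask_prod_def
proof (rule prod.cong)
  fix j assume "j \<in> {..<k}"
  then have "(\<Prod>i<Suc j. M i) dvd (\<Prod>i<k. M i)" by (intro prod_dvd_prod_subset) auto
  then have "int (\<Prod>i<Suc j. M i) dvd z" using assms by (meson dvd_trans of_nat_dvd_iff)
  then obtain w where w: "z = int (\<Prod>i<Suc j. M i) * w" by blast
  have "real_of_int z / real (\<Prod>i<Suc j. M i) = w"
    unfolding w of_int_mult of_int_of_nat_eq using radix_pos[of "Suc j"] by (metis less_numeral_extra(3)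
      nonzero_mult_div_cancel_left of_nat_eq_0_iff)
  then show "mask (c j) ((x + real_of_int z) / real (\<Prod>i<Suc j. M i)) = mask (c j) (x / real (\<Prod>i<Suc j. M i))"
    unfolding add_divide_distrib by (simp only: mask_add_int Ints_of_int)
qed simp

text \<open>The zeros of the infinite mask product are the integers that violate the last claim at some
  level \<open>l\<close>.\<close>

lemma ex_cong_nonzero_level:
  fixes i :: int
  assumes t: "t > 0" "\<And>j. coprime t (c j)" and J: "t < (\<Prod>i<J. q i)"
    and b: "\<And>j. c j \<le> b"
  obtains n :: int where "int t dvd n - i" "\<bar>n\<bar> \<le> 2 * int t * int b ^ J"
    "\<And>l. int ((\<Prod>i<l. M i) * q l) dvd n \<Longrightarrow> int (\<Prod>i<Suc l. M i) dvd n"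
proof -
  \<comment> \<open>Level \<open>j\<close> separates two regimes. Below it the partial products of
    the \<open>q i\<close> divide \<open>t\<close>, hence are coprime to the digit counts. At
    \<open>j\<close> the product fails to divide \<open>t\<close>, so it cannot divide two integers
    that differ by \<open>t\<close>.\<close>
  define j where "j = (LEAST j. \<not> (\<Prod>i<Suc j. q i) dvd t)"
  have "\<not> (\<Prod>i<J. q i) dvd t" using J t(1) by (auto dest: dvd_imp_le)
  then have "J \<noteq> 0" by (cases J) simp_all
  then have J': "\<not> (\<Prod>i<Suc (J - 1). q i) dvd t" using \<open>\<not> (\<Prod>i<J. q i) dvd t\<close> by simp
  have j: "\<not> (\<Prod>i<Suc j. q i) dvd t"
    unfolding j_def by (rule LeastI[of "\<lambda>j. \<not> (\<Prod>i<Suc j. q i) dvd t", OF J'])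
  have "j \<le> J - 1"
    unfolding j_def by (rule Least_le[of "\<lambda>j. \<not> (\<Prod>i<Suc j. q i) dvd t", OF J'])
  with \<open>J \<noteq> 0\<close> have jJ: "j \<le> J" by simp
  have below: "(\<Prod>i<Suc l. q i) dvd t" if "l < j" for l
    using not_less_Least[of l "\<lambda>j. \<not> (\<Prod>i<Suc j. q i) dvd t"] that j_def by blast
  \<comment> \<open>As a factor of \<open>n\<close>, \<open>\<beta>\<close> supplies the digit
    counts needed at every level below \<open>j\<close>; being coprime to \<open>t\<close>, it
    leaves every class modulo \<open>t\<close> reachable.\<close>
  define \<beta> where "\<beta> = (\<Prod>i<j. c i)"
  have \<beta>: "coprime t \<beta>" unfolding \<beta>_def by (rule prod_coprime_right) (rule t(2))
  have "\<beta> \<le> (\<Prod>i<j. b)" unfolding \<beta>_def by (intro prod_mono) (use b in auto)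
  also have "\<dots> = b ^ j" by simp
  also have "\<dots> \<le> b ^ J" using jJ b[of 0] c_ge[of 0] by (intro power_increasing) auto
  finally have \<beta>_le: "\<beta> \<le> b ^ J" .
  define Q where "Q = (\<Prod>i<Suc j. q i)"
  obtain z where z: "int t dvd int \<beta> * z - i"
  proof -
    have "coprime (int \<beta>) (int t)" using \<beta> by (simp add: coprime_commute)
    then obtain u v where uv: "u * int \<beta> + v * int t = 1"
      using bezout_int[of "int \<beta>" "int t"] by auto
    have "int \<beta> * (u * i) - i = (u * int \<beta> + v * int t) * i - i - int t * (v * i)"
      by (simp add: algebra_simps)
    then have "int \<beta> * (u * i) - i = int t * (- (v * i))" unfolding uv by simp
    then show ?thesis using that by (metis dvd_triv_left)
  qed
  define r where "r = z mod int t"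
  have r: "0 \<le> r" "r < int t" using t(1) by (simp_all add: r_def)
  \<comment> \<open>Both candidates are congruent to \<open>z\<close> modulo \<open>t\<close>, and
    \<open>Q\<close> misses at least one of them. The second candidate causes the factor
    \<open>2\<close> in the bound for \<open>n\<close>.\<close>
  obtain n' where n': "n' = r \<or> n' = r + int t" "\<not> int Q dvd n'"
  proof (cases "int Q dvd r")
    case True
    have "\<not> int Q dvd r + int t"
    proof
      assume "int Q dvd r + int t"
      then have "int Q dvd int t" using True dvd_add_right_iff by blast
      then show False using j Q_def of_nat_dvd_iff by blast
    qed
    then show ?thesis using that by blast
  qed (use that in blast)
  define n where "n = int \<beta> * n'"
  show ?thesis
  proof
    have "int t dvd n' - z" using n'(1) by (auto simp: r_def mod_eq_dvd_iff[symmetric])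
    then have "int t dvd int \<beta> * (n' - z) + (int \<beta> * z - i)" using z by (intro dvd_add dvd_mult)
    then show "int t dvd n - i" by (simp add: n_def algebra_simps)
    have "\<bar>n\<bar> \<le> int (b ^ J) * (2 * int t)"
      unfolding n_def abs_mult using \<beta>_le n'(1) r by (intro mult_mono) auto
    then show "\<bar>n\<bar> \<le> 2 * int t * int b ^ J" by (simp add: ac_simps)
    fix l assume l: "int ((\<Prod>i<l. M i) * q l) dvd n"
    have M_prod: "(\<Prod>i<k. M i) = (\<Prod>i<k. c i) * (\<Prod>i<k. q i)" for k
      by (simp add: M_eq prod.distrib)
    show "int (\<Prod>i<Suc l. M i) dvd n"
    proof (cases "l < j")
      case True
      have "int (\<Prod>i<Suc l. c i) dvd n" unfolding n_def \<beta>_def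
        using True by (intro dvd_mult2) (simp only: of_nat_dvd_iff, intro prod_dvd_prod_subset, auto)
      moreover have "(\<Prod>i<l. M i) * q l = (\<Prod>i<l. c i) * (\<Prod>i<Suc l. q i)"
        by (simp add: M_prod)
      then have "int (\<Prod>i<Suc l. q i) dvd n" using l by (metis dvd_mult_right of_nat_mult)
      moreover have "coprime (\<Prod>i<Suc l. c i) (\<Prod>i<Suc l. q i)"
      proof -
        have "coprime (\<Prod>i<Suc l. c i) t"
          by (intro prod_coprime_left) (simp add: t(2) coprime_commute)
        then show ?thesis using below[OF True] coprime_divisors dvd_refl by blast
      qed
      then have "coprime (int (\<Prod>i<Suc l. c i)) (int (\<Prod>i<Suc l. q i))"
        by (simp only: coprime_int_iff)
      ultimately have "int (\<Prod>i<Suc l. c i) * int (\<Prod>i<Suc l. q i) dvd n"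
        by (intro divides_mult)
      then show ?thesis unfolding M_prod by simp
    next
      \<comment> \<open>From level \<open>j\<close> on the premise would force \<open>Q\<close> to
        divide \<open>n'\<close>, so the claim holds vacuously.\<close>
      case False
      have "(\<Prod>i<j. M i) * q j dvd (\<Prod>i<l. M i) * q l"
      proof (cases "l = j")
        case False
        with \<open>\<not> l < j\<close> have "(\<Prod>i<Suc j. M i) dvd (\<Prod>i<l. M i)"
          by (intro prod_dvd_prod_subset) auto
        moreover have "(\<Prod>i<j. M i) * q j dvd (\<Prod>i<Suc j. M i)" by (simp add: M_eq)
        ultimately show ?thesis by (meson dvd_mult2 dvd_trans)
      qed simp
      moreover have "(\<Prod>i<j. M i) * q j = \<beta> * Q" by (simp add: M_prod \<beta>_def Q_def)
      ultimately have "int \<beta> * int Q dvd int \<beta> * n'"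
        using l unfolding n_def by (metis dvd_trans of_nat_dvd_iff of_nat_mult)
      moreover have "\<beta> > 0" unfolding \<beta>_def by (intro prod_pos) (simp add: c_pos)
      ultimately have "int Q dvd n'" by simp
      with n'(2) show ?thesis by simp
    qed
  qed
qed

text \<open>If \<open>Q\<close> divides \<open>n\<close>, then by \<open>level\<close> the phase is
  an integer plus a perturbation by \<open>u\<close>, and the quadratic bound leaves
  \<open>1 - 5/3 * 9/16 = 1/16\<close>. Otherwise \<open>(n + u) / Q\<close> keeps distance
  \<open>1 / (4 * Q)\<close> from the integers, because a nonzero integer moved by at most
  \<open>3/4\<close> stays \<open>1/4\<close> away from \<open>0\<close>. For large \<open>Q\<close>
  the phase is small and the quadratic bound applies again; for \<open>Q < 4 * (R + 1)\<close> the
  sine bound gives the stated constant.\<close>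

lemma cmod_mask_ge_nonzero_level:
  fixes n :: int and u :: real
  assumes n: "\<bar>real_of_int n\<bar> \<le> R" and u: "\<bar>u\<bar> \<le> 3/4"
    and level: "int ((\<Prod>i<l. M i) * q l) dvd n \<Longrightarrow> int (\<Prod>i<Suc l. M i) dvd n"
  shows "1 / (16 * pi * (R + 1)\<^sup>2) \<le> cmod (mask (c l) ((n + u) / real (\<Prod>i<Suc l. M i)))"
proof -
  define Q where "Q = (\<Prod>i<l. M i) * q l"
  have Q: "Q > 0" using radix_pos q_pos by (simp add: Q_def del: prod_pos_nat_iff)
  have MQ: "(\<Prod>i<Suc l. M i) = Q * c l" by (simp add: Q_def M_eq)
  have R: "R \<ge> 0" using n by simp
  define \<epsilon> where "\<epsilon> = 1 / (16 * pi * (R + 1)\<^sup>2)"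
  have "1 * 1 \<le> pi * (R + 1)\<^sup>2" using R pi_gt3 by (intro mult_mono) auto
  then have \<epsilon>_le: "\<epsilon> \<le> 1 / 16" by (simp add: \<epsilon>_def field_simps)
  let ?y = "(n + u) / Q"
  have y: "(n + u) / real (\<Prod>i<Suc l. M i) = ?y / c l" unfolding MQ by simp
  have ge: "1 / 16 \<le> cmod (mask (c l) (v / c l))" if "\<bar>v\<bar> \<le> 3 / 4" for v
    using cmod_mask_ge_quadratic[OF c_pos, of v l] power_mono[OF that, of 2]
    by (simp add: power2_eq_square)
  show ?thesis
  proof (cases "int Q dvd n")
    case True
    then obtain k where k: "n = int (Q * c l) * k" using level MQ Q_def by (metis dvdE)
    have "?y / c l = (u / Q) / c l + of_int k"
      unfolding k using Q c_pos[of l] by (simp add: field_simps)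
    then have "mask (c l) (?y / c l) = mask (c l) ((u / Q) / c l)"
      by (simp only: mask_add_int Ints_of_int)
    moreover have "\<bar>u / Q\<bar> \<le> \<bar>u\<bar>"
      using Q by (simp add: abs_divide divide_le_eq mult_le_cancel_left1)
    with u have "\<bar>u / Q\<bar> \<le> 3 / 4" by linarith
    ultimately show ?thesis using ge[of "u / Q"] \<epsilon>_le unfolding y \<epsilon>_def by simp
  next
    case False
    have dist: "1 / (4 * Q) \<le> \<bar>?y - of_int k\<bar>" for k :: int
    proof -
      have "n - k * int Q \<noteq> 0" using False by (metis dvd_triv_right eq_iff_diff_eq_0)
      then have "1 \<le> \<bar>real_of_int (n - k * int Q)\<bar>" by linarith
      then have "1 / 4 \<le> \<bar>real_of_int (n - k * int Q) + u\<bar>" using u by linarith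
      moreover have "?y - of_int k = (real_of_int (n - k * int Q) + u) / Q"
        using Q by (simp add: field_simps)
      ultimately show ?thesis using Q by (simp add: abs_divide field_simps)
    qed
    have nu: "\<bar>n + u\<bar> \<le> R + 1" using n u by linarith
    show ?thesis
    proof (cases "4 * (R + 1) \<le> Q")
      case True
      then have "\<bar>?y\<bar> \<le> 3 / 4" using nu Q by (simp add: abs_divide divide_le_eq)
      then show ?thesis using ge[of ?y] \<epsilon>_le unfolding y \<epsilon>_def by simp
    next
      case Q_le: False
      have "1 / (4 * Q) \<le> \<bar>sin (pi * ?y)\<bar>" by (rule abs_sin_pi_ge[OF dist]) simp
      moreover have "1 / (16 * (R + 1)) \<le> 1 / (4 * Q)" using Q_le Q R by (intro divide_left_mono) auto
      ultimately have s: "1 / (16 * (R + 1)) \<le> \<bar>sin (pi * ?y)\<bar>" by linarith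
      have y0: "?y \<noteq> 0" using dist[of 0] Q by auto
      have "\<bar>?y\<bar> \<le> \<bar>n + u\<bar>" using Q by (simp add: abs_divide divide_le_eq mult_le_cancel_left1)
      then have "pi * \<bar>?y\<bar> \<le> pi * (R + 1)" using nu pi_ge_zero by (intro mult_left_mono) linarith+
      then have "1 / (16 * (R + 1)) / (pi * (R + 1)) \<le> \<bar>sin (pi * ?y)\<bar> / (pi * \<bar>?y\<bar>)"
        using s y0 R by (intro frac_le) auto
      also have "\<dots> \<le> cmod (mask (c l) (?y / c l))" by (rule cmod_mask_ge_sin[OF c_pos y0])
      finally show ?thesis unfolding y by (simp add: power2_eq_square ac_simps)
    qed
  qed
qed

text \<open>The first \<open>K\<close> factors are bounded one at a time; beyond them the radices
  are at least \<open>4 * (R + 1) * 2 ^ l\<close>, so the factors tend to \<open>1\<close>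
  geometrically and their product is at least \<open>1/2\<close>. The bound is free of
  \<open>L\<close>, so it survives the limit.\<close>

lemma mask_prod_lower_bound:
  fixes n :: int and u :: real
  assumes n: "\<bar>real_of_int n\<bar> \<le> R" and u: "\<bar>u\<bar> \<le> 3/4" and K: "4 * (R + 1) \<le> 2 ^ K"
    and level: "\<And>l. int ((\<Prod>i<l. M i) * q l) dvd n \<Longrightarrow> int (\<Prod>i<Suc l. M i) dvd n"
  shows "(1 / (16 * pi * (R + 1)\<^sup>2)) ^ K / 2 \<le> cmod (mask_prod M c L (n + u))"
proof -
  define f where "f = (\<lambda>l. cmod (mask (c l) ((n + u) / real (\<Prod>i<Suc l. M i))))"
  define \<epsilon> where "\<epsilon> = 1 / (16 * pi * (R + 1)\<^sup>2)"
  have R: "R \<ge> 0" using n by simp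
  have \<epsilon>: "\<epsilon> \<ge> 0" by (simp add: \<epsilon>_def)
  \<comment> \<open>\<open>5/48\<close> is the \<open>5/3\<close> of the quadratic bound times the
    square of \<open>1/4\<close>; the series of deviations then sums to at most
    \<open>5/36\<close>.\<close>
  have tail: "1 - 5 / 48 * (1 / 4) ^ l \<le> f (K + l)" for l
  proof -
    let ?Q = "real ((\<Prod>i<K + l. M i) * q (K + l))"
    have "2 ^ (K + l) \<le> (\<Prod>i<K + l. M i)" by (rule radix_ge)
    also have "\<dots> \<le> (\<Prod>i<K + l. M i) * q (K + l)" using q_pos[of "K + l"] by simp
    finally have "real (2 ^ (K + l)) \<le> ?Q" by (rule of_nat_mono)
    then have "2 ^ K * 2 ^ l \<le> ?Q" by (simp add: power_add)
    moreover have "4 * (R + 1) * 2 ^ l \<le> 2 ^ K * 2 ^ l" using K by (intro mult_right_mono) auto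
    ultimately have "4 * (R + 1) * 2 ^ l \<le> ?Q" by linarith
    moreover have "\<bar>n + u\<bar> \<le> R + 1" using n u by linarith
    then have "4 * \<bar>n + u\<bar> * 2 ^ l \<le> 4 * (R + 1) * 2 ^ l" by (intro mult_right_mono) auto
    ultimately have *: "4 * \<bar>n + u\<bar> * 2 ^ l \<le> ?Q" by linarith
    have "?Q > 0" unfolding of_nat_0_less_iff using radix_pos q_pos by (rule mult_pos_pos)
    with * have "\<bar>(n + u) / ?Q\<bar> \<le> 1 / 4 * (1 / 2) ^ l"
      by (simp add: abs_divide divide_le_eq power_divide le_divide_eq ac_simps)
    then have "\<bar>(n + u) / ?Q\<bar>\<^sup>2 \<le> (1 / 4 * (1 / 2) ^ l)\<^sup>2" by (intro power_mono) auto
    also have "\<dots> = 1 / 16 * (1 / 4) ^ l"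
      by (simp add: power2_eq_square power_mult_distrib[symmetric])
    finally have "1 - 5 / 48 * (1 / 4) ^ l \<le> 1 - 5 / 3 * ((n + u) / ?Q)\<^sup>2"
      unfolding power2_abs by linarith
    also have "\<dots> \<le> cmod (mask (c (K + l)) ((n + u) / ?Q / c (K + l)))"
      by (rule cmod_mask_ge_quadratic[OF c_pos])
    also have "(n + u) / ?Q / c (K + l) = (n + u) / real (\<Prod>i<Suc (K + l). M i)"
      by (simp add: M_eq ac_simps)
    finally show ?thesis unfolding f_def .
  qed
  have "(\<Sum>l<L. 5 / 48 * (1 / 4) ^ l) \<le> (1/2 :: real)"
  proof -
    have "(\<Sum>l<L. (1 / 4 :: real) ^ l) = (1 - (1 / 4) ^ L) / (1 - 1 / 4)"
      by (simp add: sum_gp_strict)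
    also have "\<dots> \<le> 4 / 3" by simp
    finally show ?thesis unfolding sum_distrib_left[symmetric] by linarith
  qed
  then have "1 / 2 \<le> 1 - (\<Sum>l<L. 5 / 48 * (1 / 4 :: real) ^ l)" by simp
  also have "\<dots> \<le> (\<Prod>l<L. 1 - 5 / 48 * (1 / 4) ^ l)"
  proof (rule prod_one_minus_ge)
    fix l
    have "(1 / 4 :: real) ^ l \<le> 1" by (intro power_le_one) auto
    then show "5 / 48 * (1 / 4 :: real) ^ l \<le> 1" by simp
  qed simp
  also have "\<dots> \<le> (\<Prod>l<L. f (K + l))"
  proof (intro prod_mono conjI tail)
    fix l
    have "(1 / 4 :: real) ^ l \<le> 1" by (intro power_le_one) auto
    then show "0 \<le> 1 - 5 / 48 * (1 / 4 :: real) ^ l" by simp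
  qed
  finally have "1 / 2 \<le> (\<Prod>l<L. f (K + l))" .
  moreover have "\<epsilon> ^ K \<le> (\<Prod>l<K. f l)"
  proof -
    have "\<epsilon> ^ K = (\<Prod>l<K. \<epsilon>)" by simp
    also have "\<dots> \<le> (\<Prod>l<K. f l)"
      unfolding f_def \<epsilon>_def
      by (intro prod_mono conjI cmod_mask_ge_nonzero_level[OF n u level]) (use \<epsilon> \<epsilon>_def in auto)
    finally show ?thesis .
  qed
  ultimately have "\<epsilon> ^ K * (1 / 2) \<le> (\<Prod>l<K. f l) * (\<Prod>l<L. f (K + l))"
    using \<epsilon> by (intro mult_mono prod_nonneg) (auto simp: f_def)
  \<comment> \<open>The estimate is proved for \<open>L + K\<close> factors; dropping the last
    \<open>K\<close> of them, each at most \<open>1\<close>, gives it for every \<open>L\<close>,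
    including \<open>L < K\<close>.\<close>
  also have "\<dots> = (\<Prod>l<L + K. f l)" by (subst add.commute) (simp only: prod_lessThan_add)
  also have "\<dots> = (\<Prod>l<L. f l) * (\<Prod>l<K. f (L + l))" by (rule prod_lessThan_add)
  also have "\<dots> \<le> (\<Prod>l<L. f l) * 1"
    by (intro mult_left_mono prod_le_1 prod_nonneg) (auto simp: f_def cmod_mask_le_1)
  also have "\<dots> = cmod (mask_prod M c L (n + u))" by (simp only: mask_prod_def f_def prod_norm mult_1_right)
  finally show ?thesis by (simp add: \<epsilon>_def)
qed

end

subsection \<open>Spectra of the partial convolutions\<close>

lemma mask_prod_Suc:
  "mask_prod M c (Suc k) x = mask_prod M c k x * mask (c k) (x / real (\<Prod>i<Suc k. M i))"
  unfolding mask_prod_def by (rule prod.lessThan_Suc)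

context digit_system
begin

text \<open>The Jorgensen-Pedersen criterion for \<open>t X\<close> to be a spectrum of the
  convolution of the first \<open>k\<close> factors, demanded for all admissible \<open>t\<close>
  together. As an identity in \<open>x\<close> it passes from one level to the next by factoring the
  sum.\<close>

definition level_spectrum :: "nat \<Rightarrow> int set \<Rightarrow> bool" where
  "level_spectrum k X \<longleftrightarrow> finite X \<and> (\<forall>t>0. (\<forall>j. coprime t (c j)) \<longrightarrow>
     (\<forall>x. (\<Sum>z\<in>X. (cmod (mask_prod M c k (x + real t * of_int z)))\<^sup>2) = 1))"

lemma level_spectrum_finite: "level_spectrum k X \<Longrightarrow> finite X"
  by (simp add: level_spectrum_def)

lemma level_spectrum_sum:
  assumes "level_spectrum k X" "t > 0" "\<And>j. coprime t (c j)"
  shows "(\<Sum>z\<in>X. (cmod (mask_prod M c k (x + real t * of_int z)))\<^sup>2) = 1"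
  using assms unfolding level_spectrum_def by blast

lemma mask_prod_0 [simp]: "mask_prod M c k 0 = 1"
  unfolding mask_prod_def using c_pos by (intro prod.neutral) auto

text \<open>Take \<open>x = - t z\<close> in the defining identity: the term of \<open>z\<close>
  alone is \<open>1\<close>, so every other term vanishes.\<close>

lemma level_spectrum_orthogonal:
  assumes "level_spectrum k X" "t > 0" "\<And>j. coprime t (c j)" "z \<in> X" "z' \<in> X" "z \<noteq> z'"
  shows "mask_prod M c k (real t * of_int (z' - z)) = 0"
proof -
  have fin: "finite X" using assms(1) by (rule level_spectrum_finite)
  let ?f = "\<lambda>y. (cmod (mask_prod M c k (real t * of_int (- z) + real t * of_int y)))\<^sup>2"
  have "sum ?f {z, z'} \<le> sum ?f X"
    using assms fin by (intro sum_mono2) auto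
  also have "sum ?f X = 1" using assms(1-3) by (rule level_spectrum_sum)
  finally have "?f z' \<le> 0" using assms(6) by simp
  then show ?thesis by (simp add: algebra_simps)
qed

text \<open>A difference divisible by the radix is a period of the partial transform, whose value
  there is \<open>1\<close>; orthogonality with \<open>t = 1\<close> would make it
  \<open>0\<close>.\<close>

lemma level_spectrum_cong_imp_eq:
  assumes "level_spectrum k X" "z \<in> X" "z' \<in> X" "int (\<Prod>i<k. M i) dvd z' - z"
  shows "z = z'"
proof (rule ccontr)
  assume "z \<noteq> z'"
  then have "mask_prod M c k (real 1 * of_int (z' - z)) = 0"
    using assms(1-3) by (intro level_spectrum_orthogonal) auto
  moreover have "mask_prod M c k (0 + of_int (z' - z)) = mask_prod M c k 0"
    using assms(4) by (rule mask_prod_add_radix)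
  ultimately show False by simp
qed

text \<open>Moving by periods changes no term of the sum, since \<open>t\<close> is an integer, and
  it cannot identify two elements because they are incongruent modulo the radix.\<close>

lemma level_spectrum_shift:
  assumes X: "level_spectrum k X" and f: "\<And>z. z \<in> X \<Longrightarrow> int (\<Prod>i<k. M i) dvd f z - z"
  shows "level_spectrum k (f ` X)"
  unfolding level_spectrum_def
proof (intro conjI allI impI)
  show "finite (f ` X)" using X by (simp add: level_spectrum_finite)
  have inj: "inj_on f X"
  proof (rule inj_onI)
    fix z z' assume z: "z \<in> X" "z' \<in> X" "f z = f z'"
    have "int (\<Prod>i<k. M i) dvd (f z - z) - (f z' - z')"
      using f[OF z(1)] f[OF z(2)] by (rule dvd_diff)
    then show "z = z'" using z by (intro level_spectrum_cong_imp_eq[OF X]) auto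
  qed
  fix t :: nat and x :: real
  assume t: "t > 0" "\<forall>j. coprime t (c j)"
  have "mask_prod M c k (x + real t * of_int (f z)) = mask_prod M c k (x + real t * of_int z)"
    if "z \<in> X" for z
  proof -
    have "mask_prod M c k (x + real t * of_int z + of_int (int t * (f z - z))) =
        mask_prod M c k (x + real t * of_int z)"
      using f[OF that] by (intro mask_prod_add_radix dvd_mult)
    then show ?thesis by (simp add: algebra_simps)
  qed
  then show "(\<Sum>z\<in>f ` X. (cmod (mask_prod M c k (x + real t * of_int z)))\<^sup>2) = 1"
    using level_spectrum_sum[OF X t(1)] t(2) by (simp add: sum.reindex[OF inj])
qed

lemma level_spectrum_0: "level_spectrum 0 {0}"
  by (simp add: level_spectrum_def mask_prod_def)

text \<open>A new digit \<open>a\<close> is a period of the first \<open>k\<close> factors and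
  shifts the phase of the last mask by \<open>t * a / c k\<close>. Summing over \<open>a\<close>
  first, Parseval's identity for that mask leaves the sum of level \<open>k\<close>.\<close>

lemma level_spectrum_Suc:
  assumes X: "level_spectrum k X"
  shows "level_spectrum (Suc k) ((\<lambda>(z, a). z + int ((\<Prod>i<k. M i) * q k * a)) ` (X \<times> {..<c k}))"
    (is "level_spectrum _ (?g ` _)")
  unfolding level_spectrum_def
proof (intro conjI allI impI)
  let ?A = "\<Prod>i<k. M i"
  have A: "?A > 0" by (rule radix_pos)
  show "finite (?g ` (X \<times> {..<c k}))" using X by (simp add: level_spectrum_finite)
  have inj: "inj_on ?g (X \<times> {..<c k})"
  proof (rule inj_onI, clarify)
    fix z a z' a' assume z: "z \<in> X" "z' \<in> X"
      and eq: "z + int (?A * q k * a) = z' + int (?A * q k * a')"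
    have "z' - z = int ?A * (int (q k) * (int a - int a'))"
      using eq by (simp add: algebra_simps)
    then have zz: "z = z'" using z by (intro level_spectrum_cong_imp_eq[OF X]) auto
    with eq have "?A * q k * a = ?A * q k * a'" by (simp only: add_left_cancel of_nat_eq_iff)
    moreover have "?A * q k > 0" using A q_pos by (rule mult_pos_pos)
    ultimately have "a = a'" by (metis mult_cancel1 less_irrefl)
    with zz show "z = z' \<and> a = a'" by blast
  qed
  fix t :: nat and x :: real
  assume t: "t > 0" "\<forall>j. coprime t (c j)"
  let ?P = "\<lambda>k y. (cmod (mask_prod M c k y))\<^sup>2"
  have step: "?P (Suc k) (x + real t * of_int (?g (z, a))) =
      ?P k (x + real t * of_int z) * (cmod (mask (c k) ((x + real t * of_int z) / real (\<Prod>i<Suc k. M i) + real t * real a / c k)))\<^sup>2" for z a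
  proof -
    let ?y = "x + real t * of_int (?g (z, a))"
    have y: "?y = x + real t * of_int z + of_int (int t * int (?A * q k * a))"
      by (simp add: algebra_simps)
    have "mask_prod M c k ?y = mask_prod M c k (x + real t * of_int z)"
      unfolding y by (rule mask_prod_add_radix) simp
    moreover have "?y / real (\<Prod>i<Suc k. M i) = (x + real t * of_int z) / real (\<Prod>i<Suc k. M i) + real t * real a / c k"
    proof -
      have "of_int (int t * int (?A * q k * a)) / real (\<Prod>i<Suc k. M i) = real (?A * q k) * (real t * real a) / (real (?A * q k) * c k)"
        by (simp add: M_eq ac_simps)
      also have "\<dots> = real t * real a / c k"
        using mult_pos_pos[OF A q_pos[of k]]
        by (intro mult_divide_mult_cancel_left) (metis less_irrefl of_nat_eq_0_iff)
      finally show ?thesis unfolding y add_divide_distrib by simp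
    qed
    ultimately show ?thesis
      unfolding mask_prod_Suc
      by (simp only: norm_mult power_mult_distrib)
  qed
  have "(\<Sum>z\<in>?g ` (X \<times> {..<c k}). ?P (Suc k) (x + real t * of_int z)) =
      (\<Sum>z\<in>X. \<Sum>a<c k. ?P (Suc k) (x + real t * of_int (?g (z, a))))"
    unfolding sum.reindex[OF inj] o_def sum.cartesian_product by (intro sum.cong refl) auto
  also have "\<dots> = (\<Sum>z\<in>X. ?P k (x + real t * of_int z) * 1)"
    unfolding step sum_distrib_left[symmetric]
    using t(2) by (simp only: sum_cmod_mask_sq[OF c_pos])
  also have "\<dots> = 1" using level_spectrum_sum[OF X t(1)] t(2) by simp
  finally show "(\<Sum>z\<in>?g ` (X \<times> {..<c k}). ?P (Suc k) (x + real t * of_int z)) = 1" .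
qed

lemma level_spectrum_extend:
  assumes "level_spectrum k X"
  shows "\<exists>X'. X \<subseteq> X' \<and> level_spectrum (k + d) X'"
proof (induction d)
  case (Suc d)
  then obtain X' where X': "X \<subseteq> X'" "level_spectrum (k + d) X'" by blast
  let ?Y = "(\<lambda>(z, a). z + int ((\<Prod>i<k + d. M i) * q (k + d) * a)) ` (X' \<times> {..<c (k + d)})"
  have "z \<in> ?Y" if "z \<in> X" for z
    using X'(1) that c_pos[of "k + d"] by (intro image_eqI[of _ _ "(z, 0)"]) auto
  with level_spectrum_Suc[OF X'(2)] show ?case by (intro exI[of _ ?Y]) auto
qed (use assms in auto)

text \<open>The order of quantifiers is the point: \<open>\<epsilon>\<close> depends on
  \<open>t\<close>, \<open>b\<close> and \<open>J\<close> only, so the same bound can recur at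
  arbitrarily high levels. Old elements stay in place because the next level can be chosen high
  enough to make their phases small; only new elements are moved.\<close>

lemma level_spectrum_extend_lower_bound:
  assumes t: "t > 0" "\<And>j. coprime t (c j)" and b: "\<And>j. c j \<le> b"
    and J: "\<And>K0. \<exists>K\<ge>K0. t < (\<Prod>i<J. q (K + i))"
  shows "\<exists>\<epsilon>>0. \<forall>k X r. level_spectrum k X \<longrightarrow> (\<exists>k'>k. \<exists>X'. X \<subseteq> X' \<and> level_spectrum k' X' \<and>
    (\<forall>z\<in>X'. \<forall>x. \<bar>x\<bar> \<le> r \<longrightarrow> (\<forall>L. \<epsilon> \<le> cmod (mask_prod (\<lambda>i. M (k' + i)) (\<lambda>i. c (k' + i)) L
       ((x + real t * of_int z) / real (\<Prod>i<k'. M i))))))"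
proof -
  \<comment> \<open>This is the size of the integers delivered by
    \<open>ex_cong_nonzero_level\<close>.\<close>
  define R where "R = 2 * real t * real b ^ J"
  have R: "R \<ge> 0" by (simp add: R_def)
  obtain K1 where K1: "4 * (R + 1) \<le> 2 ^ K1"
    using real_arch_pow[of 2 "4 * (R + 1)"] by (auto intro: less_imp_le)
  define \<epsilon> where "\<epsilon> = (1 / (16 * pi * (R + 1)\<^sup>2)) ^ K1 / 2"
  have "\<epsilon> > 0" unfolding \<epsilon>_def using R by (intro divide_pos_pos zero_less_power) auto
  moreover have "\<exists>k'>k. \<exists>X'. X \<subseteq> X' \<and> level_spectrum k' X' \<and>
    (\<forall>z\<in>X'. \<forall>x. \<bar>x\<bar> \<le> r \<longrightarrow> (\<forall>L. \<epsilon> \<le> cmod (mask_prod (\<lambda>i. M (k' + i)) (\<lambda>i. c (k' + i)) L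
       ((x + real t * of_int z) / real (\<Prod>i<k'. M i)))))" if X: "level_spectrum k X" for k X r
  proof -
    \<comment> \<open>\<open>C\<close> bounds \<open>x + t z\<close> for all \<open>z\<close> in
      \<open>X\<close>. A radix above \<open>4 * C\<close> puts these phases within
      \<open>1/4\<close> of \<open>0\<close>, so \<open>n = 0\<close> serves the old elements, as it
      is divisible by every radix.\<close>
    define C where "C = \<bar>r\<bar> + real t * (\<Sum>z\<in>X. \<bar>real_of_int z\<bar>)"
    obtain k0 where k0: "4 * C < 2 ^ k0" using real_arch_pow[of 2 "4 * C"] by auto
    obtain k' where k': "k' \<ge> k0 + Suc k" "t < (\<Prod>i<J. q (k' + i))" using J by blast
    define A where "A = (\<Prod>i<k'. M i)"
    interpret S: digit_system "\<lambda>i. M (k' + i)" "\<lambda>i. c (k' + i)" "\<lambda>i. q (k' + i)" by (rule shift)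
    have "(2::real) ^ k0 \<le> 2 ^ k'" using k' by (intro power_increasing) auto
    also have "\<dots> \<le> A" using radix_ge[of k'] unfolding A_def by (metis of_nat_le_iff of_nat_numeral of_nat_power)
    finally have A: "4 * C < A" using k0 by linarith
    have rC: "\<bar>r\<bar> \<le> C" unfolding C_def le_add_same_cancel1 by (intro mult_nonneg_nonneg sum_nonneg) auto
    then have "C \<ge> 0" by linarith
    with A have A0: "real A > 0" by linarith
    obtain X'' where X'': "X \<subseteq> X''" "level_spectrum k' X''"
      using level_spectrum_extend[OF X, of "k' - k"] k' by auto
    have "\<exists>y n. int A dvd y - z \<and> (z \<in> X \<longrightarrow> y = z) \<and> \<bar>real_of_int n\<bar> \<le> R \<and>
       (\<forall>x. \<bar>x\<bar> \<le> r \<longrightarrow> \<bar>(x + real t * of_int y) / A - of_int n\<bar> \<le> 3 / 4) \<and>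
       (\<forall>l. int ((\<Prod>i<l. M (k' + i)) * q (k' + l)) dvd n \<longrightarrow> int (\<Prod>i<Suc l. M (k' + i)) dvd n)" for z
    proof (cases "z \<in> X")
      case True
      have "\<bar>(x + real t * of_int z) / A\<bar> \<le> 3 / 4" if "\<bar>x\<bar> \<le> r" for x
      proof -
        have "\<bar>real_of_int z\<bar> \<le> (\<Sum>z\<in>X. \<bar>real_of_int z\<bar>)"
          using True level_spectrum_finite[OF X] by (intro member_le_sum) auto
        then have "real t * \<bar>real_of_int z\<bar> \<le> real t * (\<Sum>z\<in>X. \<bar>real_of_int z\<bar>)" by (intro mult_left_mono) auto
        moreover have "\<bar>x + real t * of_int z\<bar> \<le> \<bar>x\<bar> + real t * \<bar>real_of_int z\<bar>"
          by (rule order_trans[OF abs_triangle_ineq]) (simp add: abs_mult)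
        ultimately have "\<bar>x + real t * of_int z\<bar> \<le> C" using that unfolding C_def by linarith
        then show ?thesis using A A0 by (simp add: abs_divide divide_le_eq)
      qed
      then show ?thesis using R by (intro exI[of _ z] exI[of _ 0]) auto
    next
      case False
      \<comment> \<open>Replacing \<open>z\<close> by \<open>z + A * w\<close> shifts the phase by
        \<open>t * w = n - i\<close>, from the nearest integer \<open>i\<close> to \<open>n\<close>.
        Rounding costs \<open>1/2\<close> and the offset \<open>x / A\<close> at most
        \<open>1/4\<close>, which is the \<open>3/4\<close> allowed for \<open>u\<close>.\<close>
      define i where "i = round (real t * of_int z / A)"
      obtain n :: int where n: "int t dvd n - i" "\<bar>n\<bar> \<le> 2 * int t * int b ^ J"
        "\<And>l. int ((\<Prod>i<l. M (k' + i)) * q (k' + l)) dvd n \<Longrightarrow> int (\<Prod>i<Suc l. M (k' + i)) dvd n"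
        using S.ex_cong_nonzero_level[OF t(1) t(2) k'(2) b] by blast
      then obtain w where w: "n - i = int t * w" by blast
      have "\<bar>(x + real t * of_int (z + int A * w)) / A - of_int n\<bar> \<le> 3 / 4" if "\<bar>x\<bar> \<le> r" for x
      proof -
        have "(x + real t * of_int (z + int A * w)) / A = x / A + real t * of_int z / A + of_int (int t * w)"
          using A0 by (simp add: field_simps)
        then have "(x + real t * of_int (z + int A * w)) / A - of_int n = x / A - (i - real t * of_int z / A)"
          unfolding w[symmetric] by simp
        moreover have "\<bar>i - real t * of_int z / A\<bar> \<le> 1 / 2" unfolding i_def by (rule of_int_round_abs_le)
        moreover have "4 * \<bar>x\<bar> \<le> A" using that A rC by linarith
        then have "\<bar>x / A\<bar> \<le> 1 / 4" using A0 by (simp add: abs_divide divide_le_eq)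
        ultimately show ?thesis by linarith
      qed
      moreover have "R = of_int (2 * int t * int b ^ J)" by (simp add: R_def)
      then have "\<bar>real_of_int n\<bar> \<le> R"
        using n(2) by (simp only: of_int_abs[symmetric] of_int_le_iff)
      ultimately show ?thesis using False n(3)
        by (intro exI[of _ "z + int A * w"] exI[of _ n]) auto
    qed
    then obtain f g where fg: "\<And>z. int A dvd f z - z" "\<And>z. z \<in> X \<Longrightarrow> f z = z"
      "\<And>z. \<bar>real_of_int (g z)\<bar> \<le> R"
      "\<And>z x. \<bar>x\<bar> \<le> r \<Longrightarrow> \<bar>(x + real t * of_int (f z)) / A - of_int (g z)\<bar> \<le> 3 / 4"
      "\<And>z l. int ((\<Prod>i<l. M (k' + i)) * q (k' + l)) dvd g z \<Longrightarrow> int (\<Prod>i<Suc l. M (k' + i)) dvd g z"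
      by metis
    have "level_spectrum k' (f ` X'')"
      using X''(2) fg(1) unfolding A_def by (intro level_spectrum_shift)
    moreover have "X \<subseteq> f ` X''" using X''(1) fg(2) by force
    moreover have "\<epsilon> \<le> cmod (mask_prod (\<lambda>i. M (k' + i)) (\<lambda>i. c (k' + i)) L ((x + real t * of_int (f z)) / A))"
      if "\<bar>x\<bar> \<le> r" for x z L
    proof -
      have "\<epsilon> \<le> cmod (mask_prod (\<lambda>i. M (k' + i)) (\<lambda>i. c (k' + i)) L
          (g z + ((x + real t * of_int (f z)) / A - of_int (g z))))"
        unfolding \<epsilon>_def by (rule S.mask_prod_lower_bound[OF fg(3) fg(4)[OF that] K1 fg(5)])
      then show ?thesis by simp
    qed
    ultimately show ?thesis using k'(1) unfolding A_def
      by (intro exI[of _ k'] conjI exI[of _ "f ` X''"]) auto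
  qed
  ultimately show ?thesis by blast
qed

text \<open>Multipliers take turns. Each turn extends the current set, and the turns of a given
  \<open>t\<close> come back at arbitrarily late indices, each time with the bound belonging to
  \<open>t\<close>.\<close>

lemma ex_spectrum_sequence:
  assumes b: "\<And>j. c j \<le> b"
    and J: "\<And>T. \<exists>J. \<forall>K0. \<exists>K\<ge>K0. T < (\<Prod>i<J. q (K + i))"
  obtains k :: "nat \<Rightarrow> nat" and X where "strict_mono k" "\<And>i. level_spectrum (k i) (X i)" "incseq X"
    "\<And>t. t > 0 \<Longrightarrow> (\<And>j. coprime t (c j)) \<Longrightarrow> \<exists>\<epsilon>>0. \<forall>r. \<exists>i\<ge>r. \<forall>z\<in>X i. \<forall>x. \<bar>x\<bar> \<le> real r \<longrightarrow>
      (\<forall>L. \<epsilon> \<le> cmod (mask_prod (\<lambda>j. M (k i + j)) (\<lambda>j. c (k i + j)) L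
       ((x + real t * of_int z) / real (\<Prod>j<k i. M j))))"
proof -
  define good where "good = (\<lambda>t \<epsilon> r k' X'. \<forall>z\<in>X'. \<forall>x. \<bar>x\<bar> \<le> real r \<longrightarrow>
    (\<forall>L. \<epsilon> \<le> cmod (mask_prod (\<lambda>i. M (k' + i)) (\<lambda>i. c (k' + i)) L
       ((x + real t * of_int z) / real (\<Prod>i<k'. M i)))))"
  define E where "E = {t. t > 0 \<and> (\<forall>j. coprime t (c j))}"
  have "\<exists>\<epsilon>. t \<in> E \<longrightarrow> \<epsilon> > 0 \<and> (\<forall>k X r. level_spectrum k X \<longrightarrow> (\<exists>k'>k. \<exists>X'. X \<subseteq> X' \<and> level_spectrum k' X' \<and> good t \<epsilon> r k' X'))" for t
  proof (cases "t \<in> E")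
    case True
    obtain J0 where J0: "\<And>K0. \<exists>K\<ge>K0. t < (\<Prod>i<J0. q (K + i))" using J by blast
    have "t > 0" "\<And>j. coprime t (c j)" using True by (simp_all add: E_def)
    from level_spectrum_extend_lower_bound[OF this b J0] obtain \<epsilon> where "\<epsilon> > 0" and
      \<epsilon>: "\<And>k X r. level_spectrum k X \<Longrightarrow> \<exists>k'>k. \<exists>X'. X \<subseteq> X' \<and> level_spectrum k' X' \<and>
        (\<forall>z\<in>X'. \<forall>x. \<bar>x\<bar> \<le> r \<longrightarrow> (\<forall>L. \<epsilon> \<le> cmod (mask_prod (\<lambda>i. M (k' + i)) (\<lambda>i. c (k' + i)) L
          ((x + real t * of_int z) / real (\<Prod>i<k'. M i)))))"
      by metis
    then show ?thesis unfolding good_def by (intro exI[of _ \<epsilon>] impI conjI allI) simp_all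
  qed simp
  then obtain \<epsilon> where \<epsilon>: "\<And>t. t \<in> E \<Longrightarrow> \<epsilon> t > 0" and
    ext: "\<And>t k X r. t \<in> E \<Longrightarrow> level_spectrum k X \<Longrightarrow> \<exists>k'>k. \<exists>X'. X \<subseteq> X' \<and> level_spectrum k' X' \<and> good t (\<epsilon> t) r k' X'"
    by metis
  \<comment> \<open>The pairing function enumerates all pairs \<open>(t, r)\<close>. Keeping only
    the first component lists every \<open>t\<close> infinitely often, with a turn at an index no
    smaller than any prescribed \<open>r\<close>.\<close>
  define \<tau> where "\<tau> = (\<lambda>i. fst (prod_decode i))"
  \<comment> \<open>Index \<open>i > 0\<close> serves the multiplier \<open>\<tau> (i - 1)\<close>;
    index \<open>0\<close> is the trivial start \<open>{0}\<close> and serves none.\<close>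
  have "\<exists>f. \<forall>i. (level_spectrum (fst (f i)) (snd (f i)) \<and>
      (i > 0 \<longrightarrow> \<tau> (i - 1) \<in> E \<longrightarrow> good (\<tau> (i - 1)) (\<epsilon> (\<tau> (i - 1))) i (fst (f i)) (snd (f i)))) \<and>
      (fst (f i) < fst (f (Suc i)) \<and> snd (f i) \<subseteq> snd (f (Suc i)))"
  proof (rule dependent_nat_choice[where P = "\<lambda>i p. level_spectrum (fst p) (snd p) \<and>
      (i > 0 \<longrightarrow> \<tau> (i - 1) \<in> E \<longrightarrow> good (\<tau> (i - 1)) (\<epsilon> (\<tau> (i - 1))) i (fst p) (snd p))"
      and Q = "\<lambda>i p p'. fst p < fst p' \<and> snd p \<subseteq> snd p'"])
    show "\<exists>p. level_spectrum (fst p) (snd p) \<and>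
      (0 < (0::nat) \<longrightarrow> \<tau> (0 - 1) \<in> E \<longrightarrow> good (\<tau> (0 - 1)) (\<epsilon> (\<tau> (0 - 1))) 0 (fst p) (snd p))"
      using level_spectrum_0 by (intro exI[of _ "(0, {0})"]) simp
  next
    fix p i assume "level_spectrum (fst p) (snd p) \<and>
      (i > 0 \<longrightarrow> \<tau> (i - 1) \<in> E \<longrightarrow> good (\<tau> (i - 1)) (\<epsilon> (\<tau> (i - 1))) i (fst p) (snd p))"
    then have p: "level_spectrum (fst p) (snd p)" by blast
    have "\<exists>k'>fst p. \<exists>X'. snd p \<subseteq> X' \<and> level_spectrum k' X' \<and> (\<tau> i \<in> E \<longrightarrow> good (\<tau> i) (\<epsilon> (\<tau> i)) (Suc i) k' X')"
    proof (cases "\<tau> i \<in> E")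
      case False
      then show ?thesis using level_spectrum_extend[OF p, of 1] by (metis less_add_one)
    qed (use ext[OF _ p] in metis)
    then obtain k' X' where "k' > fst p" "snd p \<subseteq> X'" "level_spectrum k' X'"
      "\<tau> i \<in> E \<longrightarrow> good (\<tau> i) (\<epsilon> (\<tau> i)) (Suc i) k' X'" by blast
    then show "\<exists>p'. (level_spectrum (fst p') (snd p') \<and>
      (Suc i > 0 \<longrightarrow> \<tau> (Suc i - 1) \<in> E \<longrightarrow> good (\<tau> (Suc i - 1)) (\<epsilon> (\<tau> (Suc i - 1))) (Suc i) (fst p') (snd p'))) \<and>
      fst p < fst p' \<and> snd p \<subseteq> snd p'"
      by (intro exI[of _ "(k', X')"]) simp
  qed
  then obtain f where f: "\<And>i. level_spectrum (fst (f i)) (snd (f i)) \<and>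
      (i > 0 \<longrightarrow> \<tau> (i - 1) \<in> E \<longrightarrow> good (\<tau> (i - 1)) (\<epsilon> (\<tau> (i - 1))) i (fst (f i)) (snd (f i)))"
    "\<And>i. fst (f i) < fst (f (Suc i)) \<and> snd (f i) \<subseteq> snd (f (Suc i))" by blast
  show ?thesis
  proof (rule that[of "\<lambda>i. fst (f i)" "\<lambda>i. snd (f i)"])
    show "strict_mono (\<lambda>i. fst (f i))" "incseq (\<lambda>i. snd (f i))"
      using f(2) by (auto intro: strict_mono_Suc_iff[THEN iffD2] incseq_SucI)
    show "level_spectrum (fst (f i)) (snd (f i))" for i using f(1) by blast
    fix t :: nat assume "t > 0" "\<And>j. coprime t (c j)"
    then have t: "t \<in> E" by (simp add: E_def)
    have "\<exists>i\<ge>r. \<forall>z\<in>snd (f i). \<forall>x. \<bar>x\<bar> \<le> real r \<longrightarrow>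
      (\<forall>L. \<epsilon> t \<le> cmod (mask_prod (\<lambda>j. M (fst (f i) + j)) (\<lambda>j. c (fst (f i) + j)) L
       ((x + real t * of_int z) / real (\<Prod>j<fst (f i). M j))))" for r
    proof -
      define i where "i = Suc (prod_encode (t, r))"
      have "\<tau> (i - 1) = t" by (simp add: i_def \<tau>_def)
      then have "good t (\<epsilon> t) i (fst (f i)) (snd (f i))" using f(1)[of i] t by (simp add: i_def)
      moreover have "r \<le> i" unfolding i_def by (rule le_SucI, rule le_prod_encode_2)
      ultimately show ?thesis unfolding good_def by (intro exI[of _ i]) auto
    qed
    then show "\<exists>\<epsilon>>0. \<forall>r. \<exists>i\<ge>r. \<forall>z\<in>snd (f i). \<forall>x. \<bar>x\<bar> \<le> real r \<longrightarrow>
      (\<forall>L. \<epsilon> \<le> cmod (mask_prod (\<lambda>j. M (fst (f i) + j)) (\<lambda>j. c (fst (f i) + j)) L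
       ((x + real t * of_int z) / real (\<Prod>j<fst (f i). M j))))"
      using \<epsilon>[OF t] by blast
  qed
qed

end

subsection \<open>Exponentials in \<open>L\<^sup>2\<close>\<close>

lemma cmod_add_sq_le: "(cmod (x + y))\<^sup>2 \<le> 2 * (cmod x)\<^sup>2 + 2 * (cmod y)\<^sup>2"
proof -
  have "(cmod (x + y))\<^sup>2 \<le> (cmod x + cmod y)\<^sup>2"
    by (intro power_mono norm_triangle_ineq) auto
  also have "\<dots> \<le> 2 * (cmod x)\<^sup>2 + 2 * (cmod y)\<^sup>2"
    using zero_le_power2[of "cmod x - cmod y"] unfolding power2_diff power2_sum by linarith
  finally show ?thesis .
qed

lemma L2_functions_add:
  assumes "f \<in> L2_functions M" "g \<in> L2_functions M"
  shows "(\<lambda>x. f x + g x) \<in> L2_functions M"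
proof -
  have [measurable]: "f \<in> borel_measurable M" "g \<in> borel_measurable M"
    using assms by (auto simp: L2_functions_def)
  have "integrable M (\<lambda>x. (cmod (f x + g x))\<^sup>2)"
  proof (rule Bochner_Integration.integrable_bound)
    show "integrable M (\<lambda>x. 2 * (cmod (f x))\<^sup>2 + 2 * (cmod (g x))\<^sup>2)"
      using assms by (intro Bochner_Integration.integrable_add integrable_mult_right) (simp_all add: L2_functions_def)
    show "AE x in M. norm ((cmod (f x + g x))\<^sup>2) \<le> norm (2 * (cmod (f x))\<^sup>2 + 2 * (cmod (g x))\<^sup>2)"
      using cmod_add_sq_le by (intro AE_I2) (simp add: abs_of_nonneg)
  qed measurable
  then show ?thesis by (simp add: L2_functions_def)
qed

lemma L2_functions_scale:
  assumes "f \<in> L2_functions M"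
  shows "(\<lambda>x. c * f x) \<in> L2_functions M"
  using assms by (auto simp: L2_functions_def norm_mult power_mult_distrib)

lemma L2_functions_diff:
  assumes "f \<in> L2_functions M" "g \<in> L2_functions M"
  shows "(\<lambda>x. f x - g x) \<in> L2_functions M"
  using L2_functions_add[OF assms(1) L2_functions_scale[OF assms(2), of "- 1"]] by simp

lemma L2_functions_0: "(\<lambda>x. 0) \<in> L2_functions M"
  by (simp add: L2_functions_def)

lemma L2_functions_sum:
  "finite F \<Longrightarrow> (\<And>i. i \<in> F \<Longrightarrow> f i \<in> L2_functions M) \<Longrightarrow> (\<lambda>x. \<Sum>i\<in>F. f i x) \<in> L2_functions M"
  by (induction F rule: finite_induct) (auto intro: L2_functions_add L2_functions_0)

lemma L2_integrable_sq: "f \<in> L2_functions M \<Longrightarrow> integrable M (\<lambda>x. (cmod (f x))\<^sup>2)"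
  by (simp add: L2_functions_def)

text \<open>Squared norms avoid the triangle inequality of the norm at the cost of a factor
  \<open>2\<close>; two errors below \<open>\<epsilon> / 4\<close> combine to one below
  \<open>\<epsilon>\<close>.\<close>

lemma L2_integral_add_le:
  assumes "f \<in> L2_functions M" "g \<in> L2_functions M"
  shows "(\<integral>x. (cmod (f x + g x))\<^sup>2 \<partial>M) \<le> 2 * (\<integral>x. (cmod (f x))\<^sup>2 \<partial>M) + 2 * (\<integral>x. (cmod (g x))\<^sup>2 \<partial>M)"
proof -
  have "(\<integral>x. (cmod (f x + g x))\<^sup>2 \<partial>M) \<le> (\<integral>x. 2 * (cmod (f x))\<^sup>2 + 2 * (cmod (g x))\<^sup>2 \<partial>M)"
    using assms
    by (intro integral_mono L2_integrable_sq L2_functions_add Bochner_Integration.integrable_add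
        integrable_mult_right cmod_add_sq_le)
  also have "\<dots> = 2 * (\<integral>x. (cmod (f x))\<^sup>2 \<partial>M) + 2 * (\<integral>x. (cmod (g x))\<^sup>2 \<partial>M)"
    using assms by (simp add: L2_integrable_sq)
  finally show ?thesis .
qed

text \<open>Distances are squared here, so that a square root appears only when the basis property
  is finally stated in terms of \<open>L2_norm\<close>.\<close>

definition L2_closed_span :: "'a measure \<Rightarrow> 'i set \<Rightarrow> ('i \<Rightarrow> 'a \<Rightarrow> complex) \<Rightarrow> ('a \<Rightarrow> complex) set" where
  "L2_closed_span M I e = {f \<in> L2_functions M. \<forall>\<epsilon>>0. \<exists>F c. finite F \<and> F \<subseteq> I \<and>
     (\<integral>x. (cmod (f x - (\<Sum>i\<in>F. c i * e i x)))\<^sup>2 \<partial>M) < \<epsilon>}"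

lemma L2_closed_spanD:
  assumes "f \<in> L2_closed_span M I e" "\<epsilon> > 0"
  obtains F c where "finite F" "F \<subseteq> I" "(\<integral>x. (cmod (f x - (\<Sum>i\<in>F. c i * e i x)))\<^sup>2 \<partial>M) < \<epsilon>"
  using assms unfolding L2_closed_span_def by blast

lemma L2_closed_span_imp_L2: "f \<in> L2_closed_span M I e \<Longrightarrow> f \<in> L2_functions M"
  by (simp add: L2_closed_span_def)

locale L2_family =
  fixes M :: "'a measure" and I :: "'i set" and e :: "'i \<Rightarrow> 'a \<Rightarrow> complex"
  assumes L2: "i \<in> I \<Longrightarrow> e i \<in> L2_functions M"
begin

abbreviation "V \<equiv> L2_closed_span M I e"

lemma comb_L2: "finite F \<Longrightarrow> F \<subseteq> I \<Longrightarrow> (\<lambda>x. \<Sum>i\<in>F. c i * e i x) \<in> L2_functions M"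
  by (intro L2_functions_sum L2_functions_scale L2) auto

lemma comb_mem: "finite F \<Longrightarrow> F \<subseteq> I \<Longrightarrow> (\<lambda>x. \<Sum>i\<in>F. c i * e i x) \<in> V"
  unfolding L2_closed_span_def mem_Collect_eq
  by (intro conjI allI impI comb_L2 exI[of _ F] exI[of _ c]) simp_all

lemma base_mem: "i \<in> I \<Longrightarrow> e i \<in> V"
  using comb_mem[of "{i}" "\<lambda>_. 1"] by simp

lemma zero_mem: "(\<lambda>x. 0) \<in> V"
  using comb_mem[of "{}"] by simp

lemma limit_mem:
  assumes "f \<in> L2_functions M" and "\<And>\<epsilon>. \<epsilon> > 0 \<Longrightarrow> \<exists>g\<in>V. (\<integral>x. (cmod (f x - g x))\<^sup>2 \<partial>M) < \<epsilon>"
  shows "f \<in> V"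
proof -
  have "\<exists>F c. finite F \<and> F \<subseteq> I \<and> (\<integral>x. (cmod (f x - (\<Sum>i\<in>F. c i * e i x)))\<^sup>2 \<partial>M) < \<epsilon>" if "\<epsilon> > 0" for \<epsilon>
  proof -
    have "\<epsilon> / 4 > 0" using that by simp
    then obtain g where g: "g \<in> V" "(\<integral>x. (cmod (f x - g x))\<^sup>2 \<partial>M) < \<epsilon> / 4"
      using assms(2) by blast
    obtain F c where F: "finite F" "F \<subseteq> I" "(\<integral>x. (cmod (g x - (\<Sum>i\<in>F. c i * e i x)))\<^sup>2 \<partial>M) < \<epsilon> / 4"
      by (rule L2_closed_spanD[OF g(1) \<open>\<epsilon> / 4 > 0\<close>])
    have "(\<integral>x. (cmod ((f x - g x) + (g x - (\<Sum>i\<in>F. c i * e i x))))\<^sup>2 \<partial>M) \<le>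
        2 * (\<integral>x. (cmod (f x - g x))\<^sup>2 \<partial>M) + 2 * (\<integral>x. (cmod (g x - (\<Sum>i\<in>F. c i * e i x)))\<^sup>2 \<partial>M)"
      using F by (intro L2_integral_add_le L2_functions_diff comb_L2 assms(1) L2_closed_span_imp_L2[OF g(1)])
    then show ?thesis using g(2) F by (intro exI[of _ F] exI[of _ c] conjI) simp_all
  qed
  then show ?thesis using assms(1) by (simp add: L2_closed_span_def)
qed

lemma scale_mem:
  assumes "f \<in> V"
  shows "(\<lambda>x. a * f x) \<in> V"
proof (cases "a = 0")
  case False
  show ?thesis
  proof (rule limit_mem)
    show "(\<lambda>x. a * f x) \<in> L2_functions M" by (rule L2_functions_scale[OF L2_closed_span_imp_L2[OF assms]])
    fix \<epsilon> :: real assume "\<epsilon> > 0"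
    then obtain F c where F: "finite F" "F \<subseteq> I"
      "(\<integral>x. (cmod (f x - (\<Sum>i\<in>F. c i * e i x)))\<^sup>2 \<partial>M) < \<epsilon> / (cmod a)\<^sup>2"
      using L2_closed_spanD[OF assms, of "\<epsilon> / (cmod a)\<^sup>2"] False by auto
    have "(\<integral>x. (cmod (a * f x - (\<Sum>i\<in>F. (a * c i) * e i x)))\<^sup>2 \<partial>M) =
        (\<integral>x. (cmod a)\<^sup>2 * (cmod (f x - (\<Sum>i\<in>F. c i * e i x)))\<^sup>2 \<partial>M)"
      by (simp add: mult.assoc sum_distrib_left[symmetric] right_diff_distrib[symmetric] norm_mult power_mult_distrib)
    also have "\<dots> < \<epsilon>" using F(3) False by (simp add: field_simps)
    finally show "\<exists>g\<in>V. (\<integral>x. (cmod (a * f x - g x))\<^sup>2 \<partial>M) < \<epsilon>"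
      using comb_mem[OF F(1,2)] by (intro bexI[of _ "\<lambda>x. \<Sum>i\<in>F. (a * c i) * e i x"])
  qed
qed (simp add: zero_mem)

lemma add_mem:
  assumes f: "f \<in> V" and g: "g \<in> V"
  shows "(\<lambda>x. f x + g x) \<in> V"
proof (rule limit_mem)
  show "(\<lambda>x. f x + g x) \<in> L2_functions M" by (intro L2_functions_add L2_closed_span_imp_L2[OF f] L2_closed_span_imp_L2[OF g])
  fix \<epsilon> :: real assume \<epsilon>: "\<epsilon> > 0"
  then have \<epsilon>4: "\<epsilon> / 4 > 0" by simp
  obtain F c where F: "finite F" "F \<subseteq> I" "(\<integral>x. (cmod (f x - (\<Sum>i\<in>F. c i * e i x)))\<^sup>2 \<partial>M) < \<epsilon> / 4"
    by (rule L2_closed_spanD[OF f \<epsilon>4])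
  obtain G d where G: "finite G" "G \<subseteq> I" "(\<integral>x. (cmod (g x - (\<Sum>i\<in>G. d i * e i x)))\<^sup>2 \<partial>M) < \<epsilon> / 4"
    by (rule L2_closed_spanD[OF g \<epsilon>4])
  define u where "u = (\<lambda>i. (if i \<in> F then c i else 0) + (if i \<in> G then d i else 0))"
  have u: "(\<Sum>i\<in>F \<union> G. u i * e i x) = (\<Sum>i\<in>F. c i * e i x) + (\<Sum>i\<in>G. d i * e i x)" for x
  proof -
    have "(\<Sum>i\<in>F \<union> G. u i * e i x) = (\<Sum>i\<in>F \<union> G. if i \<in> F then c i * e i x else 0) +
        (\<Sum>i\<in>F \<union> G. if i \<in> G then d i * e i x else 0)"
      unfolding sum.distrib[symmetric] by (intro sum.cong) (auto simp: u_def algebra_simps)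
    also have "\<dots> = (\<Sum>i\<in>(F \<union> G) \<inter> F. c i * e i x) + (\<Sum>i\<in>(F \<union> G) \<inter> G. d i * e i x)"
      using F G by (subst (1 2) sum.inter_restrict) auto
    also have "(F \<union> G) \<inter> F = F" by auto
    also have "(F \<union> G) \<inter> G = G" by auto
    finally show ?thesis .
  qed
  have "(\<integral>x. (cmod ((f x - (\<Sum>i\<in>F. c i * e i x)) + (g x - (\<Sum>i\<in>G. d i * e i x))))\<^sup>2 \<partial>M) \<le>
      2 * (\<integral>x. (cmod (f x - (\<Sum>i\<in>F. c i * e i x)))\<^sup>2 \<partial>M) + 2 * (\<integral>x. (cmod (g x - (\<Sum>i\<in>G. d i * e i x)))\<^sup>2 \<partial>M)"
    using F G by (intro L2_integral_add_le L2_functions_diff comb_L2 L2_closed_span_imp_L2[OF f] L2_closed_span_imp_L2[OF g])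
  also have "\<dots> < \<epsilon>" using F G \<epsilon> by simp
  finally have "(\<integral>x. (cmod (f x + g x - (\<Sum>i\<in>F \<union> G. u i * e i x)))\<^sup>2 \<partial>M) < \<epsilon>"
    by (simp add: u algebra_simps)
  then show "\<exists>h\<in>V. (\<integral>x. (cmod (f x + g x - h x))\<^sup>2 \<partial>M) < \<epsilon>"
    using comb_mem[of "F \<union> G" u] F G by (intro bexI[of _ "\<lambda>x. \<Sum>i\<in>F \<union> G. u i * e i x"]) auto
qed

lemma sum_mem: "finite F \<Longrightarrow> (\<And>i. i \<in> F \<Longrightarrow> f i \<in> V) \<Longrightarrow> (\<lambda>x. \<Sum>i\<in>F. f i x) \<in> V"
  by (induction F rule: finite_induct) (auto intro: add_mem zero_mem)

text \<open>Dominated convergence applies to \<open>|h - f n|^2\<close>, with majorant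
  \<open>4 * w^2\<close>. Every step of the density proof for exponentials is an instance.\<close>

lemma dominated_mem:
  assumes f: "\<And>n. f n \<in> V" and lim: "\<And>x. x \<in> space M \<Longrightarrow> (\<lambda>n. f n x) \<longlonglongrightarrow> h x"
    and bound: "\<And>n x. x \<in> space M \<Longrightarrow> cmod (f n x) \<le> w x"
    and w [measurable]: "w \<in> borel_measurable M" "integrable M (\<lambda>x. (w x)\<^sup>2)"
  shows "h \<in> V"
proof (rule limit_mem)
  have [measurable]: "f n \<in> borel_measurable M" for n
    using L2_closed_span_imp_L2[OF f] by (simp add: L2_functions_def)
  have [measurable]: "h \<in> borel_measurable M" by (rule borel_measurable_LIMSEQ_metric[OF _ lim]) measurable
  have h: "cmod (h x) \<le> w x" if "x \<in> space M" for x
    by (rule LIMSEQ_le_const2[OF tendsto_norm[OF lim[OF that]]]) (use bound that in auto)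
  have "integrable M (\<lambda>x. (cmod (h x))\<^sup>2)"
    by (rule Bochner_Integration.integrable_bound[OF w(2)]) (auto intro!: power_mono h)
  then show "h \<in> L2_functions M" by (simp add: L2_functions_def)
  fix \<epsilon> :: real assume "\<epsilon> > 0"
  have "(\<lambda>n. \<integral>x. (cmod (h x - f n x))\<^sup>2 \<partial>M) \<longlonglongrightarrow> (\<integral>x. 0 \<partial>M)"
  proof (rule integral_dominated_convergence[where w = "\<lambda>x. 4 * (w x)\<^sup>2"])
    show "AE x in M. (\<lambda>n. (cmod (h x - f n x))\<^sup>2) \<longlonglongrightarrow> 0"
    proof (rule AE_I2)
      fix x assume "x \<in> space M"
      then have "(\<lambda>n. (cmod (h x - f n x))\<^sup>2) \<longlonglongrightarrow> (cmod (h x - h x))\<^sup>2"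
        by (intro tendsto_intros lim)
      then show "(\<lambda>n. (cmod (h x - f n x))\<^sup>2) \<longlonglongrightarrow> 0" by simp
    qed
    fix n
    show "AE x in M. norm ((cmod (h x - f n x))\<^sup>2) \<le> 4 * (w x)\<^sup>2"
    proof (rule AE_I2)
      fix x assume "x \<in> space M"
      then have "cmod (h x - f n x) \<le> 2 * w x"
        using norm_triangle_ineq4[of "h x" "f n x"] h bound[of x n] by force
      then have "(cmod (h x - f n x))\<^sup>2 \<le> (2 * w x)\<^sup>2" by (intro power_mono) auto
      then show "norm ((cmod (h x - f n x))\<^sup>2) \<le> 4 * (w x)\<^sup>2" by (simp add: power_mult_distrib)
    qed
  qed (use w(2) in auto)
  then have "\<forall>\<^sub>F n in sequentially. (\<integral>x. (cmod (h x - f n x))\<^sup>2 \<partial>M) < \<epsilon>"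
    using \<open>\<epsilon> > 0\<close> by (auto dest: order_tendstoD)
  then show "\<exists>g\<in>V. (\<integral>x. (cmod (h x - g x))\<^sup>2 \<partial>M) < \<epsilon>"
    using f by (auto simp: eventually_sequentially)
qed

end

section \<open>Density of the exponentials in \<open>L^2\<close> of a probability measure on the
  line\<close>

definition expo :: "real \<Rightarrow> real \<Rightarrow> complex" where
  "expo l x = exp (- 2 * complex_of_real pi * \<i> * complex_of_real l * complex_of_real x)"

lemma expo_eq_cis: "expo l x = cis (- (2 * pi * l * x))"
  unfolding expo_def cis_conv_exp by (simp add: ac_simps)

lemma cmod_expo [simp]: "cmod (expo l x) = 1"
  by (simp add: expo_eq_cis)

lemma expo_mult: "expo l x * expo l' x = expo (l + l') x"
  by (simp add: expo_eq_cis cis_mult algebra_simps)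

lemma cnj_expo: "cnj (expo l x) = expo (- l) x"
  by (simp add: expo_eq_cis cis_cnj)

lemma expo_measurable [measurable]: "expo l \<in> borel_measurable borel"
  unfolding expo_def by measurable

lemma abs_cts_step_le_1: "a < b \<Longrightarrow> \<bar>cts_step a b x\<bar> \<le> 1"
  by (auto simp: cts_step_def)

context real_distribution
begin

lemma expo_L2: "expo l \<in> L2_functions M"
  by (simp add: L2_functions_def)

sublocale expo: L2_family M UNIV expo
  by unfold_locales (rule expo_L2)

text \<open>The sine is a combination of two exponentials, which shift the frequency
  \<open>l\<close>; hence the induction must leave \<open>l\<close> arbitrary.\<close>

lemma sin_power_expo_mem: "(\<lambda>x. of_real (sin (h * x)) ^ k * expo l x) \<in> expo.V"
proof (induction k arbitrary: l)
  case 0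
  then show ?case using expo.base_mem[of l] by simp
next
  case (Suc k)
  let ?d = "h / (2 * pi)"
  have s: "of_real (sin (h * x)) = (expo (- ?d) x - expo ?d x) / (2 * \<i>)" for x
  proof -
    have "expo (- ?d) x - expo ?d x = 2 * \<i> * of_real (sin (h * x))"
      by (simp add: expo_eq_cis complex_eq_iff)
    then show ?thesis by simp
  qed
  have "of_real (sin (h * x)) ^ Suc k * expo l x =
     1 / (2 * \<i>) * (of_real (sin (h * x)) ^ k * expo (l - ?d) x) +
     (- 1 / (2 * \<i>)) * (of_real (sin (h * x)) ^ k * expo (l + ?d) x)" for x
  proof -
    have "of_real (sin (h * x)) ^ Suc k * expo l x =
       of_real (sin (h * x)) ^ k * (of_real (sin (h * x)) * expo l x)" by simp
    also have "of_real (sin (h * x)) * expo l x = (expo (l - ?d) x - expo (l + ?d) x) / (2 * \<i>)"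
      unfolding s by (simp add: left_diff_distrib expo_mult add.commute)
    finally show ?thesis by (simp add: field_simps)
  qed
  then show ?case using Suc by (simp only:) (intro expo.add_mem expo.scale_mem)
qed

text \<open>Substitute \<open>s = sin (h * x)\<close>. A Weierstrass polynomial in \<open>s\<close>
  approximating \<open>g (arcsin s / h)\<close> on \<open>[-1, 1]\<close> is a trigonometric
  polynomial in \<open>x\<close>. It is bounded on the whole line, because the sine stays in
  \<open>[-1, 1]\<close>, and close to \<open>g x\<close> where \<open>|h * x| \<le> pi / 2\<close>.
  As \<open>h\<close> tends to \<open>0\<close> this window exhausts the line.\<close>

lemma continuous_bounded_mem:
  fixes g :: "real \<Rightarrow> real"
  assumes g: "continuous_on UNIV g" and K: "\<And>x. \<bar>g x\<bar> \<le> K"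
  shows "(\<lambda>x. complex_of_real (g x)) \<in> expo.V"
proof -
  define h where "h = (\<lambda>n. 1 / real (Suc n))"
  have h: "h n > 0" "h n \<le> 1" for n by (simp_all add: h_def)
  have h_lim: "h \<longlonglongrightarrow> 0" unfolding h_def using LIMSEQ_inverse_real_of_nat by (simp add: inverse_eq_divide)
  have "\<exists>a m. \<forall>s\<in>{-1..1}. \<bar>g (arcsin s / h n) - (\<Sum>i\<le>m::nat. a i * s ^ i)\<bar> < h n" for n
  proof -
    have "continuous_on {-1..1} (\<lambda>s. g (arcsin s / h n))"
      by (intro continuous_on_compose2[OF g] continuous_intros continuous_on_arcsin) (use h[of n] in auto)
    then obtain p where p: "real_polynomial_function p" "\<And>s. s \<in> {-1..1} \<Longrightarrow> \<bar>g (arcsin s / h n) - p s\<bar> < h n"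
      using Stone_Weierstrass_real_polynomial_function[of "{-1..1::real}" _ "h n"] h by auto
    from p(1) obtain a m where "p = (\<lambda>s. \<Sum>i\<le>m::nat. a i * s ^ i)"
      by (auto simp: real_polynomial_function_iff_sum)
    with p(2) show ?thesis by blast
  qed
  then obtain a m where am: "\<And>n s. s \<in> {-1..1} \<Longrightarrow> \<bar>g (arcsin s / h n) - (\<Sum>i\<le>m n::nat. a n i * s ^ i)\<bar> < h n"
    by metis
  define f where "f = (\<lambda>n x. complex_of_real (\<Sum>i\<le>m n. a n i * sin (h n * x) ^ i))"
  show ?thesis
  proof (rule expo.dominated_mem[where f = f and w = "\<lambda>_. K + 1"])
    fix n
    have "(\<lambda>x. \<Sum>i\<le>m n. complex_of_real (a n i) * (of_real (sin (h n * x)) ^ i * expo 0 x)) \<in> expo.V"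
      by (intro expo.sum_mem expo.scale_mem sin_power_expo_mem) auto
    then show "f n \<in> expo.V" by (simp add: f_def expo_def)
  next
    fix n x
    have "\<bar>g (arcsin (sin (h n * x)) / h n) - (\<Sum>i\<le>m n. a n i * sin (h n * x) ^ i)\<bar> < h n"
      by (intro am) auto
    then have "\<bar>\<Sum>i\<le>m n. a n i * sin (h n * x) ^ i\<bar> \<le> K + 1"
      using K[of "arcsin (sin (h n * x)) / h n"] h(2)[of n] by linarith
    then show "cmod (f n x) \<le> K + 1" unfolding f_def norm_of_real .
  next
    fix x
    have "\<forall>\<^sub>F n in sequentially. h n < 1 / (\<bar>x\<bar> + 1)"
      using h_lim by (rule order_tendstoD) auto
    then have "\<forall>\<^sub>F n in sequentially. cmod (f n x - of_real (g x)) \<le> h n"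
    proof eventually_elim
      case (elim n)
      have "\<bar>h n * x\<bar> \<le> h n * (\<bar>x\<bar> + 1)" using h[of n] by (simp add: abs_mult)
      also have "\<dots> < 1" using elim by (simp add: field_simps)
      finally have "\<bar>h n * x\<bar> \<le> pi / 2" using pi_gt3 by linarith
      then have "arcsin (sin (h n * x)) = h n * x" by (intro arcsin_sin) linarith+
      then have "\<bar>g x - (\<Sum>i\<le>m n. a n i * sin (h n * x) ^ i)\<bar> < h n"
        using am[of "sin (h n * x)" n] h[of n] by simp
      then have "\<bar>(\<Sum>i\<le>m n. a n i * sin (h n * x) ^ i) - g x\<bar> \<le> h n" by linarith
      then show ?case unfolding f_def of_real_diff[symmetric] norm_of_real .
    qed
    then have "(\<lambda>n. f n x - of_real (g x)) \<longlonglongrightarrow> 0"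
      by (intro Lim_null_comparison[OF _ h_lim])
    then show "(\<lambda>n. f n x) \<longlonglongrightarrow> of_real (g x)" by (simp add: LIM_zero_iff)
  qed simp_all
qed

text \<open>Dynkin's argument from half-lines, whose indicators are limits of continuous steps;
  complements and disjoint unions stay within the closed span by linearity and dominated
  limits.\<close>

lemma indicator_mem:
  assumes "A \<in> sets borel"
  shows "(\<lambda>x. complex_of_real (indicator A x)) \<in> expo.V"
proof -
  have "Int_stable (range (\<lambda>a::real. {..a}))"
    by (auto simp: Int_stable_def)
  moreover have "range (\<lambda>a::real. {..a}) \<subseteq> Pow UNIV" by simp
  moreover have "A \<in> sigma_sets UNIV (range (\<lambda>a::real. {..a}))"
    using assms by (simp add: borel_eq_atMost)
  ultimately show ?thesis
  proof (induction rule: sigma_sets_induct_disjoint)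
    case (basic A)
    then obtain a where A: "A = {..a}" by auto
    show ?case unfolding A
    proof (rule expo.dominated_mem[where f = "\<lambda>n x. complex_of_real (cts_step a (a + 1 / Suc n) x)" and w = "\<lambda>_. 1"])
      fix n
      show "(\<lambda>x. complex_of_real (cts_step a (a + 1 / Suc n) x)) \<in> expo.V"
      proof (rule continuous_bounded_mem[where K = 1])
        show "continuous_on UNIV (cts_step a (a + 1 / Suc n))"
          by (intro uniformly_continuous_imp_continuous cts_step_uniformly_continuous) simp
      qed (rule abs_cts_step_le_1, simp)
    next
      fix x
      have "(\<lambda>n. cts_step a (a + 1 / Suc n) x) \<longlonglongrightarrow> indicator {..a} x"
      proof (cases "x \<le> a")
        case False
        have "\<forall>\<^sub>F n in sequentially. 1 / Suc n < x - a"
          using LIMSEQ_inverse_real_of_nat False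
          by (intro order_tendstoD[of "\<lambda>n. 1 / real (Suc n)" 0]) (auto simp: inverse_eq_divide)
        then have "\<forall>\<^sub>F n in sequentially. cts_step a (a + 1 / Suc n) x = indicator {..a} x"
          by eventually_elim (use False in \<open>auto simp: cts_step_def\<close>)
        then show ?thesis by (rule tendsto_eventually)
      qed (simp add: cts_step_def)
      then show "(\<lambda>n. complex_of_real (cts_step a (a + 1 / Suc n) x)) \<longlonglongrightarrow> complex_of_real (indicator {..a} x)"
        by (rule tendsto_of_real)
    qed (simp_all add: abs_cts_step_le_1)
  next
    case empty
    then show ?case using expo.zero_mem by simp
  next
    case (compl A)
    have "(\<lambda>x. expo 0 x + (- 1) * complex_of_real (indicator A x)) \<in> expo.V"
      by (intro expo.add_mem expo.scale_mem compl expo.base_mem) auto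
    moreover have "expo 0 x + (- 1) * complex_of_real (indicator A x) = complex_of_real (indicator (UNIV - A) x)" for x
      by (auto simp: expo_def indicator_def)
    ultimately show ?case by (simp only:)
  next
    case (union A)
    show ?case
    proof (rule expo.dominated_mem[where f = "\<lambda>n x. \<Sum>i<n. complex_of_real (indicator (A i) x)" and w = "\<lambda>_. 1"])
      show "(\<lambda>x. \<Sum>i<n. complex_of_real (indicator (A i) x)) \<in> expo.V" for n
        by (intro expo.sum_mem union) auto
      have eq: "(\<Sum>i<n. complex_of_real (indicator (A i) x)) = complex_of_real (indicator (\<Union>i<n. A i) x)" for n x
        using union by (subst indicator_UN_disjoint) (auto simp: disjoint_family_on_def)
      show "(\<lambda>n. \<Sum>i<n. complex_of_real (indicator (A i) x)) \<longlonglongrightarrow> complex_of_real (indicator (\<Union> (range A)) x)" for x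
        unfolding eq by (intro tendsto_of_real LIMSEQ_indicator_UN)
      show "cmod (\<Sum>i<n. complex_of_real (indicator (A i) x)) \<le> 1" for n x
        unfolding eq by (simp add: indicator_def)
    qed auto
  qed
qed

lemma L2_closed_span_expo: "L2_closed_span M UNIV expo = L2_functions M"
proof
  show "L2_functions M \<subseteq> expo.V"
  proof
    fix f assume f: "f \<in> L2_functions M"
    then have [measurable]: "f \<in> borel_measurable M" by (simp add: L2_functions_def)
    obtain s where s: "\<And>i. simple_function M (s i)" "\<And>x. (\<lambda>i. s i x) \<longlonglongrightarrow> f x"
      "\<And>i x. cmod (s i x) \<le> 2 * cmod (f x)"
      using borel_measurable_implies_sequence_metric[of f M 0] by auto
    show "f \<in> expo.V"
    proof (rule expo.dominated_mem[where f = s and w = "\<lambda>x. 2 * cmod (f x)"])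
      fix i
      have fin: "finite (range (s i))" using simple_functionD(1)[OF s(1)] by simp
      have "(\<lambda>x. \<Sum>y\<in>range (s i). y * complex_of_real (indicator (s i -` {y}) x)) \<in> expo.V"
      proof (intro expo.sum_mem expo.scale_mem indicator_mem fin)
        fix y show "s i -` {y} \<in> sets borel"
          using simple_functionD(2)[OF s(1), of i "{y}"] by simp
      qed
      moreover have "(\<Sum>y\<in>range (s i). y * complex_of_real (indicator (s i -` {y}) x)) = s i x" for x
      proof -
        have "(\<Sum>y\<in>range (s i). y * complex_of_real (indicator (s i -` {y}) x)) =
            (\<Sum>y\<in>range (s i). if s i x = y then y else 0)"
          by (intro sum.cong) (auto simp: indicator_def)
        then show ?thesis using fin by simp
      qed
      ultimately show "s i \<in> expo.V" by simp
    qed (use s f in \<open>auto simp: L2_functions_def power_mult_distrib\<close>)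
  qed
qed (auto simp: L2_closed_span_def)

section \<open>Bessel's identity and the criterion for spectra\<close>

lemma has_integral_expo_product:
  "has_bochner_integral M (\<lambda>x. expo a x * cnj (expo b x)) (char M (2 * pi * (b - a)))"
proof -
  have eq: "expo a x * cnj (expo b x) = iexp (2 * pi * (b - a) * x)" for x
    by (simp add: cnj_expo expo_mult) (simp add: expo_eq_cis cis_conv_exp algebra_simps)
  have "integrable M (\<lambda>x. iexp (2 * pi * (b - a) * x))" by (rule integrable_iexp) auto
  then show ?thesis unfolding eq char_def by (rule has_bochner_integral_integrable)
qed

lemma char_minus: "char M (- t) = cnj (char M t)"
proof -
  have "cnj (char M t) = (\<integral>x. cnj (iexp (t * x)) \<partial>M)" unfolding char_def by (rule Bochner_Integration.integral_cnj[symmetric])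
  also have "\<dots> = char M (- t)" unfolding char_def by (simp add: exp_cnj)
  finally show ?thesis ..
qed

text \<open>Bessel's identity: the coefficient of \<open>expo l\<close> in the projection of
  \<open>expo \<xi>\<close> is their inner product, which is the characteristic function at
  \<open>2 * pi * (l - \<xi>)\<close>.\<close>

lemma integral_expo_diff_sq:
  assumes F: "finite F" and orth: "\<And>l l'. l \<in> F \<Longrightarrow> l' \<in> F \<Longrightarrow> l \<noteq> l' \<Longrightarrow> char M (2 * pi * (l' - l)) = 0"
  shows "(\<integral>x. (cmod (expo \<xi> x - (\<Sum>l\<in>F. char M (2 * pi * (l - \<xi>)) * expo l x)))\<^sup>2 \<partial>M) =
    1 - (\<Sum>l\<in>F. (cmod (char M (2 * pi * (l - \<xi>))))\<^sup>2)"
proof -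
  define c where "c = (\<lambda>l. char M (2 * pi * (l - \<xi>)))"
  define S where "S = (\<Sum>l\<in>F. c l * cnj (c l))"
  let ?I = "\<lambda>a b x. expo a x * cnj (expo b x)"
  have cnj_c: "char M (2 * pi * (\<xi> - l)) = cnj (c l)" for l
    unfolding c_def char_minus[symmetric] by (simp add: algebra_simps)
  have "has_bochner_integral M (\<lambda>x. ?I \<xi> \<xi> x - (\<Sum>l\<in>F. cnj (c l) * ?I \<xi> l x) - (\<Sum>l\<in>F. c l * ?I l \<xi> x)
      + (\<Sum>l\<in>F. \<Sum>l'\<in>F. (c l * cnj (c l')) * ?I l l' x))
    (char M (2 * pi * (\<xi> - \<xi>)) - (\<Sum>l\<in>F. cnj (c l) * char M (2 * pi * (l - \<xi>)))
      - (\<Sum>l\<in>F. c l * char M (2 * pi * (\<xi> - l)))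
      + (\<Sum>l\<in>F. \<Sum>l'\<in>F. (c l * cnj (c l')) * char M (2 * pi * (l' - l))))"
    by (intro has_bochner_integral_add has_bochner_integral_diff has_bochner_integral_sum
        has_bochner_integral_mult_right has_integral_expo_product)
  moreover have "char M (2 * pi * (\<xi> - \<xi>)) = 1" by (simp add: char_zero)
  moreover have "(\<Sum>l\<in>F. cnj (c l) * char M (2 * pi * (l - \<xi>))) = S"
    by (simp add: S_def c_def mult.commute)
  moreover have "(\<Sum>l\<in>F. c l * char M (2 * pi * (\<xi> - l))) = S" by (simp add: S_def cnj_c)
  moreover have "(\<Sum>l\<in>F. \<Sum>l'\<in>F. (c l * cnj (c l')) * char M (2 * pi * (l' - l))) = S"
  proof -
    have "(\<Sum>l\<in>F. \<Sum>l'\<in>F. (c l * cnj (c l')) * char M (2 * pi * (l' - l))) =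
        (\<Sum>l\<in>F. \<Sum>l'\<in>F. if l = l' then c l * cnj (c l') else 0)"
      by (intro sum.cong refl) (auto simp: orth char_zero)
    then show ?thesis using F by (simp add: S_def)
  qed
  moreover have "?I \<xi> \<xi> x - (\<Sum>l\<in>F. cnj (c l) * ?I \<xi> l x) - (\<Sum>l\<in>F. c l * ?I l \<xi> x)
      + (\<Sum>l\<in>F. \<Sum>l'\<in>F. (c l * cnj (c l')) * ?I l l' x) =
      complex_of_real ((cmod (expo \<xi> x - (\<Sum>l\<in>F. c l * expo l x)))\<^sup>2)" for x
  proof -
    have "complex_of_real ((cmod (expo \<xi> x - (\<Sum>l\<in>F. c l * expo l x)))\<^sup>2) =
        (expo \<xi> x - (\<Sum>l\<in>F. c l * expo l x)) * (cnj (expo \<xi> x) - (\<Sum>l\<in>F. cnj (c l) * cnj (expo l x)))"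
      unfolding complex_norm_square by simp
    also have "\<dots> = ?I \<xi> \<xi> x - expo \<xi> x * (\<Sum>l\<in>F. cnj (c l) * cnj (expo l x))
        - (\<Sum>l\<in>F. c l * expo l x) * cnj (expo \<xi> x)
        + (\<Sum>l\<in>F. c l * expo l x) * (\<Sum>l\<in>F. cnj (c l) * cnj (expo l x))"
      by (simp add: algebra_simps)
    also have "(\<Sum>l\<in>F. c l * expo l x) * (\<Sum>l\<in>F. cnj (c l) * cnj (expo l x)) =
        (\<Sum>l\<in>F. \<Sum>l'\<in>F. (c l * cnj (c l')) * ?I l l' x)"
      unfolding sum_product by (intro sum.cong refl) (simp only: ac_simps)
    also have "expo \<xi> x * (\<Sum>l\<in>F. cnj (c l) * cnj (expo l x)) = (\<Sum>l\<in>F. cnj (c l) * ?I \<xi> l x)"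
      by (simp add: sum_distrib_left mult.left_commute)
    also have "(\<Sum>l\<in>F. c l * expo l x) * cnj (expo \<xi> x) = (\<Sum>l\<in>F. c l * ?I l \<xi> x)"
      by (simp add: sum_distrib_right mult.assoc)
    finally show ?thesis ..
  qed
  ultimately have "has_bochner_integral M (\<lambda>x. complex_of_real ((cmod (expo \<xi> x - (\<Sum>l\<in>F. c l * expo l x)))\<^sup>2)) (1 - S)"
    by simp
  then have "(\<integral>x. complex_of_real ((cmod (expo \<xi> x - (\<Sum>l\<in>F. c l * expo l x)))\<^sup>2) \<partial>M) = 1 - S"
    by (rule has_bochner_integral_integral_eq)
  also have "S = complex_of_real (\<Sum>l\<in>F. (cmod (c l))\<^sup>2)"
    unfolding S_def of_real_sum complex_norm_square ..
  finally have "complex_of_real (\<integral>x. (cmod (expo \<xi> x - (\<Sum>l\<in>F. c l * expo l x)))\<^sup>2 \<partial>M) =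
      complex_of_real (1 - (\<Sum>l\<in>F. (cmod (c l))\<^sup>2))"
    unfolding integral_complex_of_real by simp
  then show ?thesis unfolding of_real_eq_iff c_def .
qed

lemma sum_char_sq_le_1:
  assumes "finite F" "\<And>l l'. l \<in> F \<Longrightarrow> l' \<in> F \<Longrightarrow> l \<noteq> l' \<Longrightarrow> char M (2 * pi * (l' - l)) = 0"
  shows "(\<Sum>l\<in>F. (cmod (char M (2 * pi * (l - \<xi>))))\<^sup>2) \<le> 1"
proof -
  have "0 \<le> (\<integral>x. (cmod (expo \<xi> x - (\<Sum>l\<in>F. char M (2 * pi * (l - \<xi>)) * expo l x)))\<^sup>2 \<partial>M)"
    by (intro integral_nonneg_AE) simp
  then show ?thesis using integral_expo_diff_sq[OF assms, of \<xi>] by linarith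
qed

text \<open>By Bessel's identity, \<open>full\<close> makes the distance of every
  \<open>expo \<xi>\<close> to the span of the family arbitrarily small. All exponentials together
  are dense, so the family is.\<close>

lemma is_spectrumI:
  assumes \<Lambda>: "countable \<Lambda>"
    and orth: "\<And>l l'. l \<in> \<Lambda> \<Longrightarrow> l' \<in> \<Lambda> \<Longrightarrow> l \<noteq> l' \<Longrightarrow> char M (2 * pi * (l' - l)) = 0"
    and full: "\<And>\<xi> \<epsilon>. \<epsilon> > 0 \<Longrightarrow>
      \<exists>F. finite F \<and> F \<subseteq> \<Lambda> \<and> 1 - \<epsilon> < (\<Sum>l\<in>F. (cmod (char M (2 * pi * (l - \<xi>))))\<^sup>2)"
  shows "is_spectrum M \<Lambda>"
proof -
  interpret \<Lambda>: L2_family M \<Lambda> expo by unfold_locales (rule expo_L2)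
  have expo_mem: "expo \<xi> \<in> \<Lambda>.V" for \<xi>
  proof (rule \<Lambda>.limit_mem[OF expo_L2])
    fix \<epsilon> :: real assume "\<epsilon> > 0"
    then obtain F where F: "finite F" "F \<subseteq> \<Lambda>" "1 - \<epsilon> < (\<Sum>l\<in>F. (cmod (char M (2 * pi * (l - \<xi>))))\<^sup>2)"
      using full by blast
    have "(\<integral>x. (cmod (expo \<xi> x - (\<Sum>l\<in>F. char M (2 * pi * (l - \<xi>)) * expo l x)))\<^sup>2 \<partial>M) =
        1 - (\<Sum>l\<in>F. (cmod (char M (2 * pi * (l - \<xi>))))\<^sup>2)"
      using F orth by (intro integral_expo_diff_sq) auto
    also have "\<dots> < \<epsilon>" using F by simp
    finally show "\<exists>g\<in>\<Lambda>.V. (\<integral>x. (cmod (expo \<xi> x - g x))\<^sup>2 \<partial>M) < \<epsilon>"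
      using \<Lambda>.comb_mem[OF F(1,2)] by (intro bexI)
  qed
  have mem: "f \<in> \<Lambda>.V" if "f \<in> L2_functions M" for f
  proof (rule \<Lambda>.limit_mem[OF that])
    fix \<epsilon> :: real assume "\<epsilon> > 0"
    have "f \<in> expo.V" using that L2_closed_span_expo by simp
    from this \<open>\<epsilon> > 0\<close> obtain F c where F: "finite F"
      "(\<integral>x. (cmod (f x - (\<Sum>i\<in>F. c i * expo i x)))\<^sup>2 \<partial>M) < \<epsilon>"
      by (rule L2_closed_spanD)
    have "(\<lambda>x. \<Sum>i\<in>F. c i * expo i x) \<in> \<Lambda>.V"
      using F(1) by (intro \<Lambda>.sum_mem \<Lambda>.scale_mem expo_mem)
    then show "\<exists>g\<in>\<Lambda>.V. (\<integral>x. (cmod (f x - g x))\<^sup>2 \<partial>M) < \<epsilon>" using F(2) by (intro bexI)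
  qed
  have "L2_orthonormal_basis M \<Lambda> expo"
    unfolding L2_orthonormal_basis_def
  proof (intro conjI ballI allI impI)
    show "expo i \<in> L2_functions M" for i by (rule expo_L2)
    fix i j assume "i \<in> \<Lambda>" "j \<in> \<Lambda>"
    then show "L2_inner M (expo i) (expo j) = (if i = j then 1 else 0)"
      unfolding L2_inner_def has_bochner_integral_integral_eq[OF has_integral_expo_product]
      by (auto simp: orth char_zero)
  next
    fix f :: "real \<Rightarrow> complex" and \<epsilon> :: real
    assume f: "f \<in> L2_functions M" and \<epsilon>: "0 < \<epsilon>"
    then have "\<epsilon>\<^sup>2 > 0" by simp
    with mem[OF f] obtain F c where F: "finite F" "F \<subseteq> \<Lambda>"
      "(\<integral>x. (cmod (f x - (\<Sum>i\<in>F. c i * expo i x)))\<^sup>2 \<partial>M) < \<epsilon>\<^sup>2"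
      by (rule L2_closed_spanD)
    have "L2_norm M (\<lambda>x. f x - (\<Sum>i\<in>F. c i * expo i x)) < \<epsilon>"
      unfolding L2_norm_def using F(3) \<epsilon> by (intro real_less_lsqrt) auto
    with F show "\<exists>F c. finite F \<and> F \<subseteq> \<Lambda> \<and> L2_norm M (\<lambda>x. f x - (\<Sum>i\<in>F. c i * expo i x)) < \<epsilon>"
      by blast
  qed
  then show ?thesis using \<Lambda> unfolding is_spectrum_def expo_def[abs_def] by blast
qed

end

subsection \<open>Existence of the infinite convolution\<close>

lemma real_distribution_convolution:
  assumes "real_distribution A" "real_distribution B"
  shows "real_distribution (convolution A B)"
  using real_distribution_conv_upto[of "\<lambda>j. if j = 0 then A else B" 1] assms by simp

lemma char_convolution:
  assumes "real_distribution A" "real_distribution B"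
  shows "char (convolution A B) t = char A t * char B t"
proof -
  interpret A: real_distribution A by fact
  interpret B: real_distribution B by fact
  interpret P: pair_prob_space A B ..
  have "integrable (A \<Otimes>\<^sub>M B) (\<lambda>p. iexp (t * (fst p + snd p)))"
    by (rule P.integrable_iexp) measurable
  then have "char (convolution A B) t = (\<integral>x. (\<integral>y. iexp (t * (x + y)) \<partial>B) \<partial>A)"
    unfolding char_def convolution_def
    by (subst integral_distr) (auto simp: P.integral_fst'[symmetric] case_prod_beta)
  also have "\<dots> = (\<integral>x. iexp (t * x) * char B t \<partial>A)"
    by (simp add: char_def distrib_left exp_add)
  also have "\<dots> = char A t * char B t"
    by (simp add: char_def)
  finally show ?thesis .
qed

lemma AE_convolution:
  assumes A: "real_distribution A" and B: "real_distribution B"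
    and [measurable]: "Measurable.pred borel P"
    and P: "AE x in A. AE y in B. P (x + y)"
  shows "AE z in convolution A B. P z"
proof -
  interpret A: real_distribution A by fact
  interpret B: real_distribution B by fact
  interpret P: pair_prob_space A B ..
  have "AE p in A \<Otimes>\<^sub>M B. P (fst p + snd p)"
    by (intro P.AE_pair_measure[where P = "\<lambda>p. P (fst p + snd p)"]) (measurable, use P in simp)
  then show ?thesis unfolding convolution_def
    by (subst AE_distr_iff) (auto simp: case_prod_beta)
qed

lemma integral_unif:
  fixes f :: "real \<Rightarrow> 'a::{banach, second_countable_topology}"
  assumes "finite D" "D \<noteq> {}" "f \<in> borel_measurable borel"
  shows "(\<integral>x. f x \<partial>unif D) = (\<Sum>x\<in>D. f x) /\<^sub>R card D"
proof -
  have "(\<integral>x. f x \<partial>unif D) = (\<integral>x. f x \<partial>measure_pmf (pmf_of_set D))"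
    unfolding unif_def using assms(3) by (subst integral_distr) auto
  also have "\<dots> = (\<Sum>x\<in>D. pmf (pmf_of_set D) x *\<^sub>R f x)"
    using assms by (intro integral_measure_pmf) (auto simp: set_pmf_of_set)
  also have "\<dots> = (\<Sum>x\<in>D. f x) /\<^sub>R card D"
    using assms by (simp add: scaleR_sum_right inverse_eq_divide)
  finally show ?thesis .
qed

lemma AE_unif:
  assumes "finite D" "D \<noteq> {}" "\<And>x. x \<in> D \<Longrightarrow> P x" and [measurable]: "Measurable.pred borel P"
  shows "AE x in unif D. P x"
  unfolding unif_def using assms
  by (subst AE_distr_iff) (auto simp: AE_measure_pmf_iff set_pmf_of_set)

definition digit_measure :: "(nat \<Rightarrow> nat) \<Rightarrow> (nat \<Rightarrow> nat) \<Rightarrow> nat \<Rightarrow> real measure" where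
  "digit_measure M c j = unif ((\<lambda>d. real d / real (\<Prod>i<Suc j. M i)) ` {..<c j})"

lemma real_distribution_digit_measure: "real_distribution (digit_measure M c j)"
  unfolding digit_measure_def by (rule real_distribution_unif)

lemma char_unif_arith:
  assumes "R > 0" "b > 0"
  shows "char (unif ((\<lambda>d. real d / R) ` {..<b})) (2 * pi * x) = mask b (x / R)"
proof -
  have inj: "inj_on (\<lambda>d. real d / R) {..<b}" using assms by (auto simp: inj_on_def)
  have "{..<b} \<noteq> {}" using assms by (simp add: lessThan_empty_iff)
  then have "char (unif ((\<lambda>d. real d / R) ` {..<b})) (2 * pi * x) =
      (\<Sum>d<b. iexp (2 * pi * x * (real d / R))) /\<^sub>R b"
    unfolding char_def
    by (subst integral_unif) (simp_all add: sum.reindex[OF inj] card_image[OF inj])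
  also have "(\<Sum>d<b. iexp (2 * pi * x * (real d / R))) = (\<Sum>d<b. cis (2 * pi * (x / R)) ^ d)"
    unfolding Complex.DeMoivre by (simp add: cis_conv_exp ac_simps)
  also have "(\<Sum>d<b. cis (2 * pi * (x / R)) ^ d) /\<^sub>R b = mask b (x / R)"
    by (simp add: mask_def scaleR_conv_of_real inverse_eq_divide)
  finally show ?thesis .
qed

lemma cmod_cis_minus_1_le: "cmod (cis x - 1) \<le> \<bar>x\<bar>"
proof -
  have "cmod (cis x - 1) = 2 * \<bar>sin (x / 2)\<bar>"
    using cmod_1_minus_cis[of "x / 2"] by (simp add: norm_minus_commute)
  also have "\<dots> \<le> \<bar>x\<bar>" using abs_sin_x_le_abs_x[of "x / 2"] by simp
  finally show ?thesis .
qed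

lemma cmod_mask_minus_1_le:
  assumes "b > 0"
  shows "cmod (mask b x - 1) \<le> 2 * pi * \<bar>x\<bar> * b"
proof -
  have "mask b x - 1 = (\<Sum>d<b. cis (2 * pi * x * d) - 1) / b"
    using assms unfolding mask_def Complex.DeMoivre
    by (simp add: sum_subtractf diff_divide_distrib mult.commute)
  also have "cmod \<dots> \<le> (\<Sum>d<b. 2 * pi * \<bar>x\<bar> * b) / b"
    unfolding norm_divide norm_of_nat
  proof (intro divide_right_mono sum_norm_le)
    fix d assume "d \<in> {..<b}"
    then have "\<bar>2 * pi * x * d\<bar> \<le> 2 * pi * \<bar>x\<bar> * b"
      by (simp add: abs_mult mult_left_mono)
    then show "cmod (cis (2 * pi * x * d) - 1) \<le> 2 * pi * \<bar>x\<bar> * b"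
      using cmod_cis_minus_1_le order_trans by blast
  qed simp
  also have "\<dots> = 2 * pi * \<bar>x\<bar> * b" using assms by simp
  finally show ?thesis .
qed

context digit_system
begin

lemma char_digit_measure:
  "char (digit_measure M c j) (2 * pi * x) = mask (c j) (x / real (\<Prod>i<Suc j. M i))"
  unfolding digit_measure_def using radix_pos c_pos
  by (intro char_unif_arith) (simp_all only: of_nat_0_less_iff)

lemma real_distribution_conv_digit: "real_distribution (conv_upto (digit_measure M c) k)"
  by (rule real_distribution_conv_upto) (rule real_distribution_digit_measure)

lemma char_conv_digit:
  "char (conv_upto (digit_measure M c) k) (2 * pi * x) = mask_prod M c (Suc k) x"
proof (induction k)
  case 0
  then show ?case by (simp add: mask_prod_def char_digit_measure)
next
  case (Suc k)
  then show ?case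
    unfolding mask_prod_Suc[of M c "Suc k"]
    by (simp only: conv_upto.simps char_convolution[OF real_distribution_conv_digit real_distribution_digit_measure]
        char_digit_measure)
qed

text \<open>The largest digit is at most \<open>M j - 1\<close>. Writing the resulting bound as a
  difference lets the supports telescope under convolution.\<close>

lemma AE_digit_measure:
  "AE x in digit_measure M c j. 0 \<le> x \<and> x \<le> 1 / real (\<Prod>i<j. M i) - 1 / real (\<Prod>i<Suc j. M i)"
  unfolding digit_measure_def
proof (rule AE_unif)
  fix x assume "x \<in> (\<lambda>d. real d / real (\<Prod>i<Suc j. M i)) ` {..<c j}"
  then obtain d where d: "d < c j" "x = real d / real (\<Prod>i<Suc j. M i)" by auto
  let ?R = "real (\<Prod>i<j. M i)"
  have R: "?R > 0" using radix_pos by (simp only: of_nat_0_less_iff)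
  have "c j \<le> M j" using q_pos[of j] by (simp add: M_eq)
  with d(1) have "real d + 1 \<le> real (M j)" by linarith
  then have "(real d + 1) / real (\<Prod>i<Suc j. M i) \<le> real (M j) / real (\<Prod>i<Suc j. M i)"
    by (intro divide_right_mono of_nat_0_le_iff)
  also have "real (M j) / real (\<Prod>i<Suc j. M i) = 1 / ?R"
    using M_ge[of j] by simp
  finally show "0 \<le> x \<and> x \<le> 1 / ?R - 1 / real (\<Prod>i<Suc j. M i)"
    unfolding d(2) add_divide_distrib by (intro conjI divide_nonneg_nonneg of_nat_0_le_iff) linarith
qed (use c_pos[of j] in auto)

lemma AE_conv_digit:
  "AE x in conv_upto (digit_measure M c) k. 0 \<le> x \<and> x \<le> 1 - 1 / real (\<Prod>i<Suc k. M i)"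
proof (induction k)
  case 0
  show ?case using AE_digit_measure[of 0] unfolding conv_upto.simps by simp
next
  case (Suc k)
  show ?case unfolding conv_upto.simps
  proof (rule AE_convolution[OF real_distribution_conv_digit real_distribution_digit_measure])
    show "AE x in conv_upto (digit_measure M c) k. AE y in digit_measure M c (Suc k).
        0 \<le> x + y \<and> x + y \<le> 1 - 1 / real (\<Prod>i<Suc (Suc k). M i)"
      using Suc
    proof eventually_elim
      case x: (elim x)
      from AE_digit_measure[of "Suc k"] show ?case
        by eventually_elim (use x in linarith)
    qed
  qed simp
qed

lemma tight_conv_digit: "tight (conv_upto (digit_measure M c))"
proof -
  \<comment> \<open>The left endpoint is \<open>-1\<close> because \<open>0\<close> is an atom and
    tightness is tested on intervals open on the left.\<close>
  have prob: "measure (conv_upto (digit_measure M c) k) {-1<..1} = 1" for k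
  proof -
    interpret real_distribution "conv_upto (digit_measure M c) k" by (rule real_distribution_conv_digit)
    have "AE x in conv_upto (digit_measure M c) k. x \<in> {-1<..1}"
      using AE_conv_digit[of k]
    proof eventually_elim
      case (elim x)
      have "0 \<le> 1 / real (\<Prod>i<Suc k. M i)" by (intro divide_nonneg_nonneg of_nat_0_le_iff) simp
      with elim show ?case unfolding greaterThanAtMost_iff by linarith
    qed
    then show ?thesis by (subst prob_eq_1) auto
  qed
  have "\<exists>a b. a < b \<and> (\<forall>n. 1 - \<epsilon> < measure (conv_upto (digit_measure M c) n) {a<..b})" if "\<epsilon> > 0" for \<epsilon> :: real
    using prob that by (intro exI[of _ "-1"] exI[of _ 1] conjI allI) simp_all
  then show ?thesis unfolding tight_def by (blast intro: real_distribution_conv_digit)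
qed

text \<open>Consecutive products differ by at most \<open>|mask - 1|\<close>, which is of order
  \<open>|x| * c k\<close> over a radix that is at least \<open>2 ^ k * c k\<close>; the telescoping
  series converges absolutely.\<close>

lemma convergent_mask_prod: "convergent (\<lambda>k. mask_prod M c k x)"
proof -
  have "cmod (mask_prod M c (Suc k) x - mask_prod M c k x) \<le> 2 * pi * \<bar>x\<bar> * (1 / 2) ^ k" for k
  proof -
    let ?y = "x / real (\<Prod>i<Suc k. M i)"
    have R: "2 ^ k * c k \<le> (\<Prod>i<Suc k. M i)"
      using mult_le_mono[OF radix_ge[of k], of "c k" "M k"] q_pos[of k] by (simp add: M_eq)
    have R0: "real (\<Prod>i<Suc k. M i) > 0" using radix_pos[of "Suc k"] by (simp only: of_nat_0_less_iff)
    have "cmod (mask_prod M c (Suc k) x - mask_prod M c k x) = cmod (mask_prod M c k x) * cmod (mask (c k) ?y - 1)"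
      unfolding mask_prod_Suc norm_mult[symmetric] by (simp only: right_diff_distrib mult_1_right)
    also have "\<dots> \<le> 1 * (2 * pi * \<bar>?y\<bar> * c k)"
      by (intro mult_mono cmod_mask_prod_le_1 cmod_mask_minus_1_le c_pos) simp_all
    also have "\<dots> = 2 * pi * \<bar>x\<bar> * (c k / real (\<Prod>i<Suc k. M i))"
      using R0 unfolding abs_divide by simp
    also have "\<dots> \<le> 2 * pi * \<bar>x\<bar> * (1 / 2) ^ k"
    proof (intro mult_left_mono)
      have "real (2 ^ k * c k) \<le> real (\<Prod>i<Suc k. M i)" using R by (simp only: of_nat_le_iff)
      then have "c k * 2 ^ k \<le> real (\<Prod>i<Suc k. M i)" by (simp only: of_nat_mult of_nat_power of_nat_numeral mult.commute)
      then show "c k / real (\<Prod>i<Suc k. M i) \<le> (1 / 2) ^ k"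
        using R0 by (simp only: divide_le_eq) (simp add: power_divide field_simps)
    qed simp
    finally show ?thesis .
  qed
  moreover have "summable (\<lambda>k. 2 * pi * \<bar>x\<bar> * (1 / 2) ^ k)"
    by (rule summable_mult[OF summable_geometric]) simp
  ultimately have "summable (\<lambda>k. mask_prod M c (Suc k) x - mask_prod M c k x)"
    by (rule summable_comparison_test'[where N = 0, rotated])
  then have "convergent (\<lambda>n. \<Sum>k<n. mask_prod M c (Suc k) x - mask_prod M c k x)"
    by (simp only: summable_iff_convergent)
  then have "convergent (\<lambda>n. mask_prod M c n x - mask_prod M c 0 x)"
    by (simp only: sum_lessThan_telescope[of "\<lambda>k. mask_prod M c k x"])
  then have "convergent (\<lambda>n. (mask_prod M c n x - mask_prod M c 0 x) + mask_prod M c 0 x)"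
    by (intro convergent_add convergent_const)
  then show ?thesis by simp
qed

abbreviation "infinite_measure \<equiv> inf_convolution (digit_measure M c)"

text \<open>Tightness yields a limit along a subsequence. The mask products converge along the full
  sequence, so they converge to its characteristic function, and Levy's theorem upgrades this to
  weak convergence of all partial convolutions.\<close>

lemma infinite_measure:
  shows real_distribution_infinite_measure: "real_distribution infinite_measure"
    and weak_conv_infinite_measure: "weak_conv_m (conv_upto (digit_measure M c)) infinite_measure"
    and mask_prod_tendsto_char: "(\<lambda>k. mask_prod M c k x) \<longlonglongrightarrow> char infinite_measure (2 * pi * x)"
proof -
  obtain r \<eta> where r: "strict_mono r" "real_distribution \<eta>"
    "weak_conv_m (conv_upto (digit_measure M c) \<circ> id \<circ> r) \<eta>"
    using tight_imp_convergent_subsubsequence[OF tight_conv_digit strict_mono_id] by blast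
  have lim: "(\<lambda>k. mask_prod M c k x) \<longlonglongrightarrow> char \<eta> (2 * pi * x)" for x
  proof -
    from convergent_mask_prod obtain l where l: "(\<lambda>k. mask_prod M c k x) \<longlonglongrightarrow> l"
      by (auto simp: convergent_def)
    have "(\<lambda>k. char ((conv_upto (digit_measure M c) \<circ> id \<circ> r) k) (2 * pi * x)) \<longlonglongrightarrow> char \<eta> (2 * pi * x)"
      using r(2,3) by (intro levy_continuity1) (simp_all add: real_distribution_conv_digit o_def)
    moreover have "(\<lambda>k. mask_prod M c (Suc (r k)) x) \<longlonglongrightarrow> l"
      using LIMSEQ_subseq_LIMSEQ[OF LIMSEQ_Suc[OF l] r(1)] by (simp add: o_def)
    ultimately show ?thesis using l LIMSEQ_unique by (simp add: char_conv_digit) blast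
  qed
  have weak: "weak_conv_m (conv_upto (digit_measure M c)) \<eta>"
  proof (rule levy_continuity[OF real_distribution_conv_digit r(2)])
    fix t
    have "t = 2 * pi * (t / (2 * pi))" by simp
    then show "(\<lambda>k. char (conv_upto (digit_measure M c) k) t) \<longlonglongrightarrow> char \<eta> t"
      using LIMSEQ_Suc[OF lim[of "t / (2 * pi)"]] char_conv_digit[of _ "t / (2 * pi)"] by simp
  qed
  have "infinite_measure = \<eta>"
    by (rule inf_convolution_eqI[OF real_distribution_digit_measure r(2) weak])
  then show "real_distribution infinite_measure"
    "weak_conv_m (conv_upto (digit_measure M c)) infinite_measure"
    "(\<lambda>k. mask_prod M c k x) \<longlonglongrightarrow> char infinite_measure (2 * pi * x)"
    using r(2) weak lim by simp_all
qed

end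

subsection \<open>Non-degeneracy\<close>

lemma cdf_convolution:
  assumes A: "real_distribution A" and B: "real_distribution B"
  shows "cdf (convolution A B) v = (\<integral>y. cdf A (v - y) \<partial>B)"
proof -
  interpret A: real_distribution A by fact
  interpret B: real_distribution B by fact
  interpret P: pair_prob_space A B ..
  interpret C: real_distribution "convolution A B" by (rule real_distribution_convolution[OF A B])
  have "cdf (convolution A B) v = (\<integral>z. indicator {..v} z \<partial>convolution A B)"
    by (simp add: cdf_def2)
  also have "\<dots> = integral\<^sup>L (A \<Otimes>\<^sub>M B) (\<lambda>(x, y). indicator {..v} (x + y) :: real)"
    unfolding convolution_def by (subst integral_distr) (auto simp: split_def)
  also have "\<dots> = (\<integral>y. (\<integral>x. indicator {..v} (x + y) \<partial>A) \<partial>B)"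
    by (rule P.integral_snd[symmetric], rule P.integrable_const_bound[where B = 1]) (auto simp: case_prod_beta)
  also have "\<dots> = (\<integral>y. cdf A (v - y) \<partial>B)"
  proof (rule Bochner_Integration.integral_cong[OF refl])
    fix y
    have "(\<integral>x. indicator {..v} (x + y) \<partial>A) = (\<integral>x. (indicator {..v - y} x :: real) \<partial>A)"
      by (intro Bochner_Integration.integral_cong) (auto simp: indicator_def)
    then show "(\<integral>x. indicator {..v} (x + y) \<partial>A) = cdf A (v - y)" by (simp add: cdf_def2)
  qed
  finally show ?thesis .
qed

lemma (in real_distribution) cdf_measurable [measurable]: "cdf M \<in> borel_measurable borel"
  by (intro borel_measurable_mono monoI cdf_nondecreasing)

text \<open>Convolution averages the increments of the first distribution function over translates,
  so a bound uniform in \<open>a\<close> persists.\<close>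

lemma cdf_convolution_diff_le:
  assumes A: "real_distribution A" and B: "real_distribution B"
    and le: "\<And>a. cdf A (a + \<delta>) - cdf A a \<le> s"
  shows "cdf (convolution A B) (a + \<delta>) - cdf (convolution A B) a \<le> s"
proof -
  interpret A: real_distribution A by fact
  interpret B: real_distribution B by fact
  have int: "integrable B (\<lambda>y. cdf A (v - y))" for v
    by (rule B.integrable_const_bound[where B = 1])
       (auto simp: A.cdf_nonneg A.cdf_bounded_prob intro!: measurable_compose[OF _ A.cdf_measurable])
  have "cdf (convolution A B) (a + \<delta>) - cdf (convolution A B) a =
      (\<integral>y. cdf A (a + \<delta> - y) - cdf A (a - y) \<partial>B)"
    unfolding cdf_convolution[OF A B] by (intro Bochner_Integration.integral_diff[symmetric] int)
  also have "\<dots> \<le> (\<integral>y. s \<partial>B)"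
  proof (intro integral_mono Bochner_Integration.integrable_diff int)
    show "cdf A (a + \<delta> - y) - cdf A (a - y) \<le> s" for y
      using le[of "a - y"] by (simp add: algebra_simps)
  qed simp
  also have "\<dots> = s" using B.prob_space by simp
  finally show ?thesis .
qed

text \<open>The interval is covered by \<open>(b - a) / \<delta>\<close> steps, rounded up; since
  \<open>\<delta> \<le> b - a\<close>, rounding at most doubles their number.\<close>

lemma (in real_distribution) cdf_diff_le_multiple:
  assumes \<delta>: "\<delta> > 0" and le: "\<And>a. cdf M (a + \<delta>) - cdf M a \<le> s" and ab: "\<delta> \<le> b - a"
  shows "cdf M b - cdf M a \<le> 2 * (b - a) * (s / \<delta>)"
proof -
  have steps: "cdf M (a + real n * \<delta>) - cdf M a \<le> real n * s" for n
  proof (induction n)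
    case (Suc n)
    then show ?case using le[of "a + real n * \<delta>"] by (simp add: algebra_simps)
  qed simp
  define n where "n = nat \<lceil>(b - a) / \<delta>\<rceil>"
  have n: "(b - a) / \<delta> \<le> n" unfolding n_def by (rule real_nat_ceiling_ge)
  have "0 \<le> (b - a) / \<delta>" using \<delta> ab by (intro divide_nonneg_nonneg) auto
  then have n': "n \<le> (b - a) / \<delta> + 1" unfolding n_def using of_int_ceiling_le_add_one by (simp add: of_nat_nat)
  have "1 \<le> (b - a) / \<delta>" using \<delta> ab by simp
  then have n2: "n \<le> 2 * ((b - a) / \<delta>)" using n' by linarith
  have "b \<le> a + real n * \<delta>" using n \<delta> by (simp add: field_simps)
  then have "cdf M b \<le> cdf M (a + real n * \<delta>)" by (rule cdf_nondecreasing)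
  then have "cdf M b - cdf M a \<le> n * s" using steps[of n] by linarith
  also have "0 \<le> s" using le[of a] cdf_nondecreasing[of a "a + \<delta>"] \<delta> by linarith
  then have "n * s \<le> 2 * ((b - a) / \<delta>) * s" using n2 by (intro mult_right_mono)
  finally show ?thesis by (simp add: field_simps)
qed

text \<open>Convergence is known only at continuity points. Both endpoints are shifted by the same
  small \<open>s\<close>, which keeps the length \<open>b - a\<close> and avoids the countably many
  atoms; right continuity at \<open>a\<close> undoes the shift.\<close>

lemma weak_conv_cdf_diff_le:
  assumes weak: "weak_conv_m \<mu> \<rho>" and \<rho>: "real_distribution \<rho>"
    and le: "\<forall>\<^sub>F n in sequentially. \<forall>a b. \<delta> \<le> b - a \<longrightarrow> cdf (\<mu> n) b - cdf (\<mu> n) a \<le> C * (b - a)"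
    and ab: "\<delta> \<le> b - a"
  shows "cdf \<rho> b - cdf \<rho> a \<le> C * (b - a)"
proof (rule field_le_epsilon)
  fix e :: real assume e: "e > 0"
  interpret real_distribution \<rho> by fact
  have "((\<lambda>x. cdf \<rho> x) \<longlongrightarrow> cdf \<rho> a) (at_right a)"
    using cdf_is_right_cont[of a] by (simp add: continuous_within)
  then have "\<forall>\<^sub>F x in at_right a. cdf \<rho> x < cdf \<rho> a + e"
    using e by (intro order_tendstoD) auto
  then obtain d where d: "d > a" "\<And>x. a < x \<Longrightarrow> x < d \<Longrightarrow> cdf \<rho> x < cdf \<rho> a + e"
    unfolding eventually_at_right_field by blast
  define D where "D = {x. measure \<rho> {x} > 0}"
  have "countable ((\<lambda>x. x - a) ` D \<union> (\<lambda>x. x - b) ` D)"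
    using countable_atoms unfolding D_def by auto
  moreover have "uncountable {0<..<d - a}" using d(1) by (simp add: uncountable_open_interval)
  ultimately obtain s where s: "s \<in> {0<..<d - a}" "s \<notin> (\<lambda>x. x - a) ` D \<union> (\<lambda>x. x - b) ` D"
    by (metis countable_subset subsetI)
  have cont: "isCont (cdf \<rho>) (x + s)" if "x = a \<or> x = b" for x
  proof -
    have "x + s \<notin> D" using s(2) that by force
    then show ?thesis unfolding isCont_cdf D_def using measure_nonneg[of \<rho> "{x + s}"] by auto
  qed
  have "(\<lambda>n. cdf (\<mu> n) (x + s)) \<longlonglongrightarrow> cdf \<rho> (x + s)" if "x = a \<or> x = b" for x
    using weak cont[OF that] unfolding weak_conv_m_def weak_conv_def by blast
  then have "(\<lambda>n. cdf (\<mu> n) (b + s) - cdf (\<mu> n) (a + s)) \<longlonglongrightarrow> cdf \<rho> (b + s) - cdf \<rho> (a + s)"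
    by (intro tendsto_diff) blast+
  moreover have "\<forall>\<^sub>F n in sequentially. cdf (\<mu> n) (b + s) - cdf (\<mu> n) (a + s) \<le> C * (b - a)"
    using le
  proof eventually_elim
    case (elim n)
    then have "cdf (\<mu> n) (b + s) - cdf (\<mu> n) (a + s) \<le> C * ((b + s) - (a + s))"
      using ab by (intro elim[rule_format]) simp
    then show ?case by simp
  qed
  ultimately have "cdf \<rho> (b + s) - cdf \<rho> (a + s) \<le> C * (b - a)"
    by (intro tendsto_upperbound) auto
  moreover have "cdf \<rho> b \<le> cdf \<rho> (b + s)" using s by (intro cdf_nondecreasing) auto
  moreover have "cdf \<rho> (a + s) < cdf \<rho> a + e" using s by (intro d(2)) auto
  ultimately show "cdf \<rho> b - cdf \<rho> a \<le> C * (b - a) + e" by linarith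
qed

text \<open>The complementary measure below has distribution function \<open>x - cdf M x / C\<close>.\<close>

lemma (in real_distribution) Lipschitz_cdf_emeasure_le:
  assumes C: "C > 0" and lip: "\<And>a b. a < b \<Longrightarrow> cdf M b - cdf M a \<le> C * (b - a)"
    and A: "A \<in> sets borel"
  shows "ennreal (1 / C) * emeasure M A \<le> emeasure lborel A"
proof -
  define G where "G = (\<lambda>x. x - cdf M x / C)"
  define IG where "IG = interval_measure G"
  \<comment> \<open>\<open>S\<close> is the complementary measure plus \<open>M / C\<close>. It
    agrees with Lebesgue measure on half-open intervals, hence equals it, and \<open>M / C\<close>
    is one of its two summands.\<close>
  define S where "S = measure_of UNIV (sets borel) (\<lambda>A. emeasure IG A + ennreal (1 / C) * emeasure M A)"
  have G_mono: "G x \<le> G y" if "x \<le> y" for x y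
  proof (cases "x = y")
    case False
    then have "(cdf M y - cdf M x) / C \<le> y - x"
      using lip[of x y] that C by (simp add: divide_le_eq mult.commute)
    then show ?thesis by (simp add: G_def diff_divide_distrib)
  qed simp
  have G_cont: "continuous (at_right a) G" for a
    unfolding G_def by (intro continuous_intros cdf_is_right_cont) (use C in auto)
  have sets_S: "sets S = sets borel" unfolding S_def using sets.sigma_sets_eq[of "borel :: real measure"] by simp
  have emeasure_S: "emeasure S X = emeasure IG X + ennreal (1 / C) * emeasure M X" if "X \<in> sets borel" for X
  proof (rule emeasure_measure_of[OF S_def])
    show "countably_additive (sets S) (\<lambda>A. emeasure IG A + ennreal (1 / C) * emeasure M A)"
      unfolding sets_S countably_additive_def
    proof (intro allI impI)
      fix X :: "nat \<Rightarrow> real set" assume X: "range X \<subseteq> sets borel" "disjoint_family X"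
      have "(\<Sum>i. emeasure IG (X i)) = emeasure IG (\<Union>i. X i)"
        using X by (intro suminf_emeasure) (auto simp: IG_def)
      moreover have "(\<Sum>i. emeasure M (X i)) = emeasure M (\<Union>i. X i)"
        using X by (intro suminf_emeasure) auto
      ultimately show "(\<Sum>i. emeasure IG (X i) + ennreal (1 / C) * emeasure M (X i)) =
          emeasure IG (\<Union>i. X i) + ennreal (1 / C) * emeasure M (\<Union>i. X i)"
        by (simp add: suminf_add[symmetric])
    qed
  qed (use that sets_S in \<open>auto simp: positive_def\<close>)
  have Ioc: "emeasure S {a<..b} = ennreal (b - a)" if "a \<le> b" for a b
  proof -
    have "emeasure IG {a<..b} = ennreal (G b - G a)"
      unfolding IG_def by (rule emeasure_interval_measure_Ioc[OF that G_mono G_cont])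
    moreover have "emeasure M {a<..b} = ennreal (cdf M b - cdf M a)"
      using that by (rule emeasure_Ioc)
    ultimately have "emeasure S {a<..b} = ennreal (G b - G a) + ennreal (1 / C) * ennreal (cdf M b - cdf M a)"
      by (simp add: emeasure_S)
    also have "\<dots> = ennreal ((G b - G a) + 1 / C * (cdf M b - cdf M a))"
      using G_mono[OF that] cdf_nondecreasing[OF that] C
      by (simp add: ennreal_mult[symmetric] ennreal_plus[symmetric] del: ennreal_plus)
    also have "(G b - G a) + 1 / C * (cdf M b - cdf M a) = b - a"
      by (simp add: G_def diff_divide_distrib)
    finally show ?thesis .
  qed
  have "S = lborel"
  proof (rule measure_eqI_generator_eq[where E = "range (\<lambda>(a, b). {a<..b::real})" and \<Omega> = UNIV and A = "\<lambda>i. {- real i<..real i}"])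
    show "Int_stable (range (\<lambda>(a, b). {a<..b::real}))"
      by (auto simp: Int_stable_def Int_greaterThanAtMost)
    show "sets S = sigma_sets UNIV (range (\<lambda>(a, b). {a<..b::real}))"
      "sets lborel = sigma_sets UNIV (range (\<lambda>(a, b). {a<..b::real}))"
      unfolding sets_S by (simp_all add: borel_sigma_sets_Ioc)
    show "emeasure S X = emeasure lborel X" if "X \<in> range (\<lambda>(a, b). {a<..b::real})" for X
    proof -
      from that obtain p where "X = (case p of (a, b) \<Rightarrow> {a<..b})" by blast
      then obtain a b where X: "X = {a<..b}" by (cases p) simp
      show ?thesis unfolding X by (cases "a \<le> b") (simp_all add: Ioc)
    qed
    show "(\<Union>i. {- real i<..real i}) = UNIV" by (rule UN_Ioc_eq_UNIV)
    show "emeasure S {- real i<..real i} \<noteq> \<infinity>" for i by (simp add: Ioc)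
  qed auto
  then show ?thesis using emeasure_S[OF A] by (metis add.commute le_iff_add)
qed

lemma (in real_distribution) Lipschitz_cdf_not_singular:
  assumes C: "C > 0" and lip: "\<And>a b. a < b \<Longrightarrow> cdf M b - cdf M a \<le> C * (b - a)"
  shows "\<not> mutually_singular M lborel"
proof
  assume "mutually_singular M lborel"
  then obtain A where A: "A \<in> sets borel" "emeasure M A = 0" "emeasure lborel (UNIV - A) = 0"
    by (auto simp: mutually_singular_def)
  have "ennreal (1 / C) * emeasure M (UNIV - A) \<le> emeasure lborel (UNIV - A)"
    using A(1) by (intro Lipschitz_cdf_emeasure_le[OF C lip]) auto
  then have "emeasure M (UNIV - A) = 0" using A(3) C by simp
  moreover have "emeasure M UNIV \<le> emeasure M A + emeasure M (UNIV - A)"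
    using A(1) emeasure_subadditive[of A M "UNIV - A"] by (simp add: Un_Diff_cancel)
  ultimately show False using A(2) emeasure_space_1 by simp
qed

text \<open>The atoms are spaced exactly \<open>\<delta>\<close> apart, so the increments over one
  step telescope to a single increment of length \<open>c * \<delta>\<close>, averaged over the
  \<open>c\<close> atoms.\<close>

lemma cdf_digit_step:
  assumes A: "real_distribution A" and \<delta>: "\<delta> > 0" and c: "c > 0"
  shows "cdf (convolution A (unif ((\<lambda>d. real d * \<delta>) ` {..<c}))) (a + \<delta>) -
      cdf (convolution A (unif ((\<lambda>d. real d * \<delta>) ` {..<c}))) a =
    (cdf A (a + \<delta>) - cdf A (a + \<delta> - real c * \<delta>)) / c"
proof -
  interpret A: real_distribution A by fact
  have inj: "inj_on (\<lambda>d. real d * \<delta>) {..<c}" using \<delta> by (auto simp: inj_on_def)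
  have ne: "{..<c} \<noteq> {}" using c by (simp add: lessThan_empty_iff)
  have cdf: "cdf (convolution A (unif ((\<lambda>d. real d * \<delta>) ` {..<c}))) v = (\<Sum>d<c. cdf A (v - real d * \<delta>)) / c" for v
  proof -
    have "(\<lambda>y. cdf A (v - y)) \<in> borel_measurable borel" by (rule measurable_compose[OF _ A.cdf_measurable]) simp
    then show ?thesis
      unfolding cdf_convolution[OF A real_distribution_unif]
      by (subst integral_unif) (use ne in \<open>simp_all add: sum.reindex[OF inj] card_image[OF inj] inverse_eq_divide\<close>)
  qed
  have "(\<Sum>d<c. cdf A (a + \<delta> - real d * \<delta>)) - (\<Sum>d<c. cdf A (a - real d * \<delta>)) =
      (\<Sum>d<c. cdf A (a + \<delta> - real d * \<delta>) - cdf A (a + \<delta> - real (Suc d) * \<delta>))"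
    unfolding sum_subtractf[symmetric] by (intro sum.cong refl) (simp add: algebra_simps)
  also have "\<dots> = cdf A (a + \<delta>) - cdf A (a + \<delta> - real c * \<delta>)"
    using sum_lessThan_telescope'[of "\<lambda>d. cdf A (a + \<delta> - real d * \<delta>)" c] by simp
  finally show ?thesis unfolding cdf by (simp add: diff_divide_distrib[symmetric])
qed

context digit_system
begin

text \<open>Each digit trades an increment over the new spacing for \<open>1 / c\<close> times an
  increment over \<open>c\<close> such spacings, which is no longer than the previous spacing
  because \<open>c j \<le> M j\<close>.\<close>

lemma cdf_conv_digit_diff_le:
  "cdf (conv_upto (digit_measure M c) k) (a + 1 / real (\<Prod>i<Suc k. M i)) -
   cdf (conv_upto (digit_measure M c) k) a \<le> 1 / real (\<Prod>i<Suc k. c i)"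
proof (induction k arbitrary: a)
  case 0
  interpret real_distribution "return borel (0::real)"
    by (intro real_distribution.intro prob_space_return real_distribution_axioms.intro) auto
  have R: "real (M 0) > 0" using M_ge[of 0] by simp
  \<comment> \<open>Viewing the first factor as a convolution with the point mass at
    \<open>0\<close> lets the base case use \<open>cdf_digit_step\<close> as well.\<close>
  have "digit_measure M c 0 = convolution (return borel 0) (digit_measure M c 0)"
  proof (rule Levy_uniqueness[OF real_distribution_digit_measure])
    show "real_distribution (convolution (return borel 0) (digit_measure M c 0))"
      by (intro real_distribution_convolution real_distribution_digit_measure real_distribution_axioms)
    show "char (digit_measure M c 0) = char (convolution (return borel 0) (digit_measure M c 0))"
      by (intro ext, subst char_convolution)
         (auto simp: real_distribution_axioms real_distribution_digit_measure char_def integral_return)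
  qed
  then have "cdf (digit_measure M c 0) (a + 1 / real (M 0)) - cdf (digit_measure M c 0) a =
     (cdf (return borel 0) (a + 1 / real (M 0)) - cdf (return borel 0) (a + 1 / real (M 0) - real (c 0) * (1 / real (M 0)))) / c 0"
    using cdf_digit_step[OF real_distribution_axioms, of "1 / real (M 0)" "c 0" a] R c_pos[of 0]
    by (simp add: digit_measure_def)
  also have "\<dots> \<le> 1 / c 0"
    using cdf_bounded_prob cdf_nonneg by (intro divide_right_mono) (smt (verit), simp)
  finally show ?case by simp
next
  case (Suc k)
  let ?\<mu> = "conv_upto (digit_measure M c) k"
  interpret real_distribution ?\<mu> by (rule real_distribution_conv_digit)
  define \<delta> where "\<delta> = 1 / real (\<Prod>i<Suc (Suc k). M i)"
  have R: "real (\<Prod>i<Suc j. M i) > 0" for j using radix_pos[of "Suc j"] by (simp only: of_nat_0_less_iff)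
  have \<delta>: "\<delta> > 0" unfolding \<delta>_def using R[of "Suc k"] by (simp only: zero_less_divide_1_iff)
  have "digit_measure M c (Suc k) = unif ((\<lambda>d. real d * \<delta>) ` {..<c (Suc k)})"
    by (simp add: digit_measure_def \<delta>_def)
  then have "cdf (conv_upto (digit_measure M c) (Suc k)) (a + \<delta>) - cdf (conv_upto (digit_measure M c) (Suc k)) a =
     (cdf ?\<mu> (a + \<delta>) - cdf ?\<mu> (a + \<delta> - real (c (Suc k)) * \<delta>)) / c (Suc k)"
    using cdf_digit_step[OF real_distribution_axioms \<delta> c_pos[of "Suc k"]] by simp
  also have "\<dots> \<le> (1 / real (\<Prod>i<Suc k. c i)) / c (Suc k)"
  proof (intro divide_right_mono)
    let ?a = "a + \<delta> - 1 / real (\<Prod>i<Suc k. M i)"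
    have "c (Suc k) \<le> M (Suc k)" using q_pos[of "Suc k"] by (simp add: M_eq)
    then have "real (c (Suc k)) * \<delta> \<le> real (M (Suc k)) * \<delta>" using \<delta> by (intro mult_right_mono) auto
    also have "\<dots> = 1 / real (\<Prod>i<Suc k. M i)"
      unfolding \<delta>_def using R[of "Suc k"] M_ge[of "Suc k"] by simp
    finally have "cdf ?\<mu> ?a \<le> cdf ?\<mu> (a + \<delta> - real (c (Suc k)) * \<delta>)" by (intro cdf_nondecreasing) linarith
    moreover have "cdf ?\<mu> (a + \<delta>) - cdf ?\<mu> ?a \<le> 1 / real (\<Prod>i<Suc k. c i)"
      using Suc[of ?a] by (simp del: prod.lessThan_Suc)
    ultimately show "cdf ?\<mu> (a + \<delta>) - cdf ?\<mu> (a + \<delta> - real (c (Suc k)) * \<delta>) \<le> 1 / real (\<Prod>i<Suc k. c i)" by linarith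
  qed simp
  finally show ?case unfolding \<delta>_def by simp
qed

text \<open>After \<open>J\<close> factors the slope at the scale of the radix is the product of the
  radices over that of the digit counts, which is the product of the first \<open>J\<close>
  quotients. Further convolutions preserve it, and the factor \<open>2\<close> comes from covering
  longer intervals.\<close>

lemma cdf_infinite_measure_diff_le:
  assumes J: "(\<Prod>i<J. q i) \<le> T" "J > 0" and ab: "(1 / 2) ^ J \<le> b - a"
  shows "cdf infinite_measure b - cdf infinite_measure a \<le> 2 * real T * (b - a)"
proof (rule weak_conv_cdf_diff_le[OF weak_conv_infinite_measure real_distribution_infinite_measure _ ab])
  define \<delta> where "\<delta> = 1 / real (\<Prod>i<J. M i)"
  define s where "s = 1 / real (\<Prod>i<J. c i)"
  have pos: "real (\<Prod>i<J. M i) > 0" using radix_pos by (simp only: of_nat_0_less_iff)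
  have \<delta>: "\<delta> > 0" unfolding \<delta>_def using pos by simp
  have "real (2 ^ J) \<le> real (\<Prod>i<J. M i)" using radix_ge by (simp only: of_nat_le_iff)
  then have \<delta>_le: "\<delta> \<le> (1 / 2) ^ J"
    unfolding \<delta>_def power_one_over using pos by (intro divide_left_mono) simp_all
  have "(\<Prod>i<J. c i) > 0" by (intro prod_pos) (simp add: c_pos)
  then have "s / \<delta> = real (\<Prod>i<J. q i)"
    unfolding s_def \<delta>_def M_eq prod.distrib by simp
  then have sT: "s / \<delta> \<le> real T" using J(1) by (simp only: of_nat_le_iff)
  \<comment> \<open>Index \<open>J - 1\<close> of \<open>conv_upto\<close> is the convolution of
    exactly \<open>J\<close> factors.\<close>
  have le: "cdf (conv_upto (digit_measure M c) (J - 1 + n)) (x + \<delta>) - cdf (conv_upto (digit_measure M c) (J - 1 + n)) x \<le> s" for n x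
  proof (induction n arbitrary: x)
    case 0
    then show ?case using cdf_conv_digit_diff_le[of "J - 1" x] J(2) by (simp only: \<delta>_def s_def Suc_diff_1 add_0_right)
  next
    case (Suc n)
    then show ?case unfolding add_Suc_right conv_upto.simps
      by (intro cdf_convolution_diff_le real_distribution_conv_digit real_distribution_digit_measure)
  qed
  have "cdf (conv_upto (digit_measure M c) n) y - cdf (conv_upto (digit_measure M c) n) x \<le> 2 * real T * (y - x)"
    if n: "n \<ge> J - 1" and xy: "(1 / 2) ^ J \<le> y - x" for n x y
  proof -
    interpret real_distribution "conv_upto (digit_measure M c) n" by (rule real_distribution_conv_digit)
    obtain l where l: "n = J - 1 + l" using n le_Suc_ex by blast
    have "cdf (conv_upto (digit_measure M c) n) y - cdf (conv_upto (digit_measure M c) n) x \<le> 2 * (y - x) * (s / \<delta>)"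
    proof (rule cdf_diff_le_multiple[OF \<delta>])
      show "cdf (conv_upto (digit_measure M c) n) (z + \<delta>) - cdf (conv_upto (digit_measure M c) n) z \<le> s" for z
        unfolding l by (rule le)
    qed (use \<delta>_le xy in linarith)
    also have "\<dots> \<le> 2 * (y - x) * real T"
    proof (intro mult_left_mono sT)
      have "0 \<le> (1 / 2 :: real) ^ J" by simp
      from order_trans[OF this xy] show "0 \<le> 2 * (y - x)" by simp
    qed
    finally show ?thesis by (simp add: ac_simps)
  qed
  then show "\<forall>\<^sub>F n in sequentially. \<forall>x y. (1 / 2) ^ J \<le> y - x \<longrightarrow>
      cdf (conv_upto (digit_measure M c) n) y - cdf (conv_upto (digit_measure M c) n) x \<le> 2 * real T * (y - x)"
    unfolding eventually_sequentially by blast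
qed

text \<open>Otherwise, for every \<open>J\<close>, all products of \<open>J\<close> consecutive
  quotients are at most \<open>T\<close> from some level on. The tails then have slope at most a
  multiple of \<open>T\<close> at scale \<open>2^-J\<close>, and their limit has it at every scale,
  so its distribution function is Lipschitz and it cannot be singular.\<close>

lemma singular_limit_imp_large_quotients:
  assumes r: "strict_mono r" and \<rho>: "real_distribution \<rho>" "mutually_singular \<rho> lborel"
    and weak: "weak_conv_m (\<lambda>j. inf_convolution (digit_measure (\<lambda>i. M (r j + i)) (\<lambda>i. c (r j + i)))) \<rho>"
  shows "\<exists>J. \<forall>K0. \<exists>K\<ge>K0. T < (\<Prod>i<J. q (K + i))"
proof (rule ccontr)
  assume contra: "\<not> ?thesis"
  \<comment> \<open>The maximum keeps the Lipschitz constant positive when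
    \<open>T = 0\<close>.\<close>
  define T' where "T' = max T 1"
  interpret real_distribution \<rho> by fact
  have "cdf \<rho> b - cdf \<rho> a \<le> 2 * real T' * (b - a)" if "a < b" for a b
  proof -
    obtain J0 where "(1 / 2) ^ J0 < b - a" using real_arch_pow_inv[of "b - a" "1 / 2"] \<open>a < b\<close> by auto
    define J where "J = Suc J0"
    have J: "(1 / 2) ^ J \<le> b - a" unfolding J_def using \<open>(1 / 2) ^ J0 < b - a\<close>
      by (intro order_trans[OF power_decreasing[of J0 "Suc J0"] less_imp_le]) auto
    obtain K0 where K0: "\<And>K. K \<ge> K0 \<Longrightarrow> (\<Prod>i<J. q (K + i)) \<le> T"
      using contra by (meson not_less)
    show ?thesis
    proof (rule weak_conv_cdf_diff_le[OF weak \<rho>(1) _ J])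
      have "cdf (inf_convolution (digit_measure (\<lambda>i. M (r j + i)) (\<lambda>i. c (r j + i)))) y -
          cdf (inf_convolution (digit_measure (\<lambda>i. M (r j + i)) (\<lambda>i. c (r j + i)))) x \<le> 2 * real T' * (y - x)"
        if j: "j \<ge> K0" and "(1 / 2) ^ J \<le> y - x" for j x y
      proof -
        interpret S: digit_system "\<lambda>i. M (r j + i)" "\<lambda>i. c (r j + i)" "\<lambda>i. q (r j + i)" by (rule shift)
        have "K0 \<le> r j" using j seq_suble[OF r, of j] by linarith
        from K0[OF this] have "(\<Prod>i<J. q (r j + i)) \<le> T'" unfolding T'_def by simp
        then show ?thesis using that by (intro S.cdf_infinite_measure_diff_le[of J]) (auto simp: J_def)
      qed
      then show "\<forall>\<^sub>F j in sequentially. \<forall>x y. (1 / 2) ^ J \<le> y - x \<longrightarrow>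
          cdf (inf_convolution (digit_measure (\<lambda>i. M (r j + i)) (\<lambda>i. c (r j + i)))) y -
          cdf (inf_convolution (digit_measure (\<lambda>i. M (r j + i)) (\<lambda>i. c (r j + i)))) x \<le> 2 * real T' * (y - x)"
        unfolding eventually_sequentially by blast
    qed
  qed
  then have "\<not> mutually_singular \<rho> lborel"
    by (intro Lipschitz_cdf_not_singular[of "2 * real T'"]) (auto simp: T'_def)
  with \<rho>(2) show False by contradiction
qed

end

subsection \<open>Common spectra\<close>

text \<open>Every real \<open>a\<close> lies in the translate of \<open>X\<close> by
  \<open>a\<close>, moved back by a fixed \<open>x\<close> in \<open>X\<close>; countably many
  countable translates would cover the line.\<close>

lemma uncountable_translates:
  fixes X :: "real set"
  assumes "countable X" "X \<noteq> {}"
  shows "uncountable (range (\<lambda>a. (\<lambda>x. x + a) ` X))"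
proof
  assume *: "countable (range (\<lambda>a. (\<lambda>x. x + a) ` X))"
  obtain x where x: "x \<in> X" using assms by blast
  have "countable (\<Union>Y\<in>range (\<lambda>a. (\<lambda>x. x + a) ` X). (\<lambda>y. y - x) ` Y)"
    using * assms(1) by (intro countable_UN) auto
  moreover have "UNIV \<subseteq> (\<Union>Y\<in>range (\<lambda>a. (\<lambda>x. x + a) ` X). (\<lambda>y. y - x) ` Y)"
    using x by (auto simp: image_iff intro!: bexI[of _ x])
  ultimately show False using uncountable_UNIV_real countable_subset by blast
qed

context digit_system
begin

text \<open>Let \<open>g\<close> and \<open>G\<close> be the squared transforms of the infinite
  measure and of its partial convolutions. At a good level \<open>G\<close> is at most
  \<open>g / \<delta>^2\<close> on the level set. A finite \<open>F\<close> almost exhausting the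
  sum of \<open>g\<close> thus carries nearly all of the total \<open>1\<close> of \<open>G\<close>;
  on \<open>F\<close> itself \<open>G\<close> converges to \<open>g\<close>.\<close>

lemma ex_common_spectrum:
  assumes b: "\<And>j. c j \<le> b"
    and J: "\<And>T. \<exists>J. \<forall>K0. \<exists>K\<ge>K0. T < (\<Prod>i<J. q (K + i))"
  obtains X :: "real set" where "countable X" "X \<noteq> {}"
    "\<And>t a. t > 0 \<Longrightarrow> (\<And>j. coprime t (c j)) \<Longrightarrow>
      is_spectrum infinite_measure ((\<lambda>x. real t * x) ` (\<lambda>x. x + a) ` X)"
proof -
  obtain k :: "nat \<Rightarrow> nat" and X where k: "strict_mono k" and X: "\<And>i. level_spectrum (k i) (X i)" "incseq X"
    and bound: "\<And>t. t > 0 \<Longrightarrow> (\<And>j. coprime t (c j)) \<Longrightarrow> \<exists>\<epsilon>>0. \<forall>r. \<exists>i\<ge>r. \<forall>z\<in>X i. \<forall>x. \<bar>x\<bar> \<le> real r \<longrightarrow>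
      (\<forall>L. \<epsilon> \<le> cmod (mask_prod (\<lambda>j. M (k i + j)) (\<lambda>j. c (k i + j)) L
       ((x + real t * of_int z) / real (\<Prod>j<k i. M j))))"
    using ex_spectrum_sequence[OF b J] by blast
  interpret real_distribution infinite_measure by (rule real_distribution_infinite_measure)
  let ?\<chi> = "\<lambda>s. char infinite_measure (2 * pi * s)"
  define Y where "Y = (\<Union>i. X i)"
  have split: "(\<lambda>L. mask_prod M c K x * mask_prod (\<lambda>i. M (K + i)) (\<lambda>i. c (K + i)) L (x / real (\<Prod>i<K. M i)))
      \<longlonglongrightarrow> ?\<chi> x" for K x
    using LIMSEQ_ignore_initial_segment[OF mask_prod_tendsto_char[of x], of K]
    by (simp only: add.commute[of _ K] mask_prod_add)
  show ?thesis
  proof (rule that)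
    show "countable (real_of_int ` Y)" by simp
    have "X 0 \<noteq> {}" using level_spectrum_sum[OF X(1), of 1 0 0] by auto
    then show "real_of_int ` Y \<noteq> {}" by (auto simp: Y_def)
  next
    fix t :: nat and a :: real
    assume t: "t > 0" "\<And>j. coprime t (c j)"
    define l where "l = (\<lambda>z. real t * (real_of_int z + a))"
    have image: "(\<lambda>x. real t * x) ` (\<lambda>x. x + a) ` real_of_int ` Y = l ` Y"
      by (simp add: image_image l_def)
    have inj: "inj l" using t(1) by (auto simp: inj_def l_def)
    have orth: "?\<chi> (l z' - l z) = 0" if "z \<in> Y" "z' \<in> Y" "z \<noteq> z'" for z z'
    proof -
      obtain i i' where "z \<in> X i" "z' \<in> X i'" using \<open>z \<in> Y\<close> \<open>z' \<in> Y\<close> unfolding Y_def by blast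
      then have "z \<in> X (max i i')" "z' \<in> X (max i i')"
        using X(2) by (meson incseqD max.cobounded1 max.cobounded2 subsetD)+
      then have "mask_prod M c (k (max i i')) (real t * of_int (z' - z)) = 0"
        using t that(3) by (intro level_spectrum_orthogonal[OF X(1)])
      then have "?\<chi> (real t * of_int (z' - z)) = 0"
        using split[of "k (max i i')" "real t * of_int (z' - z)"] by (simp add: LIMSEQ_const_iff)
      then show ?thesis by (simp add: l_def algebra_simps)
    qed
    have "is_spectrum infinite_measure (l ` Y)"
    proof (rule is_spectrumI)
      show "countable (l ` Y)" by simp
      show "?\<chi> (x' - x) = 0" if "x \<in> l ` Y" "x' \<in> l ` Y" "x \<noteq> x'" for x x'
        using that orth by blast
      fix \<xi> \<epsilon> :: real assume "\<epsilon> > 0"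
      obtain \<delta> where \<delta>: "\<delta> > 0" "\<And>r. \<exists>i\<ge>r. \<forall>z\<in>X i. \<forall>x. \<bar>x\<bar> \<le> real r \<longrightarrow>
        (\<forall>L. \<delta> \<le> cmod (mask_prod (\<lambda>j. M (k i + j)) (\<lambda>j. c (k i + j)) L
         ((x + real t * of_int z) / real (\<Prod>j<k i. M j))))"
        using bound[OF t] by blast
      \<comment> \<open>Translation and test frequency merge into one real offset. The lower bounds
        hold for all offsets up to \<open>r\<close>, so every translate is a spectrum too.\<close>
      define x0 where "x0 = real t * a - \<xi>"
      define g where "g = (\<lambda>z. (cmod (?\<chi> (l z - \<xi>)))\<^sup>2)"
      define G where "G = (\<lambda>K z. (cmod (mask_prod M c K (x0 + real t * of_int z)))\<^sup>2)"
      have l_\<xi>: "l z - \<xi> = x0 + real t * of_int z" for z by (simp add: l_def x0_def algebra_simps)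
      have g_sum: "sum g F \<le> 1" if "finite F" "F \<subseteq> Y" for F
      proof -
        have "(\<Sum>x\<in>l ` F. (cmod (?\<chi> (x - \<xi>)))\<^sup>2) \<le> 1"
          using that orth by (intro sum_char_sq_le_1) auto
        then show ?thesis by (subst (asm) sum.reindex) (auto simp: g_def intro: inj_on_subset[OF inj])
      qed
      define S where "S = (SUP F\<in>{F. finite F \<and> F \<subseteq> Y}. sum g F)"
      have bdd: "bdd_above (sum g ` {F. finite F \<and> F \<subseteq> Y})" using g_sum by (intro bdd_aboveI[of _ 1]) auto
      have S: "sum g F \<le> S" if "finite F" "F \<subseteq> Y" for F
        unfolding S_def using that by (intro cSUP_upper bdd) auto
      \<comment> \<open>Chosen so that division by \<open>\<delta>^2\<close> leaves an error of
        \<open>\<epsilon> / 2\<close>; convergence on \<open>F\<close> takes the other half.\<close>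
      define e where "e = \<epsilon> / 2 * \<delta>\<^sup>2"
      have "e > 0" unfolding e_def using \<open>\<epsilon> > 0\<close> \<delta>(1) by simp
      then have "\<exists>F\<in>{F. finite F \<and> F \<subseteq> Y}. S - e < sum g F"
        unfolding S_def by (subst less_cSUP_iff[symmetric]) (use bdd in auto)
      then obtain F where F: "finite F" "F \<subseteq> Y" "S - e < sum g F" by blast
      have "(\<lambda>K. sum (G K) F) \<longlonglongrightarrow> sum g F"
        unfolding G_def g_def l_\<xi> by (intro tendsto_intros mask_prod_tendsto_char)
      then have "\<forall>\<^sub>F K in sequentially. sum (G K) F < sum g F + \<epsilon> / 2"
        using \<open>\<epsilon> > 0\<close> by (intro order_tendstoD) auto
      then obtain K0 where K0: "\<And>K. K \<ge> K0 \<Longrightarrow> sum (G K) F < sum g F + \<epsilon> / 2"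
        unfolding eventually_sequentially by blast
      \<comment> \<open>One index serves both needs: the offset is within the range of the lower
        bound, and \<open>k i \<ge> i \<ge> K0\<close>.\<close>
      define r where "r = max K0 (nat \<lceil>\<bar>x0\<bar>\<rceil>)"
      have r: "\<bar>x0\<bar> \<le> real r" "K0 \<le> r" unfolding r_def by linarith+
      obtain i where i: "i \<ge> r" and lower: "\<And>z L. z \<in> X i \<Longrightarrow> \<delta> \<le> cmod (mask_prod (\<lambda>j. M (k i + j)) (\<lambda>j. c (k i + j)) L
         ((x0 + real t * of_int z) / real (\<Prod>j<k i. M j)))"
        using \<delta>(2)[of r] r(1) by blast
      have ki: "K0 \<le> k i" using i r(2) seq_suble[OF k, of i] by linarith
      have G_le: "G (k i) z * \<delta>\<^sup>2 \<le> g z" if "z \<in> X i" for z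
      proof -
        have "cmod (mask_prod M c (k i) (x0 + real t * of_int z)) * \<delta> \<le> cmod (?\<chi> (x0 + real t * of_int z))"
        proof (rule LIMSEQ_le_const[OF tendsto_norm[OF split]], intro exI allI impI)
          fix L :: nat
          show "cmod (mask_prod M c (k i) (x0 + real t * of_int z)) * \<delta> \<le>
            cmod (mask_prod M c (k i) (x0 + real t * of_int z) *
              mask_prod (\<lambda>j. M (k i + j)) (\<lambda>j. c (k i + j)) L ((x0 + real t * of_int z) / real (\<Prod>j<k i. M j)))"
            unfolding norm_mult by (intro mult_left_mono lower that) simp
        qed
        then have "(cmod (mask_prod M c (k i) (x0 + real t * of_int z)) * \<delta>)\<^sup>2 \<le> (cmod (?\<chi> (x0 + real t * of_int z)))\<^sup>2"
          using \<delta>(1) by (intro power_mono) auto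
        then show ?thesis by (simp add: G_def g_def l_\<xi> power_mult_distrib)
      qed
      have fin: "finite (X i)" using X(1) by (rule level_spectrum_finite)
      have XY: "X i \<subseteq> Y" by (auto simp: Y_def)
      have "sum (G (k i)) (X i - F) * \<delta>\<^sup>2 \<le> sum g (X i - F)"
        unfolding sum_distrib_right by (intro sum_mono G_le) auto
      also have "sum g (X i - F) < e"
      proof -
        have "sum g (X i - F) + sum g F = sum g ((X i - F) \<union> F)"
          using fin F(1) by (intro sum.union_disjoint[symmetric]) auto
        also have "\<dots> \<le> S" using fin F XY by (intro S) auto
        finally show ?thesis using F(3) by linarith
      qed
      finally have "sum (G (k i)) (X i - F) < \<epsilon> / 2" using \<delta>(1) by (simp add: e_def)
      moreover have "sum (G (k i)) (X i) = 1"
        unfolding G_def by (rule level_spectrum_sum[OF X(1) t])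
      moreover have "sum (G (k i)) (X i) \<le> sum (G (k i)) ((X i - F) \<union> F)"
        using fin F(1) by (intro sum_mono2) (auto simp: G_def)
      moreover have "sum (G (k i)) ((X i - F) \<union> F) = sum (G (k i)) (X i - F) + sum (G (k i)) F"
        using fin F(1) by (intro sum.union_disjoint) auto
      ultimately have "1 - \<epsilon> < sum g F" using K0[OF ki] by linarith
      moreover have "sum g F = (\<Sum>x\<in>l ` F. (cmod (?\<chi> (x - \<xi>)))\<^sup>2)"
        by (subst sum.reindex) (auto simp: g_def intro: inj_on_subset[OF inj])
      ultimately show "\<exists>F. finite F \<and> F \<subseteq> l ` Y \<and> 1 - \<epsilon> < (\<Sum>x\<in>F. (cmod (?\<chi> (x - \<xi>)))\<^sup>2)"
        using F by (intro exI[of _ "l ` F"]) auto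
    qed
    then show "is_spectrum infinite_measure ((\<lambda>x. real t * x) ` (\<lambda>x. x + a) ` real_of_int ` Y)"
      unfolding image .
  qed
qed

end

section \<open>Measurable dependence on the word\<close>

lemma cylinder_function_measurable:
  assumes "\<And>\<alpha> \<beta>. \<alpha> \<in> words m \<Longrightarrow> \<beta> \<in> words m \<Longrightarrow> (\<And>i. i \<le> k \<Longrightarrow> \<alpha> i = \<beta> i) \<Longrightarrow> f \<alpha> = f \<beta>"
    and range: "f \<in> words m \<rightarrow> space N"
  shows "f \<in> measurable (borel_words m) N"
proof (rule measurableI)
  interpret Metric_space "words m" word_dist by (rule Metric_space_words)
  have Pow: "{U. openin mtopology U} \<subseteq> Pow (words m)"
    using openin_subset by fastforce
  then have space: "space (borel_words m) = words m"
    by (simp add: borel_words_def space_measure_of)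
  show "f \<omega> \<in> space N" if "\<omega> \<in> space (borel_words m)" for \<omega>
    using range that space by auto
  fix A assume "A \<in> sets N"
  have "openin mtopology (f -` A \<inter> words m)"
    unfolding openin_mtopology
  proof (intro conjI allI impI)
    fix \<alpha> assume \<alpha>: "\<alpha> \<in> f -` A \<inter> words m"
    \<comment> \<open>Distance below \<open>(1 / 2) ^ k\<close> means that the first difference has
      index above \<open>k\<close>, so the \<open>k + 1\<close> letters that \<open>f\<close> looks
      at agree.\<close>
    have "mball \<alpha> ((1 / 2) ^ k) \<subseteq> f -` A \<inter> words m"
    proof
      fix \<beta> assume \<beta>: "\<beta> \<in> mball \<alpha> ((1 / 2) ^ k)"
      then have "\<beta> \<in> words m" by simp
      have "\<alpha> i = \<beta> i" if "i \<le> k" for i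
      proof (rule ccontr)
        assume neq: "\<alpha> i \<noteq> \<beta> i"
        then have "(LEAST i. \<alpha> i \<noteq> \<beta> i) \<le> k" using that by (meson Least_le order_trans)
        then have "(1 / 2 :: real) ^ k \<le> (1 / 2) ^ (LEAST i. \<alpha> i \<noteq> \<beta> i)" by (intro power_decreasing) auto
        then show False using \<beta> neq by (auto simp: word_dist_def split: if_splits)
      qed
      then have "f \<alpha> = f \<beta>" using \<alpha> \<open>\<beta> \<in> words m\<close> by (intro assms(1)) auto
      then show "\<beta> \<in> f -` A \<inter> words m" using \<alpha> \<open>\<beta> \<in> words m\<close> by simp
    qed
    then show "\<exists>r>0. mball \<alpha> r \<subseteq> f -` A \<inter> words m"
      by (intro exI[of _ "(1 / 2) ^ k"]) auto
  qed simp
  then show "f -` A \<inter> space (borel_words m) \<in> sets (borel_words m)"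
    unfolding space using Pow by (simp add: borel_words_def)
qed

text \<open>Half-line probabilities are limits of integrals of continuous steps, and these are limits of
  functions of finitely many letters.\<close>

lemma random_measure_weak_limit:
  fixes \<mu> :: "nat \<Rightarrow> (nat \<Rightarrow> nat) \<Rightarrow> real measure"
  assumes P: "sets P = sets (borel_words m)"
    and \<mu>: "\<And>k \<omega>. \<omega> \<in> words m \<Longrightarrow> real_distribution (\<mu> k \<omega>)"
    and loc: "\<And>k \<alpha> \<beta>. \<alpha> \<in> words m \<Longrightarrow> \<beta> \<in> words m \<Longrightarrow> (\<And>i. i \<le> k \<Longrightarrow> \<alpha> i = \<beta> i) \<Longrightarrow> \<mu> k \<alpha> = \<mu> k \<beta>"
    and \<eta>: "\<And>\<omega>. \<omega> \<in> words m \<Longrightarrow> real_distribution (\<eta> \<omega>)"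
    and weak: "\<And>\<omega>. \<omega> \<in> words m \<Longrightarrow> weak_conv_m (\<lambda>k. \<mu> k \<omega>) (\<eta> \<omega>)"
  shows "random_measure P \<eta>"
proof -
  have Pow: "{U. openin (Metric_space.mtopology (words m) word_dist) U} \<subseteq> Pow (words m)"
    using openin_subset Metric_space.topspace_mtopology[OF Metric_space_words] by fastforce
  have space: "space P = words m"
    using sets_eq_imp_space_eq[OF P] Pow by (simp add: borel_words_def space_measure_of)
  have step: "(\<lambda>\<omega>. \<integral>x. cts_step a b x \<partial>\<eta> \<omega>) \<in> borel_measurable P" if "a < b" for a b
  proof (rule borel_measurable_LIMSEQ_real)
    show "(\<lambda>\<omega>. \<integral>x. cts_step a b x \<partial>\<mu> k \<omega>) \<in> borel_measurable P" for k
    proof -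
      have "(\<lambda>\<omega>. \<integral>x. cts_step a b x \<partial>\<mu> k \<omega>) \<in> borel_measurable (borel_words m)"
        by (rule cylinder_function_measurable[of m k]) (auto dest: loc[of _ _ k])
      then show ?thesis using measurable_cong_sets[OF P refl] by blast
    qed
    fix \<omega> assume "\<omega> \<in> space P"
    then have \<omega>: "\<omega> \<in> words m" by (simp add: space)
    show "(\<lambda>k. \<integral>x. cts_step a b x \<partial>\<mu> k \<omega>) \<longlonglongrightarrow> (\<integral>x. cts_step a b x \<partial>\<eta> \<omega>)"
    proof (rule weak_conv_imp_integral_bdd_continuous_conv[OF \<mu>[OF \<omega>] \<eta>[OF \<omega>] weak[OF \<omega>]])
      have "continuous_on UNIV (cts_step a b)"
        using uniformly_continuous_imp_continuous cts_step_uniformly_continuous that by blast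
      then show "isCont (cts_step a b) x" for x by (simp add: continuous_on_eq_continuous_at)
      show "norm (cts_step a b x) \<le> 1" for x using abs_cts_step_le_1[OF that] by simp
    qed
  qed
  have half: "(\<lambda>\<omega>. emeasure (\<eta> \<omega>) {..a}) \<in> borel_measurable P" for a
  proof -
    have "(\<lambda>\<omega>. measure (\<eta> \<omega>) {..a}) \<in> borel_measurable P"
    proof (rule borel_measurable_LIMSEQ_real)
      show "(\<lambda>\<omega>. \<integral>x. cts_step a (a + 1 / Suc n) x \<partial>\<eta> \<omega>) \<in> borel_measurable P" for n
        by (rule step) simp
      fix \<omega> assume "\<omega> \<in> space P"
      then interpret real_distribution "\<eta> \<omega>" using \<eta> by (simp add: space)
      have "(\<lambda>n. \<integral>x. cts_step a (a + 1 / Suc n) x \<partial>\<eta> \<omega>) \<longlonglongrightarrow> cdf (\<eta> \<omega>) a"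
      proof (rule tendsto_sandwich)
        show "\<forall>\<^sub>F n in sequentially. cdf (\<eta> \<omega>) a \<le> (\<integral>x. cts_step a (a + 1 / Suc n) x \<partial>\<eta> \<omega>)"
          "\<forall>\<^sub>F n in sequentially. (\<integral>x. cts_step a (a + 1 / Suc n) x \<partial>\<eta> \<omega>) \<le> cdf (\<eta> \<omega>) (a + 1 / Suc n)"
          by (intro always_eventually allI cdf_cts_step, simp)+
        have "filterlim (\<lambda>n. a + 1 / Suc n) (at_right a) sequentially"
          unfolding filterlim_at
        proof
          have "(\<lambda>n. a + inverse (real (Suc n))) \<longlonglongrightarrow> a + 0"
            by (intro tendsto_intros LIMSEQ_inverse_real_of_nat)
          then show "(\<lambda>n. a + 1 / Suc n) \<longlonglongrightarrow> a" by (simp add: inverse_eq_divide)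
        qed auto
        moreover have "(cdf (\<eta> \<omega>) \<longlongrightarrow> cdf (\<eta> \<omega>) a) (at_right a)"
          using cdf_is_right_cont[of a] by (simp add: continuous_within)
        ultimately show "(\<lambda>n. cdf (\<eta> \<omega>) (a + 1 / Suc n)) \<longlonglongrightarrow> cdf (\<eta> \<omega>) a"
          by (rule filterlim_compose[rotated])
      qed simp
      then show "(\<lambda>n. \<integral>x. cts_step a (a + 1 / Suc n) x \<partial>\<eta> \<omega>) \<longlonglongrightarrow> measure (\<eta> \<omega>) {..a}"
        by (simp add: cdf_def2)
    qed
    moreover have "emeasure (\<eta> \<omega>) {..a} = ennreal (measure (\<eta> \<omega>) {..a})" if "\<omega> \<in> space P" for \<omega>
    proof -
      interpret real_distribution "\<eta> \<omega>" using \<eta> that by (simp add: space)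
      show ?thesis by (rule emeasure_eq_measure)
    qed
    ultimately show ?thesis by (simp cong: measurable_cong)
  qed
  have "\<eta> \<in> measurable P (subprob_algebra borel)"
  proof (rule measurable_subprob_algebra_generated[where \<Omega> = UNIV and G = "range (\<lambda>a::real. {..a})"])
    show "sets borel = sigma_sets UNIV (range (\<lambda>a::real. {..a}))"
      by (subst borel_eq_atMost) simp
    show "Int_stable (range (\<lambda>a::real. {..a}))" by (auto simp: Int_stable_def)
    show "(\<lambda>\<omega>. emeasure (\<eta> \<omega>) A) \<in> borel_measurable P" if "A \<in> range (\<lambda>a::real. {..a})" for A
      using that half by auto
    fix \<omega> assume "\<omega> \<in> space P"
    then interpret real_distribution "\<eta> \<omega>" using \<eta> by (simp add: space)
    show "subprob_space (\<eta> \<omega>)" by (rule prob_space_imp_subprob_space) (rule prob_space_axioms)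
    show "sets (\<eta> \<omega>) = sets borel" by simp
  next
    have "emeasure (\<eta> \<omega>) UNIV = 1" if "\<omega> \<in> space P" for \<omega>
    proof -
      interpret real_distribution "\<eta> \<omega>" using \<eta> that by (simp add: space)
      show ?thesis using emeasure_space_1 by simp
    qed
    then show "(\<lambda>\<omega>. emeasure (\<eta> \<omega>) UNIV) \<in> borel_measurable P" by (simp cong: measurable_cong)
  qed simp
  moreover have "sets (\<eta> \<omega>) = sets borel" if "\<omega> \<in> space P" for \<omega>
    using \<eta> that by (simp add: space real_distribution.events_eq_borel)
  ultimately show ?thesis
    unfolding random_measure_def by (blast intro: measurable_emeasure_kernel)
qed

lemma conv_upto_cong: "(\<And>j. j \<le> k \<Longrightarrow> \<nu> j = \<nu>' j) \<Longrightarrow> conv_upto \<nu> k = conv_upto \<nu>' k"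
  by (induction k) simp_all

lemma mu_exp_eq_inf_convolution:
  assumes "\<And>j. B (\<omega> j) = {0..int (b (\<omega> j)) - 1}" "\<And>j. N (\<omega> j) \<ge> 0"
  shows "mu_exp N B n \<omega> = inf_convolution (digit_measure (\<lambda>i. nat (N (\<omega> i)) ^ n i) (\<lambda>i. b (\<omega> i)))"
proof -
  have "(\<lambda>x. inverse (\<Prod>i\<le>j. real_of_int (N (\<omega> i)) ^ n i) * real_of_int x) ` B (\<omega> j) =
      (\<lambda>d. real d / real (\<Prod>i<Suc j. nat (N (\<omega> i)) ^ n i)) ` {..<b (\<omega> j)}" for j
  proof -
    have "(\<Prod>i\<le>j. real_of_int (N (\<omega> i)) ^ n i) = real (\<Prod>i<Suc j. nat (N (\<omega> i)) ^ n i)"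
      unfolding lessThan_Suc_atMost of_nat_prod of_nat_power using assms(2) by simp
    moreover have "B (\<omega> j) = int ` {..<b (\<omega> j)}"
      unfolding assms(1) by (auto simp: image_iff intro!: bexI[of _ "nat _"])
    ultimately show ?thesis by (simp add: image_image divide_inverse mult.commute del: prod.lessThan_Suc)
  qed
  then show ?thesis unfolding mu_exp_def digit_measure_def by simp
qed

section \<open>From single words to random words\<close>

theorem corollary1p7:
  fixes m :: nat and N :: "nat \<Rightarrow> int" and B :: "nat \<Rightarrow> int set" and b :: "nat \<Rightarrow> nat"
    and n :: "nat \<Rightarrow> nat" and P :: "(nat \<Rightarrow> nat) measure"
  assumes "\<And>k. k \<in> {1..m} \<Longrightarrow> b k > 0"
    and "\<And>k. k \<in> {1..m} \<Longrightarrow> B k = {0..int (b k) - 1}"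
    and "\<And>k. k \<in> {1..m} \<Longrightarrow> admissible_pair (N k) (B k)"
    and "\<And>i. n i > 0"
    and "prob_space P" and "sets P = sets (borel_words m)"
    and "AE \<omega> in P. nondegenerate N B \<omega>"
  shows "spectral_random_measure P (mu_exp N B n) \<and>
         aleph1_spectral_eigen_set P (mu_exp N B n) (coprime_multipliers m b)"
proof -
  \<comment> \<open>The exponents remain a parameter because two systems are compared: the given
    exponents, and all exponents \<open>1\<close>, to which non-degeneracy refers.\<close>
  define M where "M = (\<lambda>(n :: nat \<Rightarrow> nat) (\<omega> :: nat \<Rightarrow> nat) i. nat (N (\<omega> i)) ^ n i)"
  define c where "c = (\<lambda>(\<omega> :: nat \<Rightarrow> nat) i. b (\<omega> i))"
  define q where "q = (\<lambda>n \<omega> i. M n \<omega> i div c \<omega> i)"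
  have pair: "N k \<ge> 2 \<and> b k \<ge> 2 \<and> b k dvd nat (N k)" if k: "k \<in> {1..m}" for k
  proof -
    have adm: "admissible_pair (N k) {0..int (b k) - 1}" using assms(2,3)[OF k] by simp
    then have "int (b k) dvd N k" by (rule admissible_pair_dvd)
    then have "nat (int (b k)) dvd nat (N k)"
      using adm by (subst nat_dvd_iff) (simp add: admissible_pair_def)
    with adm show ?thesis by (simp add: admissible_pair_def)
  qed
  have word: "\<omega> i \<in> {1..m}" if "\<omega> \<in> words m" for \<omega> i using that by (simp add: words_def)
  have system: "digit_system (M n \<omega>) (c \<omega>) (q n \<omega>)" if \<omega>: "\<omega> \<in> words m" and n: "\<And>i. n i > 0" for n \<omega>
  proof
    fix j
    have p: "N (\<omega> j) \<ge> 2" "b (\<omega> j) \<ge> 2" "b (\<omega> j) dvd nat (N (\<omega> j))" using pair[OF word[OF \<omega>]] by blast+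
    have "c \<omega> j dvd M n \<omega> j" unfolding c_def M_def using p(3) n[of j] by (metis dvd_power dvd_trans)
    then show eq: "M n \<omega> j = c \<omega> j * q n \<omega> j" by (simp add: q_def)
    show "c \<omega> j \<ge> 2" using p(2) by (simp add: c_def)
    have "M n \<omega> j > 0" using p(1) by (simp add: M_def)
    then show "q n \<omega> j > 0" unfolding eq by simp
  qed
  have mu_eq: "mu_exp N B n \<omega> = inf_convolution (digit_measure (M n \<omega>) (c \<omega>))" if \<omega>: "\<omega> \<in> words m" for n \<omega>
  proof -
    have "N (\<omega> j) \<ge> 0" for j using pair[OF word[OF \<omega>, of j]] by linarith
    then show ?thesis unfolding M_def c_def
      using assms(2) word[OF \<omega>] by (intro mu_exp_eq_inf_convolution) blast+
  qed
  have space: "space P = words m"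
  proof -
    have "{U. openin (Metric_space.mtopology (words m) word_dist) U} \<subseteq> Pow (words m)"
      using openin_subset Metric_space.topspace_mtopology[OF Metric_space_words] by fastforce
    then show ?thesis using sets_eq_imp_space_eq[OF assms(6)] by (simp add: borel_words_def space_measure_of)
  qed
  have quotients: "\<exists>J. \<forall>K0. \<exists>K\<ge>K0. T < (\<Prod>i<J. q n \<omega> (K + i))"
    if \<omega>: "\<omega> \<in> words m" and nondeg: "nondegenerate N B \<omega>" for \<omega> T
  proof -
    obtain r \<rho> where r: "strict_mono r" "real_distribution \<rho>" "mutually_singular \<rho> lborel"
      "weak_conv_m (\<lambda>j. nu_gt N B (r j) \<omega>) \<rho>"
      using nondeg by (auto simp: nondegenerate_def)
    let ?n = "\<lambda>_. 1 :: nat"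
    interpret digit_system "M ?n \<omega>" "c \<omega>" "q ?n \<omega>" by (rule system[OF \<omega>]) simp
    \<comment> \<open>A tail is the measure of the shifted word with unit exponents.\<close>
    have "nu_gt N B k \<omega> = inf_convolution (digit_measure (\<lambda>i. M ?n \<omega> (k + i)) (\<lambda>i. c \<omega> (k + i)))" for k
    proof -
      have "(\<lambda>i. \<omega> (k + i)) \<in> words m" using \<omega> by (simp add: words_def)
      moreover have "nu_gt N B k \<omega> = mu_exp N B ?n (\<lambda>i. \<omega> (k + i))" by (simp add: nu_gt_def mu_exp_def)
      ultimately show ?thesis using mu_eq by (simp add: M_def c_def)
    qed
    with r(4) obtain J where J: "\<And>K0. \<exists>K\<ge>K0. T < (\<Prod>i<J. q ?n \<omega> (K + i))"
      using singular_limit_imp_large_quotients[OF r(1-3), of T] by auto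
    \<comment> \<open>Raising exponents only enlarges the quotients, so large products found for
      unit exponents carry over to \<open>n\<close>.\<close>
    have "q ?n \<omega> i \<le> q n \<omega> i" for i
    proof -
      have "nat (N (\<omega> i)) ^ 1 \<le> nat (N (\<omega> i)) ^ n i"
        using pair[OF word[OF \<omega>, of i]] assms(4)[of i] by (intro power_increasing) auto
      then show ?thesis unfolding q_def M_def by (intro div_le_mono)
    qed
    then have "(\<Prod>i<J. q ?n \<omega> (K + i)) \<le> (\<Prod>i<J. q n \<omega> (K + i))" for K by (intro prod_mono) auto
    with J show ?thesis by (meson less_le_trans)
  qed
  have spectrum: "\<exists>X. countable X \<and> X \<noteq> {} \<and>
      (\<forall>t\<in>coprime_multipliers m b. \<forall>a. is_spectrum (mu_exp N B n \<omega>) ((\<lambda>x. t * x) ` (\<lambda>x. x + a) ` X))"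
    if \<omega>: "\<omega> \<in> words m" and nondeg: "nondegenerate N B \<omega>" for \<omega>
  proof -
    interpret digit_system "M n \<omega>" "c \<omega>" "q n \<omega>" by (rule system[OF \<omega> assms(4)])
    \<comment> \<open>Finiteness of the alphabet provides the uniform bound on digit counts.\<close>
    have "c \<omega> j \<le> Max (b ` {1..m})" for j
      unfolding c_def using word[OF \<omega>] by (intro Max_ge) auto
    then obtain X :: "real set" where X: "countable X" "X \<noteq> {}" "\<And>t a. t > 0 \<Longrightarrow> (\<And>j. coprime t (c \<omega> j)) \<Longrightarrow>
      is_spectrum infinite_measure ((\<lambda>x. real t * x) ` (\<lambda>x. x + a) ` X)"
      using ex_common_spectrum[OF _ quotients[OF \<omega> nondeg]] by blast
    show ?thesis
    proof (intro exI[of _ X] conjI X(1,2) ballI allI)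
      fix t a assume "t \<in> coprime_multipliers m b"
      then obtain s :: nat where s: "t = real s" "s > 0" "\<And>k. k \<in> {1..m} \<Longrightarrow> coprime s (b k)"
        by (auto simp: coprime_multipliers_def)
      then have "coprime s (c \<omega> j)" for j using word[OF \<omega>] by (simp add: c_def)
      then show "is_spectrum (mu_exp N B n \<omega>) ((\<lambda>x. t * x) ` (\<lambda>x. x + a) ` X)"
        unfolding mu_eq[OF \<omega>] s(1) using s(2) by (intro X(3))
    qed
  qed
  have one: "1 \<in> coprime_multipliers m b" by (auto simp: coprime_multipliers_def intro!: exI[of _ 1])
  have dist: "real_distribution (mu_exp N B n \<omega>)" if "\<omega> \<in> words m" for \<omega>
    unfolding mu_eq[OF that] by (rule digit_system.real_distribution_infinite_measure[OF system[OF that assms(4)]])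
  have "random_measure P (mu_exp N B n)"
  proof (rule random_measure_weak_limit[OF assms(6)])
    fix \<omega> assume \<omega>: "\<omega> \<in> words m"
    interpret digit_system "M n \<omega>" "c \<omega>" "q n \<omega>" by (rule system[OF \<omega> assms(4)])
    show "real_distribution (conv_upto (digit_measure (M n \<omega>) (c \<omega>)) k)" for k
      by (rule real_distribution_conv_digit)
    show "real_distribution (mu_exp N B n \<omega>)" by (rule dist[OF \<omega>])
    show "weak_conv_m (\<lambda>k. conv_upto (digit_measure (M n \<omega>) (c \<omega>)) k) (mu_exp N B n \<omega>)"
      unfolding mu_eq[OF \<omega>] by (rule weak_conv_infinite_measure)
  next
    fix k and \<alpha> \<beta> :: "nat \<Rightarrow> nat" assume eq: "\<And>i. i \<le> k \<Longrightarrow> \<alpha> i = \<beta> i"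
    show "conv_upto (digit_measure (M n \<alpha>) (c \<alpha>)) k = conv_upto (digit_measure (M n \<beta>) (c \<beta>)) k"
    proof (rule conv_upto_cong)
      fix j assume "j \<le> k"
      then have "(\<Prod>i<Suc j. M n \<alpha> i) = (\<Prod>i<Suc j. M n \<beta> i)" "c \<alpha> j = c \<beta> j"
        using eq by (auto intro!: prod.cong simp: M_def c_def simp del: prod.lessThan_Suc)
      then show "digit_measure (M n \<alpha>) (c \<alpha>) j = digit_measure (M n \<beta>) (c \<beta>) j"
        unfolding digit_measure_def by simp
    qed
  qed
  moreover have "AE \<omega> in P. spectral_measure (mu_exp N B n \<omega>)"
    using assms(7) AE_space
  proof eventually_elim
    case (elim \<omega>)
    then have \<omega>: "\<omega> \<in> words m" by (simp add: space)
    show ?case unfolding spectral_measure_def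
      using spectrum[OF \<omega> elim(1)] one dist[OF \<omega>] by blast
  qed
  moreover have "AE \<omega> in P. uncountable {\<Lambda>. \<forall>t\<in>coprime_multipliers m b. is_spectrum (mu_exp N B n \<omega>) ((\<lambda>l. t * l) ` \<Lambda>)}"
    using assms(7) AE_space
  proof eventually_elim
    case (elim \<omega>)
    then have \<omega>: "\<omega> \<in> words m" by (simp add: space)
    obtain X where X: "countable X" "X \<noteq> {}" "\<And>t a. t \<in> coprime_multipliers m b \<Longrightarrow>
        is_spectrum (mu_exp N B n \<omega>) ((\<lambda>x. t * x) ` (\<lambda>x. x + a) ` X)"
      using spectrum[OF \<omega> elim(1)] by blast
    have "range (\<lambda>a. (\<lambda>x. x + a) ` X) \<subseteq>
        {\<Lambda>. \<forall>t\<in>coprime_multipliers m b. is_spectrum (mu_exp N B n \<omega>) ((\<lambda>l. t * l) ` \<Lambda>)}"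
      using X(3) by auto
    then show ?case using uncountable_translates[OF X(1,2)] countable_subset by blast
  qed
  ultimately show ?thesis
    using one by (simp add: spectral_random_measure_def aleph1_spectral_eigen_set_def)
qed

end
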